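(* Let $G$ be a finite connected graph (multiple edges allowed) containing at least one edge. Assume $G$ has no loops and no pendant vertices. Let $n(G)$ be the number of vertices of $G$, and assume that $G$ admits an induced tree of order $n(G)-1$, i.e. there are $n(G)-1$ vertices of $G$ such that the subgraph of $G$ induced by them is a tree. Then $$\Lambda_1(G) = \big(1+\beta(G)\big)^2 \pi^2 ,$$ where $\beta(G)$ is the Betti number of $G$.
   Context: A pendant vertex is a vertex of degree one. The Betti number of a finite connected graph with $m(G)$ edges and $n(G)$ vertices is $\beta(G)=m(G)-n(G)+1$. The subgraph induced by a set of vertices contains all edges of $G$ (with multiplicity) both of whose endpoints lie in the set; a single vertex with no edges is a tree of order one. A metric on a finite connected graph $G$ with edge set $E \neq \emptyset$ is a function $\ell : E \to (0,\infty)$; the pair $(G,\ell)$ is a finite metric graph, in which each edge $e$ is identified with an interval in $\mathbb{R}$ of length $\ell(e)$. Its length is $L(G,\ell)=\sum_{e\in E}\ell(e)$. The (Neumann) eigenvalues of $(G,\ell)$ are the numbers $\lambda$ for which there is a nonzero continuous function $f$ on $G$ with $-f''=\lambda f$ on each edge and $\sum_{e\sim v} f'(v)=0$ at each vertex $v$, where the sum is over edges incident to $v$ and derivatives are taken in the direction away from $v$ into the edge. Counted with multiplicity they are indexed as $0=\lambda_0(G,\ell)<\lambda_1(G,\ell)\le\lambda_2(G,\ell)\le\dots$. Equivalently, $\lambda_j(G,\ell)=\min_W\max_{0\ne f\in W}\frac{\int_G|f'|^2}{\int_G|f|^2}$, the minimum over all $(j+1)$-dimensional subspaces $W$ of $H^1(G,\ell)$,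 the space of continuous functions $f:G\to\mathbb{R}$ that are in $H^1$ over each edge. $\Lambda_1(G)$ is the smallest number such that $\lambda_1(G,\ell)\le \Lambda_1(G)/L(G,\ell)^2$ for all metrics $\ell$ on $G$. *)

theory Defs
  imports "HOL-Analysis.Analysis" "HOL-Library.Function_Algebras" "Graph_Theory.Digraph_Component"
begin

text \<open>
  A finite multigraph is a \<^typ>\<open>('v, 'e) pre_digraph\<close> satisfying \<^const>\<open>fin_digraph\<close>.  The
  direction of an arc has no meaning for the graph itself: it only fixes the parametrisation
  of the edge \<open>e\<close> by the interval \<open>{0..l e}\<close>, running from \<open>tail G e\<close> (at 0) to
  \<open>head G e\<close> (at \<open>l e\<close>).  The notion \<^const>\<open>Digraph_Component.connected\<close> ignores directions, but
  \<^const>\<open>forest\<close> and \<^const>\<open>tree\<close> of Graph_Theory only exclude directed cycles, so they are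
  not the undirected notions needed here.
\<close>

definition vertex_degree :: "('v, 'e) pre_digraph \<Rightarrow> 'v \<Rightarrow> nat" where
  "vertex_degree G v = out_degree G v + in_degree G v"

definition pendant :: "('v, 'e) pre_digraph \<Rightarrow> 'v \<Rightarrow> bool" where
  "pendant G v \<longleftrightarrow> v \<in> verts G \<and> vertex_degree G v = 1"

definition betti :: "('v, 'e) pre_digraph \<Rightarrow> int" where
  "betti G = int (card (arcs G)) - int (card (verts G)) + 1"

text \<open>Loops (length 1) and pairs of parallel edges (length 2) count as cycles.\<close>

definition undirected_cycle :: "('v, 'e) pre_digraph \<Rightarrow> 'v list \<Rightarrow> 'e list \<Rightarrow> bool" where
  "undirected_cycle G vs es \<longleftrightarrow>
     es \<noteq> [] \<and> length vs = length es \<and> distinct vs \<and> distinct es \<and>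
     set vs \<subseteq> verts G \<and> set es \<subseteq> arcs G \<and>
     (\<forall>i < length es. {tail G (es ! i), head G (es ! i)} = {vs ! i, vs ! (Suc i mod length es)})"

definition undirected_tree :: "('v, 'e) pre_digraph \<Rightarrow> bool" where
  "undirected_tree G \<longleftrightarrow> Digraph_Component.connected G \<and> \<not> (\<exists>vs es. undirected_cycle G vs es)"

definition is_metric :: "('v, 'e) pre_digraph \<Rightarrow> ('e \<Rightarrow> real) \<Rightarrow> bool" where
  "is_metric G l \<longleftrightarrow> (\<forall>e \<in> arcs G. 0 < l e)"

definition total_length :: "('v, 'e) pre_digraph \<Rightarrow> ('e \<Rightarrow> real) \<Rightarrow> real" where
  "total_length G l = (\<Sum>e \<in> arcs G. l e)"

text \<open>
  A function on the metric graph is a family of functions \<open>f e\<close> on the intervals \<open>{0..l e}\<close>,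
  extended by 0 outside its domain so that distinct families are distinct functions on the
  metric graph.  Below, \<open>\<phi>\<close> gives the vertex values (continuity at the vertices) and \<open>g\<close> the
  edgewise derivative.  The derivatives at the ends of an edge are one-sided; the outgoing
  derivative is \<open>g e 0\<close> at the tail and \<open>- g e (l e)\<close> at the head.
\<close>

definition neumann_eigenspace ::
    "('v, 'e) pre_digraph \<Rightarrow> ('e \<Rightarrow> real) \<Rightarrow> real \<Rightarrow> ('e \<Rightarrow> real \<Rightarrow> real) set" where
  "neumann_eigenspace G l \<mu> = {f.
     (\<forall>e x. \<not> (e \<in> arcs G \<and> x \<in> {0..l e}) \<longrightarrow> f e x = 0) \<and>
     (\<exists>\<phi>. \<forall>e \<in> arcs G. f e 0 = \<phi> (tail G e) \<and> f e (l e) = \<phi> (head G e)) \<and>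
     (\<exists>g.
       (\<forall>e \<in> arcs G. \<forall>x \<in> {0..l e}.
          (f e has_real_derivative g e x) (at x within {0..l e}) \<and>
          (g e has_real_derivative - (\<mu> * f e x)) (at x within {0..l e})) \<and>
       (\<forall>v \<in> verts G. (\<Sum>e \<in> out_arcs G v. g e 0) + (\<Sum>e \<in> in_arcs G v. - g e (l e)) = 0))}"

definition neumann_eigenvalue :: "('v, 'e) pre_digraph \<Rightarrow> ('e \<Rightarrow> real) \<Rightarrow> real \<Rightarrow> bool" where
  "neumann_eigenvalue G l \<mu> \<longleftrightarrow> (\<exists>f \<in> neumann_eigenspace G l \<mu>. f \<noteq> 0)"

definition edge_scale :: "real \<Rightarrow> ('e \<Rightarrow> real \<Rightarrow> real) \<Rightarrow> ('e \<Rightarrow> real \<Rightarrow> real)" where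
  "edge_scale c f = (\<lambda>e x. c * f e x)"

global_interpretation edge_fun: vector_space edge_scale
  by unfold_locales (auto simp: edge_scale_def fun_eq_iff algebra_simps)

definition eigenvalue_multiplicity ::
    "('v, 'e) pre_digraph \<Rightarrow> ('e \<Rightarrow> real) \<Rightarrow> real \<Rightarrow> nat" where
  "eigenvalue_multiplicity G l \<mu> = edge_fun.dim (neumann_eigenspace G l \<mu>)"

text \<open>
  In the enumeration \<open>\<lambda>\<^sub>0 \<le> \<lambda>\<^sub>1 \<le> \<dots>\<close> of the eigenvalues with multiplicity, \<open>\<lambda>\<^sub>j\<close> is the least \<open>x\<close>
  for which more than \<open>j\<close> eigenvalues, counted with multiplicity, are at most \<open>x\<close>.  The finite
  sets \<open>S\<close> of eigenvalues are used for counting because a sum over an infinite set would be 0.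
\<close>

definition nth_eigenvalue ::
    "('v, 'e) pre_digraph \<Rightarrow> ('e \<Rightarrow> real) \<Rightarrow> nat \<Rightarrow> real" where
  "nth_eigenvalue G l j = Inf {x. \<exists>S. finite S \<and>
     (\<forall>\<mu> \<in> S. neumann_eigenvalue G l \<mu> \<and> \<mu> \<le> x) \<and> j < (\<Sum>\<mu> \<in> S. eigenvalue_multiplicity G l \<mu>)}"

definition Lambda1 :: "('v, 'e) pre_digraph \<Rightarrow> real" where
  "Lambda1 G = (LEAST C. \<forall>l. is_metric G l \<longrightarrow> nth_eigenvalue G l 1 \<le> C / (total_length G l)\<^sup>2)"

end

theory Submission
  imports Defs
begin

text \<open>
  Let \<open>c\<close> be the vertex outside the induced tree and \<open>d\<close> the number of arcs at \<open>c\<close>.  Counting arcs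
  gives \<open>d = 1 + \<beta>\<close>, so the claim is \<open>\<Lambda>\<^sub>1 = (d \<pi>)\<^sup>2\<close>.

  Fix a frequency \<open>\<kappa> > 0\<close>.  On a segment of length \<open>w\<close> with \<open>\<kappa> w < \<pi>\<close> a solution of \<open>f'' = - \<kappa>\<^sup>2 f\<close> is
  determined by its end values, and its outgoing derivatives at the ends are linear in them.
  After cutting the edges into sufficiently short segments, \<open>\<kappa>\<^sup>2\<close> is therefore an eigenvalue as
  soon as the quadratic form
  \<open>Q\<^sub>\<kappa> x = (\<Sum>e. ((x\<^sub>a\<^sup>2 + x\<^sub>b\<^sup>2) cos (\<kappa> w) - 2 x\<^sub>a x\<^sub>b) / sin (\<kappa> w))\<close> in the values at the
  nodes is singular (\<open>seg_form\<close>, \<open>eigenvalue_of_singular_vector\<close>).  Up to the factor \<open>\<kappa>\<close> this form is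
  the energy \<open>\<integral> f'\<^sup>2 - \<kappa>\<^sup>2 f\<^sup>2\<close> of the piecewise solution.

  Upper bound.  At low frequency \<open>Q\<close> is positive definite on a hyperplane.  Suppose that it still is
  at frequency \<open>K\<close>, and eliminate the variables of a spanning tree from the leaves towards \<open>c\<close>.  What
  has been eliminated behind a vertex \<open>v\<close> leaves a term \<open>cot \<theta> x\<^sub>v\<^sup>2\<close>, where \<open>\<theta> \<in> (0, \<pi>)\<close> is the
  Pruefer angle: it grows by \<open>K w\<close> along a segment, each passage through \<open>\<pi>\<close> reveals a negative
  direction of \<open>Q\<close> (and only one is available), and merging two branches at a vertex costs at most \<open>\<pi>\<close>
  (\<open>cot_sum_angle\<close>).  Adding up gives \<open>K L \<le> d \<pi>\<close> (\<open>grown_elimination\<close>, \<open>positive_imp_short\<close>).  So for every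
  \<open>K > d \<pi> / L\<close> the hyperplane is lost on the way up to \<open>K\<close>, and a continuous path of symmetric forms can
  lose it only by passing through a singular form (\<open>singular_crossing\<close>).  This yields an eigenvalue
  in \<open>(0, K\<^sup>2]\<close>.

  Lower bound.  Give the arcs at \<open>c\<close> length 1 and the arcs of the tree length \<open>\<delta>\<close>.  As \<open>\<delta>\<close> tends to 0
  the tree shrinks to a point, and the limit consists of \<open>d\<close> parallel edges of length 1, whose first
  positive eigenvalue is \<open>\<pi>\<^sup>2\<close> while its total length is \<open>d\<close>.  Quantitatively: adding a constant to an
  eigenfunction of frequency \<open>\<kappa> < \<pi>\<close> produces a nonzero vector \<open>y\<close> with \<open>Q\<^sub>\<kappa> y \<le> 0\<close> that takes
  opposite values at \<open>c\<close> and at a vertex \<open>r\<close> of the tree, whereas \<open>Q\<^sub>\<kappa>\<close> is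
  positive on such vectors for small \<open>\<delta>\<close>, uniformly for \<open>\<kappa>\<close> bounded away from \<open>\<pi>\<close>
  (\<open>contracted_form_positive\<close>, \<open>contracted_spectral_gap\<close>).
\<close>

section \<open>Angles and cotangents\<close>

lemma cot_diff_sin:
  fixes x y :: real
  assumes "sin x \<noteq> 0" "sin y \<noteq> 0"
  shows "cot x - cot y = sin (y - x) / (sin x * sin y)"
  using assms by (simp add: cot_def sin_diff field_simps)

lemma cot_decreasing:
  fixes x y :: real
  assumes "0 < x" "x < y" "y < pi"
  shows "cot y < cot x"
proof -
  have "sin x > 0" "sin y > 0" "sin (y - x) > 0"
    using assms by (auto intro!: sin_gt_zero)
  then have "cot x - cot y > 0"
    by (simp add: cot_diff_sin)
  then show ?thesis by simp
qed

lemma ex_angle_with_cot: "\<exists>\<gamma>::real. 0 < \<gamma> \<and> \<gamma> < pi \<and> cot \<gamma> = m"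
proof (intro exI conjI)
  show "0 < pi/2 - arctan m" "pi/2 - arctan m < pi"
    using arctan_lbound[of m] arctan_ubound[of m] by linarith+
  show "cot (pi/2 - arctan m) = m"
    using tan_arctan[of m] by (simp add: cot_def cos_diff sin_diff tan_def)
qed

text \<open>
  Merging two branches of a tree adds the cotangents of their angles; the new angle falls short of the
  sum of the old ones by at most \<open>\<pi>\<close>.  If \<open>\<delta> = \<alpha> + \<beta> - \<pi>\<close> is positive, then \<open>cot \<delta> = cot (\<alpha> + \<beta>)\<close>, and
  \<open>cot (\<alpha> + \<beta>) \<ge> cot \<alpha> + cot \<beta>\<close> reduces to the positivity of \<open>p\<^sup>2 + p q + q\<^sup>2\<close> with
  \<open>p = sin \<alpha> cos \<beta>\<close> and \<open>q = cos \<alpha> sin \<beta>\<close>.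
\<close>
lemma cot_sum_angle:
  fixes \<alpha> \<beta> :: real
  assumes "0 < \<alpha>" "\<alpha> < pi" "0 < \<beta>" "\<beta> < pi"
  shows "\<exists>\<gamma>. 0 < \<gamma> \<and> \<gamma> < pi \<and> cot \<gamma> = cot \<alpha> + cot \<beta> \<and> \<alpha> + \<beta> - pi \<le> \<gamma>"
proof -
  obtain \<gamma> :: real where \<gamma>: "0 < \<gamma>" "\<gamma> < pi" "cot \<gamma> = cot \<alpha> + cot \<beta>"
    using ex_angle_with_cot by blast
  have "\<alpha> + \<beta> - pi \<le> \<gamma>"
  proof (rule ccontr)
    define \<delta> where "\<delta> = \<alpha> + \<beta> - pi"
    assume "\<not> \<alpha> + \<beta> - pi \<le> \<gamma>"
    then have d: "\<gamma> < \<delta>" "\<delta> < pi" using assms by (auto simp: \<delta>_def)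
    then have "cot \<delta> < cot \<alpha> + cot \<beta>" using cot_decreasing[of \<gamma> \<delta>] \<gamma> by simp
    moreover have sd: "sin \<delta> = - sin (\<alpha> + \<beta>)" "cos \<delta> = - cos (\<alpha> + \<beta>)"
      by (simp_all add: \<delta>_def sin_diff cos_diff)
    moreover have "sin \<delta> > 0" using d \<gamma> by (intro sin_gt_zero) auto
    moreover have pos: "sin \<alpha> > 0" "sin \<beta> > 0" using assms by (auto intro!: sin_gt_zero)
    moreover have "cot \<alpha> + cot \<beta> = sin (\<alpha> + \<beta>) / (sin \<alpha> * sin \<beta>)"
      using pos by (simp add: cot_def sin_add field_simps)
    ultimately have "cos \<delta> / sin \<delta> < - sin \<delta> / (sin \<alpha> * sin \<beta>)"
      by (simp add: cot_def)
    then have "cos \<delta> * (sin \<alpha> * sin \<beta>) < - sin \<delta> * sin \<delta>"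
      using \<open>sin \<delta> > 0\<close> pos by (simp add: field_simps)
    then have "sin \<delta> * sin \<delta> < cos (\<alpha> + \<beta>) * (sin \<alpha> * sin \<beta>)"
      using sd by simp
    then have "sin (\<alpha> + \<beta>) ^ 2 < cos (\<alpha> + \<beta>) * (sin \<alpha> * sin \<beta>)"
      using sd by (simp add: power2_eq_square)
    then have "(sin \<alpha> * cos \<beta>)^2 + (cos \<alpha> * sin \<beta>)^2 + (sin \<alpha> * cos \<beta>) * (cos \<alpha> * sin \<beta>)
        + (sin \<alpha> * sin \<beta>)^2 < 0"
      by (simp add: sin_add cos_add power2_eq_square algebra_simps)
    moreover have "0 \<le> p^2 + q^2 + p * q" for p q :: real
    proof -
      have "p^2 + q^2 + p * q = (p + q/2)^2 + 3/4 * q^2" by (simp add: power2_eq_square algebra_simps)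
      then show ?thesis by simp
    qed
    ultimately show False
      by (smt (verit, best) zero_le_power2)
  qed
  with \<gamma> show ?thesis by blast
qed

text \<open>
  The effect of a segment of phase \<open>s\<close> on the Pruefer angle: eliminating the far variable from
  \<open>cot \<theta> t\<^sup>2 + ((y\<^sup>2 + t\<^sup>2) cos s - 2 t y) / sin s\<close> leaves \<open>cot (\<theta> + s) y\<^sup>2\<close>.  The sign of the pivot
  \<open>cot \<theta> + cot s\<close> is that of \<open>sin (\<theta> + s)\<close>, so it records whether the angle has passed \<open>\<pi>\<close>.
\<close>
lemma cot_shift:
  fixes \<theta> s :: real
  assumes "0 < \<theta>" "\<theta> < pi" "0 < s" "s < pi" "\<theta> + s \<noteq> pi"
  shows "cot \<theta> + cot s = sin (\<theta> + s) / (sin \<theta> * sin s)"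
    and "sin (\<theta> + s) \<noteq> 0"
    and "cot (\<theta> + s) = cot s - 1 / ((cot \<theta> + cot s) * (sin s)\<^sup>2)"
proof -
  have pos: "sin \<theta> > 0" "sin s > 0" using assms by (auto intro!: sin_gt_zero)
  show 1: "cot \<theta> + cot s = sin (\<theta> + s) / (sin \<theta> * sin s)"
    using pos by (simp add: cot_def sin_add field_simps)
  show 2: "sin (\<theta> + s) \<noteq> 0"
  proof
    assume "sin (\<theta> + s) = 0"
    then have "sin (\<theta> + s - pi) = 0" by (simp add: sin_diff)
    then show False using assms sin_eq_0_pi[of "\<theta> + s - pi"] by auto
  qed
  have "cot s - 1 / ((cot \<theta> + cot s) * (sin s)\<^sup>2) = (cos s * sin (\<theta> + s) - sin \<theta>) / (sin s * sin (\<theta> + s))"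
    unfolding 1 using pos 2 by (simp add: cot_def field_simps power2_eq_square)
  also have "sin \<theta> = sin (\<theta> + s) * cos s - cos (\<theta> + s) * sin s"
    using sin_diff[of "\<theta> + s" s] by simp
  also have "(cos s * sin (\<theta> + s) - (sin (\<theta> + s) * cos s - cos (\<theta> + s) * sin s)) / (sin s * sin (\<theta> + s)) = cot (\<theta> + s)"
    using pos 2 by (simp add: cot_def field_simps)
  finally show "cot (\<theta> + s) = cot s - 1 / ((cot \<theta> + cot s) * (sin s)\<^sup>2)" by simp
qed

text \<open>
  A load is a family of angles \<open>\<theta> v\<close> on a set \<open>B\<close> of vertices, standing for the quadratic form
  \<open>\<Sum>v\<in>B. cot (\<theta> v) x\<^sub>v\<^sup>2\<close>.  Measured by \<open>\<theta> - \<pi>\<close>, the loss in \<open>cot_sum_angle\<close> disappears: the measure of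
  a load does not decrease when another term is added to it.
\<close>
lemma load_add:
  fixes \<theta> :: "'n \<Rightarrow> real"
  assumes "finite B" "\<forall>v\<in>B. 0 < \<theta> v \<and> \<theta> v < pi" "0 < \<tau>" "\<tau> < pi"
  shows "\<exists>\<theta>'. (\<forall>v\<in>insert u B. 0 < \<theta>' v \<and> \<theta>' v < pi) \<and>
     (\<forall>x. (\<Sum>v\<in>insert u B. cot (\<theta>' v) * (x v)\<^sup>2) = (\<Sum>v\<in>B. cot (\<theta> v) * (x v)\<^sup>2) + cot \<tau> * (x u)\<^sup>2) \<and>
     (\<Sum>v\<in>B. \<theta> v - pi) + (\<tau> - pi) \<le> (\<Sum>v\<in>insert u B. \<theta>' v - pi)"
proof -
  define C where "C = B - {u}"
  have C: "finite C" "u \<notin> C" "insert u B = insert u C" using assms(1) by (auto simp: C_def)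
  obtain \<gamma> where \<gamma>: "0 < \<gamma>" "\<gamma> < pi"
    "cot \<gamma> = (if u \<in> B then cot (\<theta> u) + cot \<tau> else cot \<tau>)"
    "(if u \<in> B then \<theta> u + \<tau> - pi else \<tau>) \<le> \<gamma>"
    using cot_sum_angle[of "\<theta> u" \<tau>] assms by (cases "u \<in> B") auto
  have B: "sum f B = sum f C + (if u \<in> B then f u else 0)" for f :: "'n \<Rightarrow> real"
    using assms(1) by (auto simp: C_def sum.remove[of B u])
  have upd: "(\<Sum>v\<in>C. g (if v = u then \<gamma> else \<theta> v) v) = (\<Sum>v\<in>C. g (\<theta> v) v)" for g :: "real \<Rightarrow> 'n \<Rightarrow> real"
    using C(2) by (intro sum.cong) auto
  show ?thesis
  proof (intro exI[of _ "\<theta>(u := \<gamma>)"] conjI allI)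
    show "\<forall>v\<in>insert u B. 0 < (\<theta>(u := \<gamma>)) v \<and> (\<theta>(u := \<gamma>)) v < pi" using \<gamma> assms by auto
  next
    fix x :: "'n \<Rightarrow> real"
    show "(\<Sum>v\<in>insert u B. cot ((\<theta>(u := \<gamma>)) v) * (x v)\<^sup>2) = (\<Sum>v\<in>B. cot (\<theta> v) * (x v)\<^sup>2) + cot \<tau> * (x u)\<^sup>2"
      unfolding C(3) B using C \<gamma>(3) upd[of "\<lambda>t v. cot t * (x v)\<^sup>2"]
      by (simp add: fun_upd_def algebra_simps)
  next
    show "(\<Sum>v\<in>B. \<theta> v - pi) + (\<tau> - pi) \<le> (\<Sum>v\<in>insert u B. (\<theta>(u := \<gamma>)) v - pi)"
      unfolding C(3) B using C \<gamma>(4) upd[of "\<lambda>t v. t - pi"] by (auto simp: fun_upd_def)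
  qed
qed

section \<open>The energy form of a tree and its elimination\<close>

text \<open>
  Multiplied by \<open>\<kappa>\<close>, and with \<open>s e = \<kappa> w e\<close>, this is \<open>\<integral> f' g' - \<kappa>\<^sup>2 f g\<close> for the functions \<open>f, g\<close> that
  solve the eigenvalue equation of frequency \<open>\<kappa>\<close> on every segment and take the values \<open>x, y\<close> at its ends
  \<open>a e\<close> and \<open>b e\<close>.
\<close>
definition seg_form :: "('s \<Rightarrow> 'n) \<Rightarrow> ('s \<Rightarrow> 'n) \<Rightarrow> ('s \<Rightarrow> real) \<Rightarrow> 's set \<Rightarrow> ('n \<Rightarrow> real) \<Rightarrow> ('n \<Rightarrow> real) \<Rightarrow> real" where
  "seg_form a b s E x y = (\<Sum>e\<in>E. ((x (a e) * y (a e) + x (b e) * y (b e)) * cos (s e)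
       - x (a e) * y (b e) - x (b e) * y (a e)) / sin (s e))"

text \<open>
  A tree with vertex set \<open>R\<close> and edge set \<open>F\<close>, built from the root \<open>r\<close> by attaching one new vertex at a
  time.  The multigraph is given by the end maps \<open>a\<close> and \<open>b\<close> only, so that the same notion serves the
  original graph and its subdivisions.  Reversing the construction is an elimination order: the vertex
  attached last is a leaf.
\<close>
inductive grown :: "('s \<Rightarrow> 'n) \<Rightarrow> ('s \<Rightarrow> 'n) \<Rightarrow> 'n \<Rightarrow> 'n set \<Rightarrow> 's set \<Rightarrow> bool"
  for a b :: "'s \<Rightarrow> 'n" and r :: 'n where
  root: "grown a b r {r} {}"
| grow: "grown a b r R F \<Longrightarrow> u \<in> R \<Longrightarrow> w \<notin> R \<Longrightarrow> (a e = u \<and> b e = w) \<or> (a e = w \<and> b e = u) \<Longrightarrow>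
     grown a b r (insert w R) (insert e F)"

lemma grown_basic:
  assumes "grown a b r R F"
  shows "finite R \<and> finite F \<and> r \<in> R \<and> (\<forall>e\<in>F. a e \<in> R \<and> b e \<in> R \<and> a e \<noteq> b e)"
  using assms by induction auto

definition linear_functional :: "(('n \<Rightarrow> real) \<Rightarrow> real) \<Rightarrow> bool" where
  "linear_functional \<phi> \<longleftrightarrow> (\<forall>x y c. \<phi> (\<lambda>v. x v + c * y v) = \<phi> x + c * \<phi> y)"

definition supported_in :: "('n \<Rightarrow> real) \<Rightarrow> 'n set \<Rightarrow> bool" where
  "supported_in x R \<longleftrightarrow> (\<forall>v. v \<notin> R \<longrightarrow> x v = 0)"

lemma complete_square:
  fixes c m t y S C cth q :: real
  assumes "c = cth + C / S" "m = 1 / (c * S)" "q = C / S - 1 / (c * S\<^sup>2)" "S \<noteq> 0" "c \<noteq> 0"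
  shows "cth * t\<^sup>2 + ((y\<^sup>2 + t\<^sup>2) * C - 2 * t * y) / S = c * (t - m * y)\<^sup>2 + q * y\<^sup>2"
proof -
  have "c * (t - m * y)\<^sup>2 = c * t\<^sup>2 - 2 * (c * m) * t * y + (c * m) * m * y\<^sup>2"
    by (simp add: power2_eq_square algebra_simps)
  also have cm: "c * m = 1 / S" using assms by simp
  finally have 1: "c * (t - m * y)\<^sup>2 = c * t\<^sup>2 - 2 / S * t * y + m / S * y\<^sup>2" by simp
  have "m / S = 1 / (c * S\<^sup>2)" using assms by (simp add: power2_eq_square)
  then have 2: "m / S = C / S - q" using assms(3) by simp
  have "cth * t\<^sup>2 + ((y\<^sup>2 + t\<^sup>2) * C - 2 * t * y) / S = c * t\<^sup>2 - 2 / S * t * y + C / S * y\<^sup>2"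
    unfolding assms(1) by (simp add: algebra_simps add_divide_distrib diff_divide_distrib)
  then show ?thesis unfolding 1 2 by (simp add: algebra_simps)
qed

text \<open>
  Gaussian elimination along a tree with Dirichlet condition at the root.  The load on \<open>B\<close> stands for the
  branches that are already eliminated; \<open>k\<close> counts the pivots that turned out negative.  As the form is
  positive on the hyperplane \<open>\<phi> = 0\<close>, at most one pivot is negative, and after it has occurred the
  remaining form is positive everywhere (\<open>\<phi> = 0\<close> identically).  The vertex \<open>w\<close> attached last
  is a leaf, hence loaded; pushing its load across its edge to the neighbour \<open>u\<close> replaces \<open>\<theta> w\<close> by
  \<open>\<theta> w + s e - j \<pi>\<close> with \<open>j \<in> {0, 1}\<close> and raises \<open>k\<close> by \<open>j\<close>, so the left-hand side
  \<open>k \<pi> + \<Sum>(\<theta> - \<pi>) + \<Sum>s\<close> does not decrease.  At the root alone it is visibly at most \<open>\<pi>\<close>.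
\<close>
lemma grown_elimination:
  assumes "grown a b r R F"
  shows "B \<subseteq> R \<Longrightarrow> \<forall>v\<in>B. 0 < \<theta> v \<and> \<theta> v < pi \<Longrightarrow> \<forall>e\<in>F. 0 < s e \<and> s e < pi \<Longrightarrow>
    \<forall>v\<in>R - {r}. v \<in> B \<or> 2 \<le> card {e\<in>F. a e = v \<or> b e = v} \<Longrightarrow>
    linear_functional \<phi> \<Longrightarrow> k = 0 \<or> k = (1::nat) \<and> \<phi> = (\<lambda>_. 0) \<Longrightarrow>
    (\<And>x. supported_in x R \<Longrightarrow> x r = 0 \<Longrightarrow> \<exists>v. x v \<noteq> 0 \<Longrightarrow> \<phi> x = 0 \<Longrightarrow>
       0 < seg_form a b s F x x + (\<Sum>v\<in>B. cot (\<theta> v) * (x v)\<^sup>2)) \<Longrightarrow>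
    k * pi + (\<Sum>v\<in>B. \<theta> v - pi) + (\<Sum>e\<in>F. s e) \<le> pi"
  using assms
proof (induction arbitrary: B \<theta> \<phi> k rule: grown.induct)
  case (root B \<theta> \<phi> k)
  have "(\<Sum>v\<in>B. \<theta> v - pi) \<le> 0" using root by (intro sum_nonpos) auto
  moreover have "k * pi \<le> pi" using root(6) by auto
  ultimately show ?case by (simp only: sum.empty)
next
  case (grow R F u w e B \<theta> \<phi> k)
  note basic = grown_basic[OF grow.hyps(1)]
  have fin: "finite R" "finite F" "finite B" using basic finite_subset[OF grow.prems(1)] by auto
  have eF: "e \<notin> F" using basic grow.hyps(3,4) by auto
  have wr: "w \<noteq> r" using basic grow.hyps(3) by auto
  have "{e'\<in>insert e F. a e' = w \<or> b e' = w} = {e}"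
    using basic grow.hyps by auto
  then have wB: "w \<in> B" using grow.prems(4) wr by force
  have s: "0 < s e" "s e < pi" and sF: "\<forall>e\<in>F. 0 < s e \<and> s e < pi" using grow.prems(3) by auto
  define S where "S = (\<Sum>v\<in>B - {w}. \<theta> v - pi)"
  have SB: "(\<Sum>v\<in>B. \<theta> v - pi) = S + (\<theta> w - pi)" using fin wB by (simp add: S_def sum.remove[of B w])
  show ?case
  proof (rule ccontr)
    assume neg: "\<not> ?thesis"
    then have big: "k * pi + S + (\<theta> w - pi) + (\<Sum>e\<in>F. s e) + s e > pi"
      using eF fin SB by simp
    \<comment> \<open>If the angle arrives exactly at \<open>\<pi>\<close>, the pivot is 0.  Lowering the angle slightly makes the form larger,
      hence keeps it positive, and there is room for it in the strict inequality \<open>big\<close>.\<close>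
    obtain \<eta> where \<eta>: "0 < \<eta>" "\<eta> \<le> \<theta> w" "\<eta> + s e \<noteq> pi"
      "k * pi + S + (\<eta> - pi) + (\<Sum>e\<in>F. s e) + s e > pi"
    proof (cases "\<theta> w + s e = pi")
      case False then show ?thesis using that[of "\<theta> w"] big grow.prems(2) wB by auto
    next
      case True
      define g where "g = k * pi + S + (\<theta> w - pi) + (\<Sum>e\<in>F. s e) + s e - pi"
      have "g > 0" "\<theta> w > 0" using big grow.prems(2) wB by (auto simp: g_def)
      define h where "h = min (g/2) (\<theta> w / 2)"
      have "0 < h" "h < \<theta> w" "h < g" using \<open>g > 0\<close> \<open>\<theta> w > 0\<close> unfolding h_def by linarith+
      show ?thesis
      proof (rule that[of "\<theta> w - h"])
        show "0 < \<theta> w - h" "\<theta> w - h \<le> \<theta> w" "\<theta> w - h + s e \<noteq> pi"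
          using \<open>0 < h\<close> \<open>h < \<theta> w\<close> True by linarith+
        show "k * pi + S + (\<theta> w - h - pi) + (\<Sum>e\<in>F. s e) + s e > pi"
          using \<open>h < g\<close> unfolding g_def by linarith
      qed
    qed
    have \<eta>pi: "\<eta> < pi" using \<eta> grow.prems(2) wB by force
    have cotle: "cot (\<theta> w) \<le> cot \<eta>"
      using cot_decreasing[of \<eta> "\<theta> w"] \<eta> grow.prems(2) wB by (cases "\<eta> = \<theta> w") auto
    define c where "c = cot \<eta> + cot (s e)"
    define m where "m = 1 / (c * sin (s e))"
    note shift = cot_shift[OF \<eta>(1) \<eta>pi s \<eta>(3)]
    have sin_pos: "sin \<eta> > 0" "sin (s e) > 0" using \<eta> \<eta>pi s by (auto intro!: sin_gt_zero)
    define j where "j = (if \<eta> + s e < pi then 0 else 1 :: nat)"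
    define \<tau> where "\<tau> = \<eta> + s e - j * pi"
    have \<tau>: "0 < \<tau>" "\<tau> < pi" using \<eta> \<eta>pi s by (auto simp: \<tau>_def j_def)
    have cot\<tau>: "cot \<tau> = cot (\<eta> + s e)" by (auto simp: \<tau>_def j_def cot_def sin_diff cos_diff)
    have csgn: "if j = 0 then c > 0 else c < 0"
    proof (cases "j = 0")
      case True
      then have "sin (\<eta> + s e) > 0" using \<eta> s by (intro sin_gt_zero) (auto simp: j_def split: if_splits)
      then show ?thesis using True shift(1) sin_pos by (simp add: c_def)
    next
      case False
      have "sin \<tau> > 0" using \<tau> by (intro sin_gt_zero)
      moreover have "sin \<tau> = - sin (\<eta> + s e)"
        using False by (simp add: \<tau>_def j_def sin_diff split: if_splits)
      ultimately have "sin (\<eta> + s e) < 0" by simp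
      then show ?thesis using False shift(1) sin_pos by (simp add: c_def divide_neg_pos)
    qed
    then have c0: "c \<noteq> 0" by (auto split: if_splits)
    obtain \<theta>' where \<theta>': "\<forall>v\<in>insert u (B - {w}). 0 < \<theta>' v \<and> \<theta>' v < pi"
      "\<And>x. (\<Sum>v\<in>insert u (B - {w}). cot (\<theta>' v) * (x v)\<^sup>2) = (\<Sum>v\<in>B - {w}. cot (\<theta> v) * (x v)\<^sup>2) + cot \<tau> * (x u)\<^sup>2"
      "S + (\<tau> - pi) \<le> (\<Sum>v\<in>insert u (B - {w}). \<theta>' v - pi)"
      using load_add[of "B - {w}" \<theta> \<tau> u] fin grow.prems(2) \<tau> unfolding S_def by auto
    define Q where "Q = (\<lambda>x. seg_form a b s F x x + (\<Sum>v\<in>insert u (B - {w}). cot (\<theta>' v) * (x v)\<^sup>2))"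
    \<comment> \<open>Completing the square in the value \<open>t\<close> at the leaf.\<close>
    have Q: "seg_form a b s (insert e F) (x(w := t)) (x(w := t)) + (\<Sum>v\<in>B. cot (\<theta> v) * ((x(w := t)) v)\<^sup>2)
        \<le> c * (t - m * x u)\<^sup>2 + Q x" for x t
    proof -
      have uw: "u \<noteq> w" using grow.hyps by auto
      have 1: "seg_form a b s F (x(w := t)) (x(w := t)) = seg_form a b s F x x"
        unfolding seg_form_def using basic grow.hyps(3) by (intro sum.cong) auto
      have "seg_form a b s (insert e F) y y
         = (((y u)\<^sup>2 + (y w)\<^sup>2) * cos (s e) - 2 * y w * y u) / sin (s e) + seg_form a b s F y y" for y
        unfolding seg_form_def sum.insert[OF fin(2) eF] using grow.hyps(4)
        by (auto simp: power2_eq_square add.commute)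
      from this[of "x(w := t)"]
      have 2: "seg_form a b s (insert e F) (x(w := t)) (x(w := t))
         = (((x u)\<^sup>2 + t\<^sup>2) * cos (s e) - 2 * t * x u) / sin (s e) + seg_form a b s F x x"
        using uw 1 by simp
      have 3: "(\<Sum>v\<in>B. cot (\<theta> v) * ((x(w := t)) v)\<^sup>2) = cot (\<theta> w) * t\<^sup>2 + (\<Sum>v\<in>B - {w}. cot (\<theta> v) * (x v)\<^sup>2)"
        using fin wB by (simp add: sum.remove[of B w])
      have "cot \<tau> = cos (s e) / sin (s e) - 1 / (c * (sin (s e))\<^sup>2)"
        unfolding cot\<tau> shift(3) c_def by (simp only: cot_def)
      moreover have "c = cot \<eta> + cos (s e) / sin (s e)" by (simp only: c_def cot_def)
      ultimately have 4: "cot \<eta> * t\<^sup>2 + (((x u)\<^sup>2 + t\<^sup>2) * cos (s e) - 2 * t * x u) / sin (s e)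
           = c * (t - m * x u)\<^sup>2 + cot \<tau> * (x u)\<^sup>2"
        using c0 sin_pos(2) by (intro complete_square) (simp_all add: m_def)
      have "cot (\<theta> w) * t\<^sup>2 \<le> cot \<eta> * t\<^sup>2" using cotle by (simp add: mult_right_mono)
      with 2 3 4 \<theta>'(2)[of x] show ?thesis unfolding Q_def by linarith
    qed
    have B': "insert u (B - {w}) \<subseteq> R" using grow.prems(1) grow.hyps by auto
    have deg': "\<forall>v\<in>R - {r}. v \<in> insert u (B - {w}) \<or> 2 \<le> card {e\<in>F. a e = v \<or> b e = v}"
    proof
      fix v assume v: "v \<in> R - {r}"
      show "v \<in> insert u (B - {w}) \<or> 2 \<le> card {e\<in>F. a e = v \<or> b e = v}"
      proof (cases "v = u \<or> v \<in> B")
        case True then show ?thesis using v grow.hyps(3) by auto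
      next
        case False
        then have "{e'\<in>insert e F. a e' = v \<or> b e' = v} = {e\<in>F. a e = v \<or> b e = v}"
          using v grow.hyps by auto
        moreover have "2 \<le> card {e'\<in>insert e F. a e' = v \<or> b e' = v}"
          using grow.prems(4) v False by blast
        ultimately show ?thesis by simp
      qed
    qed
    have ext: "supported_in (x(w := t)) (insert w R)" "(x(w := t)) r = x r" if "supported_in x R" for x t
      using that wr by (auto simp: supported_in_def)
    have pd: "0 < c * (t - m * x u)\<^sup>2 + Q x" if "supported_in x R" "x r = 0" "\<exists>v. (x(w:=t)) v \<noteq> 0" "\<phi> (x(w:=t)) = 0" for x t
    proof -
      have "(x(w:=t)) r = 0" using ext(2)[OF that(1)] that(2) by metis
      then have "0 < seg_form a b s (insert e F) (x(w := t)) (x(w := t)) + (\<Sum>v\<in>B. cot (\<theta> v) * ((x(w := t)) v)\<^sup>2)"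
        by (rule grow.prems(7)[OF ext(1)[OF that(1)] _ that(3,4)])
      then show ?thesis using Q[where x = x and t = t] by linarith
    qed
    have xw: "x w = 0" if "supported_in x R" for x using that grow.hyps(3) by (simp add: supported_in_def)
    have final: "\<exists>\<phi>'. linear_functional \<phi>' \<and> (k + j = 0 \<or> k + j = 1 \<and> \<phi>' = (\<lambda>_. 0)) \<and>
       (\<forall>x. supported_in x R \<longrightarrow> x r = 0 \<longrightarrow> (\<exists>v. x v \<noteq> 0) \<longrightarrow> \<phi>' x = 0 \<longrightarrow> 0 < Q x)"
    proof (cases "j = 0")
      case True
      \<comment> \<open>Positive pivot: restrict the form to the minimising value at the leaf.\<close>
      define \<phi>' where "\<phi>' = (\<lambda>x. \<phi> (\<lambda>v. if v = w then m * x u else x v))"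
      have "linear_functional \<phi>'"
        unfolding linear_functional_def
      proof (intro allI)
        fix x y d
        have "(\<lambda>v. if v = w then m * (x u + d * y u) else x v + d * y v)
           = (\<lambda>v. (if v = w then m * x u else x v) + d * (if v = w then m * y u else y v))"
          by (auto simp: algebra_simps)
        then show "\<phi>' (\<lambda>v. x v + d * y v) = \<phi>' x + d * \<phi>' y"
          using grow.prems(5) unfolding \<phi>'_def linear_functional_def by simp
      qed
      moreover have "k + j = 0 \<or> k + j = 1 \<and> \<phi>' = (\<lambda>_. 0)" using grow.prems(6) True by (auto simp: \<phi>'_def)
      moreover have "0 < Q x" if x: "supported_in x R" "x r = 0" "\<exists>v. x v \<noteq> 0" "\<phi>' x = 0" for x
      proof -
        have "\<exists>v. (x(w := m * x u)) v \<noteq> 0" using x(1,3) xw[OF x(1)] by auto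
        moreover have "\<phi> (x(w := m * x u)) = 0" using x(4) unfolding \<phi>'_def fun_upd_def by simp
        ultimately show ?thesis using pd[of x "m * x u"] x by simp
      qed
      ultimately show ?thesis by blast
    next
      case False
      then have cneg: "c < 0" "j = 1" using csgn by (auto simp: j_def split: if_splits)
      \<comment> \<open>Negative pivot: the indicator \<open>z\<close> of the leaf is a negative direction, so the hyperplane does not
        contain it, and every vector on the smaller tree extends into the hyperplane.\<close>
      define z where "z = (\<lambda>_. 0::real)(w := 1)"
      have z: "\<phi> z \<noteq> 0"
      proof
        assume "\<phi> z = 0"
        then have "0 < c * (1 - m * 0)\<^sup>2 + Q (\<lambda>_. 0)"
          using pd[of "\<lambda>_. 0" 1] by (auto simp: z_def supported_in_def)
        then show False using cneg by (simp add: Q_def seg_form_def)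
      qed
      then have "k = 0" using grow.prems(6) by auto
      moreover have "0 < Q x" if x: "supported_in x R" "x r = 0" "\<exists>v. x v \<noteq> 0" for x
      proof -
        define t where "t = - \<phi> x / \<phi> z"
        have "x(w := t) = (\<lambda>v. x v + t * z v)" using xw[OF x(1)] by (auto simp: z_def)
        then have "\<phi> (x(w := t)) = \<phi> x + t * \<phi> z" using grow.prems(5) unfolding linear_functional_def by simp
        then have "\<phi> (x(w := t)) = 0" using z by (simp add: t_def)
        moreover have "\<exists>v. (x(w := t)) v \<noteq> 0" using x(3) xw[OF x(1)] by auto
        ultimately have "0 < c * (t - m * x u)\<^sup>2 + Q x" using pd x by blast
        moreover have "c * (t - m * x u)\<^sup>2 \<le> 0" using cneg by (simp add: mult_nonpos_nonneg)
        ultimately show ?thesis by linarith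
      qed
      ultimately show ?thesis using cneg by (intro exI[of _ "\<lambda>_. 0"]) (auto simp: linear_functional_def)
    qed
    then obtain \<phi>' where \<phi>': "linear_functional \<phi>'" "k + j = 0 \<or> k + j = 1 \<and> \<phi>' = (\<lambda>_. 0)"
      "\<And>x. supported_in x R \<Longrightarrow> x r = 0 \<Longrightarrow> (\<exists>v. x v \<noteq> 0) \<Longrightarrow> \<phi>' x = 0 \<Longrightarrow> 0 < Q x"
      by blast
    have "(k + j) * pi + (\<Sum>v\<in>insert u (B - {w}). \<theta>' v - pi) + (\<Sum>e\<in>F. s e) \<le> pi"
      by (rule grow.IH[OF B' \<theta>'(1) sF deg' \<phi>'(1,2)]) (use \<phi>'(3) in \<open>auto simp: Q_def\<close>)
    then show False using \<theta>'(3) \<eta>(4) by (simp add: \<tau>_def algebra_simps)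
  qed
qed

section \<open>Paths of symmetric forms\<close>

lemma linear_functional_simps:
  assumes "linear_functional \<phi>"
  shows "\<phi> (\<lambda>v. x v + c * y v) = \<phi> x + c * \<phi> y"
    and "\<phi> (\<lambda>v. 0) = 0"
    and "\<phi> (\<lambda>v. c * x v) = c * \<phi> x"
proof -
  show 1: "\<phi> (\<lambda>v. x v + c * y v) = \<phi> x + c * \<phi> y" for x c y
    using assms unfolding linear_functional_def by blast
  show 2: "\<phi> (\<lambda>v. 0) = 0" using 1[of "\<lambda>_. 0" 1 "\<lambda>_. 0"] by simp
  show "\<phi> (\<lambda>v. c * x v) = c * \<phi> x" using 1[of "\<lambda>_. 0" c x] 2 by simp
qed

lemma linear_functional_expand:
  assumes "linear_functional \<phi>" "finite V" "supported_in x V"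
  shows "\<phi> x = (\<Sum>v\<in>V. x v * \<phi> (\<lambda>u. if u = v then 1 else 0))"
  using assms(2,3)
proof (induction V arbitrary: x rule: finite_induct)
  case empty
  then have "x = (\<lambda>_. 0)" by (auto simp: supported_in_def)
  then show ?case using linear_functional_simps(2)[OF assms(1)] by simp
next
  case (insert w V)
  define y where "y = x(w := 0)"
  have y: "supported_in y V" using insert.prems by (auto simp: y_def supported_in_def)
  have "x = (\<lambda>v. y v + x w * (if v = w then 1 else 0))" by (auto simp: y_def)
  then have "\<phi> x = \<phi> (\<lambda>v. y v + x w * (if v = w then 1 else 0))" by (rule arg_cong)
  also have "\<dots> = \<phi> y + x w * \<phi> (\<lambda>u. if u = w then 1 else 0)"
    by (rule linear_functional_simps(1)[OF assms(1)])
  finally have "\<phi> x = \<phi> y + x w * \<phi> (\<lambda>u. if u = w then 1 else 0)" .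
  moreover have "(\<Sum>v\<in>V. y v * \<phi> (\<lambda>u. if u = v then 1 else 0)) = (\<Sum>v\<in>V. x v * \<phi> (\<lambda>u. if u = v then 1 else 0))"
    using insert.hyps by (intro sum.cong) (auto simp: y_def)
  ultimately show ?case using insert.IH[OF y] insert.hyps by simp
qed

text \<open>
  Functions on an arbitrary type carry the product topology, in which the vectors supported in a finite
  set and bounded by 1 form a product of compact sets.
\<close>
lemma compact_box_supported:
  assumes "finite V"
  shows "compact {x :: 'n \<Rightarrow> real. supported_in x V \<and> (\<forall>v\<in>V. \<bar>x v\<bar> \<le> 1)}"
proof -
  have "x v \<in> (if v \<in> V then {-1..1} else {0}) \<longleftrightarrow> (v \<notin> V \<longrightarrow> x v = 0) \<and> (v \<in> V \<longrightarrow> \<bar>x v\<bar> \<le> 1)"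
    for x :: "'n \<Rightarrow> real" and v
    by (cases "v \<in> V") (simp_all add: abs_le_iff, linarith)
  then have "{x :: 'n \<Rightarrow> real. supported_in x V \<and> (\<forall>v\<in>V. \<bar>x v\<bar> \<le> 1)}
      = PiE UNIV (\<lambda>v. if v \<in> V then {-1..1} else {0})"
    unfolding PiE_UNIV_domain Pi_iff supported_in_def by blast
  moreover have "compactin (product_topology (\<lambda>_. euclidean) UNIV) (PiE UNIV (\<lambda>v::'n. if v \<in> V then {-1..1::real} else {0}))"
    unfolding compactin_PiE by auto
  ultimately show ?thesis
    by (simp add: euclidean_product_topology)
qed

text \<open>
  At most one nonpositive direction.  The functional \<open>\<phi>\<close> may vanish identically, in which case the
  form is positive definite.
\<close>
definition positive_on_hyperplane :: "'n set \<Rightarrow> (('n \<Rightarrow> real) \<Rightarrow> ('n \<Rightarrow> real) \<Rightarrow> real) \<Rightarrow> bool" where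
  "positive_on_hyperplane V B \<longleftrightarrow> (\<exists>\<phi>. linear_functional \<phi> \<and>
     (\<forall>x. supported_in x V \<longrightarrow> (\<exists>v. x v \<noteq> 0) \<longrightarrow> \<phi> x = 0 \<longrightarrow> 0 < B x x))"

text \<open>
  The determinant criterion for the form to be negative definite on the plane spanned by \<open>u\<close> and \<open>w\<close>,
  chosen because it is an open condition on finitely many values of the form.
\<close>
definition negative_pair :: "'n set \<Rightarrow> (('n \<Rightarrow> real) \<Rightarrow> ('n \<Rightarrow> real) \<Rightarrow> real) \<Rightarrow> bool" where
  "negative_pair V B \<longleftrightarrow> (\<exists>u w. supported_in u V \<and> supported_in w V \<and> B u u < 0 \<and> (B u w)\<^sup>2 < B u u * B w w)"

definition symmetric_bilinear :: "(('n \<Rightarrow> real) \<Rightarrow> ('n \<Rightarrow> real) \<Rightarrow> real) \<Rightarrow> bool" where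
  "symmetric_bilinear B \<longleftrightarrow> (\<forall>x. linear_functional (B x)) \<and> (\<forall>x y. B x y = B y x)"

lemma symmetric_bilinear_combination:
  assumes "symmetric_bilinear B"
  shows "B (\<lambda>v. c * x v + d * y v) (\<lambda>v. c * x v + d * y v) = c\<^sup>2 * B x x + 2 * c * d * B x y + d\<^sup>2 * B y y"
proof -
  have lin: "\<And>z. linear_functional (B z)" and sym: "\<And>x y. B x y = B y x" 
    using assms unfolding symmetric_bilinear_def by blast+
  have 1: "B z (\<lambda>v. c * x v + d * y v) = c * B z x + d * B z y" for z
    using linear_functional_simps[OF lin[of z]] by simp
  show ?thesis
    unfolding 1 sym[of "\<lambda>v. c * x v + d * y v"] sym[of y x] by (simp add: power2_eq_square algebra_simps)
qed

text \<open>
  A first-order perturbation: along \<open>x + \<epsilon> y\<close> the term linear in \<open>\<epsilon>\<close> dominates for small \<open>\<epsilon>\<close> of the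
  right sign.
\<close>
lemma negative_direction:
  assumes "symmetric_bilinear B" "B x x \<le> 0" "B x y \<noteq> 0"
  shows "\<exists>\<epsilon>. B (\<lambda>v. x v + \<epsilon> * y v) (\<lambda>v. x v + \<epsilon> * y v) < 0"
proof -
  define p q where "p = B x y" and "q = B y y"
  define \<epsilon> where "\<epsilon> = - p / (\<bar>q\<bar> + 1)"
  have q: "\<bar>q\<bar> + 1 > 0" by simp
  have "\<epsilon> * p = - p\<^sup>2 / (\<bar>q\<bar> + 1)" by (simp add: \<epsilon>_def power2_eq_square)
  have e2: "\<epsilon>\<^sup>2 * (\<bar>q\<bar> + 1) = p\<^sup>2 / (\<bar>q\<bar> + 1)"
    using q by (simp add: \<epsilon>_def power2_eq_square)
  have "\<epsilon>\<^sup>2 * q \<le> \<epsilon>\<^sup>2 * (\<bar>q\<bar> + 1)" by (intro mult_left_mono) auto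
  then have "\<epsilon>\<^sup>2 * q \<le> p\<^sup>2 / (\<bar>q\<bar> + 1)" using e2 by simp
  moreover have "p\<^sup>2 / (\<bar>q\<bar> + 1) > 0" using assms(3) by (simp add: p_def)
  ultimately have "2 * (\<epsilon> * p) + \<epsilon>\<^sup>2 * q < 0" unfolding \<open>\<epsilon> * p = _\<close> by simp
  moreover have "B (\<lambda>v. x v + \<epsilon> * y v) (\<lambda>v. x v + \<epsilon> * y v) = B x x + 2 * (\<epsilon> * p) + \<epsilon>\<^sup>2 * q"
    using symmetric_bilinear_combination[OF assms(1), of 1 x \<epsilon> y] by (simp add: p_def q_def)
  ultimately show ?thesis using assms(2) by (intro exI[of _ \<epsilon>]) linarith
qed

lemma negative_pair_not_positive:
  assumes "symmetric_bilinear B" "negative_pair V B"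
  shows "\<not> positive_on_hyperplane V B"
proof
  assume "positive_on_hyperplane V B"
  then obtain \<phi> where \<phi>: "linear_functional \<phi>"
    "\<And>x. supported_in x V \<Longrightarrow> \<exists>v. x v \<noteq> 0 \<Longrightarrow> \<phi> x = 0 \<Longrightarrow> 0 < B x x"
    unfolding positive_on_hyperplane_def by blast
  obtain u w where uw: "supported_in u V" "supported_in w V" "B u u < 0" "(B u w)\<^sup>2 < B u u * B w w"
    using assms(2) unfolding negative_pair_def by blast
  have neg: "B (\<lambda>v. c * u v + d * w v) (\<lambda>v. c * u v + d * w v) < 0" if "c \<noteq> 0 \<or> d \<noteq> 0" for c d
  proof -
    have "B u u * (c\<^sup>2 * B u u + 2 * c * d * B u w + d\<^sup>2 * B w w)
        = (c * B u u + d * B u w)\<^sup>2 + d\<^sup>2 * (B u u * B w w - (B u w)\<^sup>2)"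
      by (simp add: power2_eq_square algebra_simps)
    also have "\<dots> > 0"
    proof (cases "d = 0")
      case True then show ?thesis using that uw(3) by simp
    next
      case False then show ?thesis using uw(4) by (intro add_nonneg_pos) auto
    qed
    finally show ?thesis
      unfolding symmetric_bilinear_combination[OF assms(1)] using uw(3) by (simp add: zero_less_mult_iff)
  qed
  obtain c d where cd: "c \<noteq> 0 \<or> d \<noteq> 0" "c * \<phi> u + d * \<phi> w = 0"
  proof (cases "\<phi> u = 0")
    case True then show ?thesis using that[of 1 0] by simp
  next
    case False then show ?thesis using that[of "\<phi> w" "- \<phi> u"] by simp
  qed
  define z where "z = (\<lambda>v. c * u v + d * w v)"
  have "B z z < 0" using neg cd by (simp add: z_def)
  moreover have "supported_in z V" using uw by (simp add: z_def supported_in_def)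
  moreover have "\<phi> z = 0" using cd(2) linear_functional_simps[OF \<phi>(1)] by (simp add: z_def)
  moreover have "\<exists>v. z v \<noteq> 0"
  proof (rule ccontr)
    assume "\<nexists>v. z v \<noteq> 0"
    then have "z = (\<lambda>_. 0)" by auto
    then have "B z z = 0" using assms(1) by (auto simp: symmetric_bilinear_def linear_functional_simps)
    then show False using \<open>B z z < 0\<close> by simp
  qed
  ultimately show False using \<phi>(2)[of z] by simp
qed

text \<open>
  If some \<open>u\<close> has \<open>B u u < 0\<close>, then the form on the orthogonal complement of \<open>u\<close> decides: a vector \<open>x\<close> there
  with \<open>B x x \<le> 0\<close> can be perturbed inside the complement, by nonsingularity, to a negative \<open>w\<close>, and
  \<open>u, w\<close> is a negative pair; otherwise the complement is the required hyperplane.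
\<close>
lemma nonsingular_index_cases:
  assumes B: "symmetric_bilinear B"
    and ns: "\<And>x. supported_in x V \<Longrightarrow> \<exists>v. x v \<noteq> 0 \<Longrightarrow> \<exists>y. supported_in y V \<and> B x y \<noteq> 0"
  shows "positive_on_hyperplane V B \<or> negative_pair V B"
proof (rule disjCI)
  assume np: "\<not> negative_pair V B"
  have lin: "\<And>z. linear_functional (B z)" and sym: "\<And>x y. B x y = B y x" 
    using B unfolding symmetric_bilinear_def by blast+
  show "positive_on_hyperplane V B"
  proof (cases "\<exists>u. supported_in u V \<and> B u u < 0")
    case True
    then obtain u where u: "supported_in u V" "B u u < 0" by blast
    have "0 < B x x" if x: "supported_in x V" "\<exists>v. x v \<noteq> 0" "B u x = 0" for x
    proof (rule ccontr)
      assume le: "\<not> 0 < B x x"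
      obtain y where y: "supported_in y V" "B x y \<noteq> 0" using ns x by blast
      define y' where "y' = (\<lambda>v. y v + (- B u y / B u u) * u v)"
      have "B u y' = 0" "B x y' \<noteq> 0" 
        using y u x(3) sym[of x u] by (simp_all only: y'_def linear_functional_simps(1)[OF lin]) auto
      obtain \<epsilon> where \<epsilon>: "B (\<lambda>v. x v + \<epsilon> * y' v) (\<lambda>v. x v + \<epsilon> * y' v) < 0"
        using negative_direction[OF B, of x y'] le \<open>B x y' \<noteq> 0\<close> by auto
      define w where "w = (\<lambda>v. x v + \<epsilon> * y' v)"
      have "B u w = 0" using x(3) \<open>B u y' = 0\<close> by (simp add: w_def linear_functional_simps(1)[OF lin])
      moreover have "supported_in w V" using x y u by (simp add: w_def y'_def supported_in_def)
      ultimately have "negative_pair V B"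
        unfolding negative_pair_def using u \<epsilon> by (intro exI[of _ u] exI[of _ w]) (auto simp: w_def mult_neg_neg)
      then show False using np by simp
    qed
    then show ?thesis unfolding positive_on_hyperplane_def using lin by blast
  next
    case False
    have "0 < B x x" if x: "supported_in x V" "\<exists>v. x v \<noteq> 0" for x
    proof (rule ccontr)
      assume le: "\<not> 0 < B x x"
      obtain y where y: "supported_in y V" "B x y \<noteq> 0" using ns x by blast
      obtain \<epsilon> where \<epsilon>: "B (\<lambda>v. x v + \<epsilon> * y v) (\<lambda>v. x v + \<epsilon> * y v) < 0"
        using negative_direction[OF B, of x y] le y by auto
      moreover have "supported_in (\<lambda>v. x v + \<epsilon> * y v) V" using x y by (simp add: supported_in_def)
      ultimately show False using False by blast
    qed
    then show ?thesis unfolding positive_on_hyperplane_def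
      by (intro exI[of _ "\<lambda>_. 0"]) (simp add: linear_functional_def)
  qed
qed

text \<open>
  Keep the hyperplane fixed.  Positivity on its unit sphere (for the maximum norm), a compact set, persists
  for nearby parameters by the tube lemma.
\<close>
lemma openin_positive_on_hyperplane:
  fixes B :: "real \<Rightarrow> ('n \<Rightarrow> real) \<Rightarrow> ('n \<Rightarrow> real) \<Rightarrow> real"
  assumes fin: "finite V" and B: "\<And>t. symmetric_bilinear (B t)"
    and cont: "continuous_on (T \<times> UNIV) (\<lambda>(t, x). B t x x)"
  shows "openin (top_of_set T) {t \<in> T. positive_on_hyperplane V (B t)}"
proof (subst openin_subopen, intro ballI)
  fix t0 assume "t0 \<in> {t \<in> T. positive_on_hyperplane V (B t)}"
  then obtain \<phi> where t0: "t0 \<in> T" and \<phi>: "linear_functional \<phi>"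
    "\<And>x. supported_in x V \<Longrightarrow> \<exists>v. x v \<noteq> 0 \<Longrightarrow> \<phi> x = 0 \<Longrightarrow> 0 < B t0 x x"
    unfolding positive_on_hyperplane_def by blast
  define K where "K = {x. supported_in x V \<and> (\<forall>v\<in>V. \<bar>x v\<bar> \<le> 1)} \<inter>
     ((\<Union>v\<in>V. {x. \<bar>x v\<bar> = 1}) \<inter> {x. (\<Sum>v\<in>V. x v * \<phi> (\<lambda>u. if u = v then 1 else 0)) = 0})"
  have coord: "continuous_on UNIV (\<lambda>x::'n \<Rightarrow> real. x v)" for v
    by (rule continuous_on_product_coordinates)
  have "compact K"
    unfolding K_def
  proof (intro compact_Int_closed compact_box_supported fin closed_Int closed_UN ballI)
    show "closed {x::'n \<Rightarrow> real. \<bar>x v\<bar> = 1}" for v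
      by (intro closed_Collect_eq continuous_intros coord)
    show "closed {x. (\<Sum>v\<in>V. x v * \<phi> (\<lambda>u. if u = v then 1 else 0)) = 0}"
      by (intro closed_Collect_eq continuous_intros coord)
  qed
  have "openin (top_of_set (T \<times> UNIV)) ((T \<times> UNIV) \<inter> (\<lambda>(t, x). B t x x) -` {0<..})"
    by (rule continuous_openin_preimage_gen[OF cont]) simp
  then obtain W where W: "open W" "(T \<times> UNIV) \<inter> (\<lambda>(t, x). B t x x) -` {0<..} = (T \<times> UNIV) \<inter> W"
    unfolding openin_open by blast
  have K0: "0 < B t0 x x" if x: "x \<in> K" for x
  proof -
    from x obtain v where "supported_in x V" "\<bar>x v\<bar> = 1" unfolding K_def by blast
    moreover from this(2) have "\<exists>v. x v \<noteq> 0" by (intro exI[of _ v]) auto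
    moreover have "\<phi> x = 0" using x linear_functional_expand[OF \<phi>(1) fin, of x] unfolding K_def by simp
    ultimately show "0 < B t0 x x" using \<phi>(2) by blast
  qed
  then have "{t0} \<times> K \<subseteq> (T \<times> UNIV) \<inter> (\<lambda>(t, x). B t x x) -` {0<..}"
    using t0 by auto
  then have "{t0} \<times> K \<subseteq> W" using W(2) by auto
  from Elementary_Topology.tube_lemma[OF \<open>compact K\<close> W(1) this]
  obtain X where X: "t0 \<in> X" "open X" "X \<times> K \<subseteq> W" by blast
  define U where "U = T \<inter> X"
  have U: "t \<in> T" "x \<in> K \<Longrightarrow> 0 < B t x x" if "t \<in> U" for t x
  proof -
    show "t \<in> T" using that by (simp add: U_def)
    assume "x \<in> K"
    then have "(t, x) \<in> (T \<times> UNIV) \<inter> W" using that X(3) by (auto simp: U_def)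
    then show "0 < B t x x" unfolding W(2)[symmetric] by simp
  qed
  show "\<exists>U. openin (top_of_set T) U \<and> t0 \<in> U \<and> U \<subseteq> {t \<in> T. positive_on_hyperplane V (B t)}"
  proof (intro exI[of _ U] conjI subsetI)
    show "openin (top_of_set T) U"
      unfolding U_def using X(2) by (simp add: openin_open_Int)
    show "t0 \<in> U" using t0 X(1) by (simp add: U_def)
    fix t assume t: "t \<in> U"
    have "0 < B t x x" if x: "supported_in x V" "\<exists>v. x v \<noteq> 0" "\<phi> x = 0" for x
    proof -
      define M where "M = Max ((\<lambda>v. \<bar>x v\<bar>) ` V)"
      obtain v0 where v0: "x v0 \<noteq> 0" using x by blast
      then have "v0 \<in> V" using x by (auto simp: supported_in_def)
      then have V: "finite ((\<lambda>v. \<bar>x v\<bar>) ` V)" "(\<lambda>v. \<bar>x v\<bar>) ` V \<noteq> {}" using fin by auto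
      have le: "\<bar>x v\<bar> \<le> M" if "v \<in> V" for v using V that by (auto simp: M_def)
      then have M: "M > 0" using v0 \<open>v0 \<in> V\<close> by (meson dual_order.strict_trans1 zero_less_abs_iff)
      obtain v1 where v1: "v1 \<in> V" "M = \<bar>x v1\<bar>" using Max_in[OF V] unfolding M_def by auto
      define y where "y = (\<lambda>v. (1/M) * x v)"
      have sy: "supported_in y V" using x by (simp add: y_def supported_in_def)
      have "\<phi> y = 0" using linear_functional_simps(3)[OF \<phi>(1), of "1/M" x] x(3) by (simp add: y_def)
      then have "y \<in> K"
        unfolding K_def using sy linear_functional_expand[OF \<phi>(1) fin sy] le M v1 by (auto simp: y_def)
      then have "0 < B t y y" using t U(2) by blast
      moreover have "B t y y = (1/M)\<^sup>2 * B t x x"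
        using symmetric_bilinear_combination[OF B, of t "1/M" x 0 x] by (simp add: y_def)
      ultimately show ?thesis by (simp add: zero_less_mult_iff)
    qed
    then show "t \<in> {t \<in> T. positive_on_hyperplane V (B t)}"
      unfolding positive_on_hyperplane_def using \<phi>(1) U(1)[OF t] by blast
  qed
qed

lemma openin_negative_pair:
  fixes B :: "real \<Rightarrow> ('n \<Rightarrow> real) \<Rightarrow> ('n \<Rightarrow> real) \<Rightarrow> real"
  assumes B: "\<And>t. symmetric_bilinear (B t)"
    and cont: "continuous_on (T \<times> UNIV) (\<lambda>(t, x). B t x x)"
  shows "openin (top_of_set T) {t \<in> T. negative_pair V (B t)}"
proof (subst openin_subopen, intro ballI)
  fix t0 assume "t0 \<in> {t \<in> T. negative_pair V (B t)}"
  then obtain u w where uw: "t0 \<in> T" "supported_in u V" "supported_in w V" "B t0 u u < 0" "(B t0 u w)\<^sup>2 < B t0 u u * B t0 w w"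
    unfolding negative_pair_def by blast
  have cq: "continuous_on T (\<lambda>t. B t x x)" for x
  proof -
    have "continuous_on T ((\<lambda>(t, x). B t x x) \<circ> (\<lambda>t. (t, x)))"
      by (intro continuous_on_compose continuous_intros continuous_on_subset[OF cont]) auto
    then show ?thesis by (simp add: o_def)
  qed
  have pol: "B t u w = (B t (\<lambda>v. 1 * u v + 1 * w v) (\<lambda>v. 1 * u v + 1 * w v) - B t u u - B t w w) / 2" for t
    unfolding symmetric_bilinear_combination[OF B] by simp
  have cb: "continuous_on T (\<lambda>t. B t u w)"
    unfolding pol by (intro continuous_intros cq) auto
  define U where "U = (T \<inter> (\<lambda>t. B t u u) -` {..<0}) \<inter> (T \<inter> (\<lambda>t. B t u u * B t w w - (B t u w)\<^sup>2) -` {0<..})"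
  show "\<exists>U. openin (top_of_set T) U \<and> t0 \<in> U \<and> U \<subseteq> {t \<in> T. negative_pair V (B t)}"
  proof (intro exI[of _ U] conjI)
    show "openin (top_of_set T) U"
      unfolding U_def
    proof (rule openin_Int)
      show "openin (top_of_set T) (T \<inter> (\<lambda>t. B t u u) -` {..<0})"
        by (rule continuous_openin_preimage_gen[OF cq]) simp
      have "continuous_on T (\<lambda>t. B t u u * B t w w - (B t u w)\<^sup>2)" by (intro continuous_intros cq cb)
      then show "openin (top_of_set T) (T \<inter> (\<lambda>t. B t u u * B t w w - (B t u w)\<^sup>2) -` {0<..})"
        by (rule continuous_openin_preimage_gen) simp
    qed
    show "t0 \<in> U" using uw by (simp add: U_def)
    show "U \<subseteq> {t \<in> T. negative_pair V (B t)}"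
    proof
      fix t assume "t \<in> U"
      then have "t \<in> T" "B t u u < 0" "(B t u w)\<^sup>2 < B t u u * B t w w" by (auto simp: U_def)
      then show "t \<in> {t \<in> T. negative_pair V (B t)}"
        unfolding negative_pair_def using uw(2,3) by blast
    qed
  qed
qed

text \<open>
  Without singular forms the interval would split into two disjoint nonempty open sets: the parameters with
  a hyperplane of positivity and those with a negative pair.
\<close>
lemma singular_crossing:
  fixes B :: "real \<Rightarrow> ('n \<Rightarrow> real) \<Rightarrow> ('n \<Rightarrow> real) \<Rightarrow> real"
  assumes fin: "finite V" and B: "\<And>t. symmetric_bilinear (B t)"
    and cont: "continuous_on ({a..b} \<times> UNIV) (\<lambda>(t, x). B t x x)"
    and ab: "a \<le> b" and pa: "positive_on_hyperplane V (B a)" and pb: "\<not> positive_on_hyperplane V (B b)"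
  shows "\<exists>t\<in>{a..b}. \<exists>x. supported_in x V \<and> (\<exists>v. x v \<noteq> 0) \<and> (\<forall>y. supported_in y V \<longrightarrow> B t x y = 0)"
proof (rule ccontr)
  assume "\<not> ?thesis"
  then have ns: "\<And>t x. t \<in> {a..b} \<Longrightarrow> supported_in x V \<Longrightarrow> \<exists>v. x v \<noteq> 0 \<Longrightarrow> \<exists>y. supported_in y V \<and> B t x y \<noteq> 0"
    by blast
  have cover: "positive_on_hyperplane V (B t) \<or> negative_pair V (B t)" if "t \<in> {a..b}" for t
    using nonsingular_index_cases[OF B ns[OF that]] .
  let ?P = "{t \<in> {a..b}. positive_on_hyperplane V (B t)}" and ?N = "{t \<in> {a..b}. negative_pair V (B t)}"
  have "openin (top_of_set {a..b}) ?P" "openin (top_of_set {a..b}) ?N"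
    by (intro openin_positive_on_hyperplane fin B cont openin_negative_pair)+
  moreover have "{a..b} \<subseteq> ?P \<union> ?N" using cover by blast
  moreover have "?P \<inter> ?N = {}" using negative_pair_not_positive[OF B] by blast
  moreover have "?P \<noteq> {}" "?N \<noteq> {}" using pa pb cover[of b] ab by auto
  ultimately have "\<exists>E1 E2. openin (top_of_set {a..b}) E1 \<and> openin (top_of_set {a..b}) E2 \<and>
      {a..b} \<subseteq> E1 \<union> E2 \<and> E1 \<inter> E2 = {} \<and> E1 \<noteq> {} \<and> E2 \<noteq> {}"
    by (intro exI[of _ ?P] exI[of _ ?N] conjI)
  then have "\<not> Topological_Spaces.connected {a..b}" by (simp only: connected_openin not_not)
  then show False by simp
qed

section \<open>Singular frequencies\<close>

lemma seg_form_symmetric_bilinear: "symmetric_bilinear (seg_form a b s E)"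
  unfolding symmetric_bilinear_def linear_functional_def
proof (intro conjI allI)
  fix x y z :: "'a \<Rightarrow> real" and c
  show "seg_form a b s E x (\<lambda>v. y v + c * z v) = seg_form a b s E x y + c * seg_form a b s E x z"
    unfolding seg_form_def sum_distrib_left sum.distrib[symmetric]
    by (intro sum.cong refl) (simp add: algebra_simps add_divide_distrib diff_divide_distrib)
  show "seg_form a b s E x y = seg_form a b s E y x"
    unfolding seg_form_def by (intro sum.cong refl) (simp add: mult.commute)
qed

lemma seg_form_diagonal:
  "seg_form a b s E x x =
     (\<Sum>e\<in>E. (x (a e) - x (b e))\<^sup>2 / sin (s e) - (1 - cos (s e)) / sin (s e) * ((x (a e))\<^sup>2 + (x (b e))\<^sup>2))"
  unfolding seg_form_def
  unfolding times_divide_eq_left diff_divide_distrib[symmetric]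
  by (intro sum.cong refl arg_cong2[of _ _ _ _ "(/)"]) (simp add: power2_eq_square algebra_simps)

lemma seg_form_continuous:
  assumes "\<And>e t. e \<in> E \<Longrightarrow> t \<in> T \<Longrightarrow> sin (t * w e) \<noteq> 0"
  shows "continuous_on (T \<times> UNIV) (\<lambda>(t, x). seg_form a b (\<lambda>e. t * w e) E x x)"
proof -
  have coord: "continuous_on (T \<times> UNIV) (\<lambda>p::real \<times> ('b \<Rightarrow> real). snd p v)" for v
    by (rule continuous_on_product_then_coordinatewise) (intro continuous_intros)
  have "continuous_on UNIV (\<lambda>t::real. cos (t * c))" "continuous_on UNIV (\<lambda>t::real. sin (t * c))" for c
    by (intro continuous_intros)+
  then have trig: "continuous_on (T \<times> UNIV) (\<lambda>p::real \<times> ('b \<Rightarrow> real). cos (fst p * c))"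
    "continuous_on (T \<times> UNIV) (\<lambda>p::real \<times> ('b \<Rightarrow> real). sin (fst p * c))" for c
    by (auto intro!: continuous_on_compose2[of UNIV "\<lambda>t. cos (t * c)" _ fst]
        continuous_on_compose2[of UNIV "\<lambda>t. sin (t * c)" _ fst] continuous_on_fst continuous_on_id)
  show ?thesis
    unfolding seg_form_def case_prod_unfold
    by (intro continuous_intros coord trig) (use assms in auto)
qed

text \<open>
  A vertex is joined to the root by a path of tree edges; apply the triangle inequality and Cauchy-Schwarz.
\<close>
lemma grown_oscillation:
  fixes x :: "'n \<Rightarrow> real"
  assumes "grown a b r R F" "v \<in> R"
  shows "(x v - x r)\<^sup>2 \<le> card F * (\<Sum>e\<in>F. (x (a e) - x (b e))\<^sup>2)"
proof -
  have "\<bar>x v - x r\<bar> \<le> (\<Sum>e\<in>F. \<bar>x (a e) - x (b e)\<bar>)"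
    using assms
  proof (induction arbitrary: v rule: grown.induct)
    case root then show ?case by simp
  next
    case (grow R F u w e)
    note basic = grown_basic[OF grow.hyps(1)]
    have e: "finite F" "e \<notin> F" using basic grow.hyps(3,4) by auto
    show ?case
    proof (cases "v = w")
      case True
      then have "\<bar>x v - x r\<bar> \<le> \<bar>x (a e) - x (b e)\<bar> + \<bar>x u - x r\<bar>" using grow.hyps(4) by auto
      then show ?thesis using grow.IH[OF grow.hyps(2)] e by simp
    next
      case False
      then show ?thesis using grow.IH[of v] grow.prems e by simp
    qed
  qed
  then have "\<bar>x v - x r\<bar>\<^sup>2 \<le> (\<Sum>e\<in>F. \<bar>x (a e) - x (b e)\<bar>)\<^sup>2" by (intro power_mono) auto
  also have "\<dots> \<le> (\<Sum>e\<in>F. \<bar>x (a e) - x (b e)\<bar>\<^sup>2) * card F"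
    by (rule sum_squared_le_sum_of_squares)
  finally show ?thesis by (simp add: mult.commute)
qed

text \<open>
  The quotient is \<open>tan (s / 2)\<close>.
\<close>
lemma tan_half_le:
  fixes s :: real
  assumes "0 < s" "s \<le> pi / 2"
  shows "(1 - cos s) / sin s \<le> s"
proof -
  have sc: "sin s > 0" "cos s \<ge> 0" using assms by (auto intro!: sin_gt_zero cos_ge_zero)
  have "(1 - cos s) * (1 + cos s) = sin s * sin s"
    using sin_cos_squared_add[of s] by (simp add: power2_eq_square algebra_simps)
  then have "(1 - cos s) / sin s = sin s / (1 + cos s)" using sc by (simp add: field_simps)
  also have "\<dots> \<le> sin s / 1" using sc by (intro divide_left_mono) auto
  also have "\<dots> \<le> s" using assms by (simp add: sin_x_le_x)
  finally show ?thesis .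
qed

text \<open>
  For small \<open>\<kappa>\<close> the form is close to the graph Laplacian \<open>\<Sum>e. (x\<^sub>a - x\<^sub>b)\<^sup>2 / (\<kappa> w e)\<close>, which is
  positive definite on the vectors vanishing at the root because the graph is connected.
\<close>
lemma low_frequency_positive:
  assumes gr: "grown a b r V F" and FE: "F \<subseteq> E" "finite E" and EV: "\<And>e. e \<in> E \<Longrightarrow> a e \<in> V \<and> b e \<in> V"
    and w: "\<And>e. e \<in> E \<Longrightarrow> 0 < w e" and K: "0 < K"
  shows "\<exists>\<kappa>. 0 < \<kappa> \<and> \<kappa> \<le> K \<and> positive_on_hyperplane V (seg_form a b (\<lambda>e. \<kappa> * w e) E)"
proof -
  define N :: real where "N = 2 * card E * card F"
  \<comment> \<open>An upper bound for the phases that makes the error term \<open>h N D\<close> smaller than \<open>D / h\<close>.\<close>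
  define h where "h = 1 / (1 + N)"
  have N: "N \<ge> 0" by (simp add: N_def)
  have h: "0 < h" "h \<le> 1" "h * N < 1" using N by (auto simp: h_def field_simps)
  have hhN: "h * h * N < 1"
  proof -
    have "h * (h * N) \<le> 1 * (h * N)" using h N by (intro mult_right_mono) auto
    then show ?thesis using h(3) by (simp add: mult.assoc)
  qed
  \<comment> \<open>The summand \<open>1 / K\<close> ensures \<open>\<kappa> \<le> K\<close>.\<close>
  define W where "W = 1 / K + (\<Sum>e\<in>E. w e)"
  have sumw: "(\<Sum>e\<in>E. w e) \<ge> 0" using w by (intro sum_nonneg) (simp add: less_imp_le)
  have W: "W > 0" "1 / K \<le> W" using K sumw by (auto simp: W_def add_pos_nonneg)
  have wW: "w e \<le> W" if "e \<in> E" for e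
  proof -
    have "w e \<le> (\<Sum>e\<in>E. w e)" using that FE w by (intro member_le_sum) (auto simp: less_imp_le)
    then show ?thesis using K by (simp add: W_def add_increasing)
  qed
  define \<kappa> where "\<kappa> = h / W"
  have \<kappa>: "0 < \<kappa>" "\<kappa> * W = h" using h W by (auto simp: \<kappa>_def)
  have "\<kappa> \<le> K"
  proof -
    have "h \<le> 1" "1 \<le> K * W" using h W K by (auto simp: field_simps)
    then show ?thesis using W by (simp add: \<kappa>_def field_simps)
  qed
  have s: "0 < \<kappa> * w e \<and> \<kappa> * w e \<le> h" if "e \<in> E" for e
  proof -
    have "\<kappa> * w e \<le> \<kappa> * W" using wW[OF that] \<kappa>(1) by (intro mult_left_mono) auto
    moreover have "0 < \<kappa> * w e" using \<kappa>(1) w[OF that] by (rule mult_pos_pos)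
    ultimately show ?thesis unfolding \<kappa>(2) by blast
  qed
  have "0 < seg_form a b (\<lambda>e. \<kappa> * w e) E x x" if x: "supported_in x V" "\<exists>v. x v \<noteq> 0" "x r = 0" for x
  proof -
    define D where "D = (\<Sum>e\<in>E. (x (a e) - x (b e))\<^sup>2)"
    have D0: "D \<ge> 0" by (auto simp: D_def intro: sum_nonneg)
    have osc: "(x v)\<^sup>2 \<le> card F * D" if "v \<in> V" for v
    proof -
      have "(x v)\<^sup>2 \<le> card F * (\<Sum>e\<in>F. (x (a e) - x (b e))\<^sup>2)" using grown_oscillation[OF gr that, of x] x(3) by simp
      also have "\<dots> \<le> card F * D" unfolding D_def using FE by (intro mult_left_mono sum_mono2) auto
      finally show ?thesis .
    qed
    have "D \<noteq> 0"
    proof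
      assume "D = 0"
      then have "x v = 0" for v using osc[of v] x(1) by (cases "v \<in> V") (auto simp: supported_in_def)
      then show False using x(2) by simp
    qed
    with D0 have D: "D > 0" by simp
    have pe: "(x (a e) - x (b e))\<^sup>2 / h - h * (2 * card F * D)
       \<le> (x (a e) - x (b e))\<^sup>2 / sin (\<kappa> * w e) - (1 - cos (\<kappa> * w e)) / sin (\<kappa> * w e) * ((x (a e))\<^sup>2 + (x (b e))\<^sup>2)"
      if e: "e \<in> E" for e
    proof -
      define t where "t = \<kappa> * w e"
      have t: "0 < t" "t \<le> h" "t \<le> 1" using s[OF e] h by (auto simp: t_def)
      have tpi: "t \<le> pi / 2" using t pi_gt3 by linarith
      then have "sin t > 0" using t by (intro sin_gt_zero) auto
      moreover have "sin t \<le> h" using sin_x_le_x[of t] t by linarith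
      ultimately have 1: "(x (a e) - x (b e))\<^sup>2 / h \<le> (x (a e) - x (b e))\<^sup>2 / sin t"
        using h by (intro divide_left_mono) auto
      have 2: "(1 - cos t) / sin t \<le> h" using tan_half_le[OF t(1) tpi] t(2) by linarith
      have "(1 - cos t) / sin t * ((x (a e))\<^sup>2 + (x (b e))\<^sup>2) \<le> h * (2 * card F * D)"
        using 2 osc[of "a e"] osc[of "b e"] EV[OF e] h by (intro mult_mono) auto
      then show ?thesis using 1 unfolding t_def by linarith
    qed
    have "0 < D / h - h * N * D"
    proof -
      have "h * (h * N * D) < D" using mult_strict_right_mono[OF hhN D] by (simp add: algebra_simps)
      then show ?thesis using h by (simp add: field_simps)
    qed
    also have "D / h - h * N * D = (\<Sum>e\<in>E. (x (a e) - x (b e))\<^sup>2 / h - h * (2 * card F * D))"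
      by (simp add: D_def N_def sum_subtractf sum_divide_distrib)
    also have "\<dots> \<le> seg_form a b (\<lambda>e. \<kappa> * w e) E x x"
      unfolding seg_form_diagonal by (rule sum_mono[OF pe])
    finally show ?thesis .
  qed
  then have "positive_on_hyperplane V (seg_form a b (\<lambda>e. \<kappa> * w e) E)"
    unfolding positive_on_hyperplane_def
    by (intro exI[of _ "\<lambda>x. x r"]) (auto simp: linear_functional_def)
  then show ?thesis using \<kappa> \<open>\<kappa> \<le> K\<close> by blast
qed

text \<open>
  The segments that end at a vertex with Dirichlet condition act on their other ends \<open>p e\<close> as
  initial load.
\<close>
lemma load_collect:
  fixes s :: "'s \<Rightarrow> real" and p :: "'s \<Rightarrow> 'n"
  assumes "finite A" "\<forall>e\<in>A. 0 < s e \<and> s e < pi"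
  shows "\<exists>\<theta>. (\<forall>v\<in>p ` A. 0 < \<theta> v \<and> \<theta> v < pi) \<and>
     (\<forall>x. (\<Sum>v\<in>p ` A. cot (\<theta> v) * (x v)\<^sup>2) = (\<Sum>e\<in>A. cot (s e) * (x (p e))\<^sup>2)) \<and>
     (\<Sum>e\<in>A. s e - pi) \<le> (\<Sum>v\<in>p ` A. \<theta> v - pi)"
  using assms
proof (induction A rule: finite_induct)
  case empty then show ?case by simp
next
  case (insert e A)
  then obtain \<theta> where \<theta>: "\<forall>v\<in>p ` A. 0 < \<theta> v \<and> \<theta> v < pi"
     "\<And>x. (\<Sum>v\<in>p ` A. cot (\<theta> v) * (x v)\<^sup>2) = (\<Sum>e\<in>A. cot (s e) * (x (p e))\<^sup>2)"
     "(\<Sum>e\<in>A. s e - pi) \<le> (\<Sum>v\<in>p ` A. \<theta> v - pi)" by auto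
  obtain \<theta>' where \<theta>': "\<forall>v\<in>insert (p e) (p ` A). 0 < \<theta>' v \<and> \<theta>' v < pi"
     "\<And>x. (\<Sum>v\<in>insert (p e) (p ` A). cot (\<theta>' v) * (x v)\<^sup>2) = (\<Sum>v\<in>p ` A. cot (\<theta> v) * (x v)\<^sup>2) + cot (s e) * (x (p e))\<^sup>2"
     "(\<Sum>v\<in>p ` A. \<theta> v - pi) + (s e - pi) \<le> (\<Sum>v\<in>insert (p e) (p ` A). \<theta>' v - pi)"
    using load_add[of "p ` A" \<theta> "s e" "p e"] insert \<theta>(1) by auto
  show ?case
  proof (intro exI[of _ \<theta>'] conjI allI)
    show "\<forall>v\<in>p ` insert e A. 0 < \<theta>' v \<and> \<theta>' v < pi" using \<theta>'(1) by simp
    show "(\<Sum>v\<in>p ` insert e A. cot (\<theta>' v) * (x v)\<^sup>2) = (\<Sum>e\<in>insert e A. cot (s e) * (x (p e))\<^sup>2)" for x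
      unfolding image_insert \<theta>'(2) \<theta>(2) using insert.hyps by simp
    have "(\<Sum>e\<in>insert e A. s e - pi) = (s e - pi) + (\<Sum>e\<in>A. s e - pi)" using insert.hyps by simp
    then show "(\<Sum>e\<in>insert e A. s e - pi) \<le> (\<Sum>v\<in>p ` insert e A. \<theta>' v - pi)"
      unfolding image_insert using \<theta>(3) \<theta>'(3) by linarith
  qed
qed

text \<open>
  On vectors that vanish at \<open>r\<close>, every segment outside the tree has one end with value 0 and therefore
  contributes the load \<open>cot (s e)\<close> at its other end, of measure \<open>s e - \<pi>\<close>.  Elimination then
  bounds the total phase; the term 1 comes from the root.
\<close>
lemma positive_imp_short:
  assumes gr: "grown a b r V F" and FE: "F \<subseteq> E" "finite E" and s: "\<And>e. e \<in> E \<Longrightarrow> 0 < s e \<and> s e < pi"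
    and ex: "\<And>e. e \<in> E - F \<Longrightarrow> (a e = r \<and> b e \<in> V - {r}) \<or> (b e = r \<and> a e \<in> V - {r})"
    and deg: "\<And>v. v \<in> V - {r} \<Longrightarrow> 2 \<le> card {e\<in>E. a e = v \<or> b e = v}"
    and pos: "positive_on_hyperplane V (seg_form a b s E)"
  shows "(\<Sum>e\<in>E. s e) \<le> pi * (1 + card (E - F))"
proof -
  obtain \<phi> where \<phi>: "linear_functional \<phi>"
    "\<And>x. supported_in x V \<Longrightarrow> \<exists>v. x v \<noteq> 0 \<Longrightarrow> \<phi> x = 0 \<Longrightarrow> 0 < seg_form a b s E x x"
    using pos unfolding positive_on_hyperplane_def by blast
  define p where "p = (\<lambda>e. if a e = r then b e else a e)"
  define A where "A = E - F"
  have finA: "finite A" using FE by (simp add: A_def)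
  obtain \<theta> where \<theta>: "\<forall>v\<in>p ` A. 0 < \<theta> v \<and> \<theta> v < pi"
     "\<And>x. (\<Sum>v\<in>p ` A. cot (\<theta> v) * (x v)\<^sup>2) = (\<Sum>e\<in>A. cot (s e) * (x (p e))\<^sup>2)"
     "(\<Sum>e\<in>A. s e - pi) \<le> (\<Sum>v\<in>p ` A. \<theta> v - pi)"
    using load_collect[OF finA, of s p] s by (auto simp: A_def)
  have split: "sum f E = sum f F + sum f A" for f :: "_ \<Rightarrow> real"
    unfolding A_def using sum.subset_diff[OF FE, of f] by simp
  have "real 0 * pi + (\<Sum>v\<in>p ` A. \<theta> v - pi) + (\<Sum>e\<in>F. s e) \<le> pi"
  proof (rule grown_elimination[OF gr _ \<theta>(1) _ _ \<phi>(1)])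
    show "p ` A \<subseteq> V" using ex by (force simp: p_def A_def)
    show "\<forall>e\<in>F. 0 < s e \<and> s e < pi" using s FE by blast
    show "\<forall>v\<in>V - {r}. v \<in> p ` A \<or> 2 \<le> card {e\<in>F. a e = v \<or> b e = v}"
    proof
      fix v assume v: "v \<in> V - {r}"
      show "v \<in> p ` A \<or> 2 \<le> card {e\<in>F. a e = v \<or> b e = v}"
      proof (cases "v \<in> p ` A")
        case False
        have "e \<in> F" if "e \<in> E" "a e = v \<or> b e = v" for e
        proof (rule ccontr)
          assume "e \<notin> F"
          then have "e \<in> A" "v = p e" using that ex[of e] v by (auto simp: A_def p_def)
          then show False using False by blast
        qed
        then have "{e\<in>E. a e = v \<or> b e = v} = {e\<in>F. a e = v \<or> b e = v}" using FE by blast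
        then show ?thesis using deg[OF v] by simp
      qed simp
    qed
    fix x assume x: "supported_in x V" "x r = 0" "\<exists>v. x v \<noteq> 0" "\<phi> x = 0"
    have "seg_form a b s E x x = seg_form a b s F x x + (\<Sum>e\<in>A. cot (s e) * (x (p e))\<^sup>2)"
      unfolding seg_form_def split
    proof (intro arg_cong2[of _ _ _ _ "(+)"] refl sum.cong)
      fix e assume "e \<in> A"
      then show "((x (a e) * x (a e) + x (b e) * x (b e)) * cos (s e) - x (a e) * x (b e) - x (b e) * x (a e)) / sin (s e)
         = cot (s e) * (x (p e))\<^sup>2"
        using ex[of e] x(2) by (auto simp: A_def p_def cot_def power2_eq_square)
    qed
    then show "0 < seg_form a b s F x x + (\<Sum>v\<in>p ` A. cot (\<theta> v) * (x v)\<^sup>2)"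
      using \<phi>(2)[OF x(1,3,4)] \<theta>(2)[of x] by simp
  qed simp
  moreover have "(\<Sum>e\<in>A. s e - pi) = (\<Sum>e\<in>A. s e) - card A * pi" by (simp add: sum_subtractf)
  ultimately show ?thesis using \<theta>(3) split[of s] unfolding A_def by (simp add: algebra_simps)
qed

text \<open>
  Raise the frequency from a small value to \<open>K\<close>: the form is positive on a hyperplane at first, but not at \<open>K\<close>,
  because the total phase is too large.
\<close>
theorem ex_singular_frequency:
  assumes gr: "grown a b r V F" and FE: "F \<subseteq> E" "finite E"
    and w: "\<And>e. e \<in> E \<Longrightarrow> 0 < w e" and K: "0 < K" and Kw: "\<And>e. e \<in> E \<Longrightarrow> K * w e < pi"
    and ex: "\<And>e. e \<in> E - F \<Longrightarrow> (a e = r \<and> b e \<in> V - {r}) \<or> (b e = r \<and> a e \<in> V - {r})"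
    and deg: "\<And>v. v \<in> V - {r} \<Longrightarrow> 2 \<le> card {e\<in>E. a e = v \<or> b e = v}"
    and long: "pi * (1 + card (E - F)) < K * (\<Sum>e\<in>E. w e)"
  shows "\<exists>\<kappa>. 0 < \<kappa> \<and> \<kappa> \<le> K \<and> (\<exists>x. supported_in x V \<and> (\<exists>v. x v \<noteq> 0) \<and>
           (\<forall>y. supported_in y V \<longrightarrow> seg_form a b (\<lambda>e. \<kappa> * w e) E x y = 0))"
proof -
  note basic = grown_basic[OF gr]
  have EV: "a e \<in> V \<and> b e \<in> V" if "e \<in> E" for e
    using that ex[of e] basic by (cases "e \<in> F") auto
  obtain \<kappa>0 where \<kappa>0: "0 < \<kappa>0" "\<kappa>0 \<le> K" "positive_on_hyperplane V (seg_form a b (\<lambda>e. \<kappa>0 * w e) E)"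
    using low_frequency_positive[OF gr FE _ _ K, of w] EV w by blast
  have s: "0 < t * w e \<and> t * w e < pi" if "e \<in> E" "t \<in> {\<kappa>0..K}" for e t
  proof -
    have "t * w e \<le> K * w e" using that w[OF that(1)] by (intro mult_right_mono) auto
    moreover have "0 < t * w e" using w[OF that(1)] that(2) \<kappa>0(1) by (intro mult_pos_pos) auto
    ultimately show ?thesis using Kw[OF that(1)] by linarith
  qed
  have sin_ne: "sin (t * w e) \<noteq> 0" if "e \<in> E" "t \<in> {\<kappa>0..K}" for e t
    using sin_gt_zero[of "t * w e"] s[OF that] by simp
  have "\<not> positive_on_hyperplane V (seg_form a b (\<lambda>e. K * w e) E)"
  proof
    assume pos: "positive_on_hyperplane V (seg_form a b (\<lambda>e. K * w e) E)"
    have "(\<Sum>e\<in>E. K * w e) \<le> pi * (1 + card (E - F))"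
      by (rule positive_imp_short[OF gr FE _ ex deg pos]) (use s \<kappa>0 in auto)
    then show False using long by (simp add: sum_distrib_left)
  qed
  then have "\<exists>t\<in>{\<kappa>0..K}. \<exists>x. supported_in x V \<and> (\<exists>v. x v \<noteq> 0) \<and>
      (\<forall>y. supported_in y V \<longrightarrow> seg_form a b (\<lambda>e. t * w e) E x y = 0)"
    by (intro singular_crossing[where B = "\<lambda>t. seg_form a b (\<lambda>e. t * w e) E"] seg_form_symmetric_bilinear
          seg_form_continuous \<kappa>0 sin_ne) (use basic in auto)
  then obtain t x where "t \<in> {\<kappa>0..K}" "supported_in x V" "\<exists>v. x v \<noteq> 0"
      "\<forall>y. supported_in y V \<longrightarrow> seg_form a b (\<lambda>e. t * w e) E x y = 0" by blast
  then show ?thesis using \<kappa>0(1) by (intro exI[of _ t] conjI exI[of _ x]) auto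
qed

section \<open>Eigenfunctions on a metric graph\<close>

lemma derivative_interior:
  fixes f :: "real \<Rightarrow> real"
  assumes "\<And>x. x \<in> {0..l} \<Longrightarrow> (f has_real_derivative f' x) (at x within {0..l})"
  shows "continuous_on {0..l} f" "\<And>x. 0 < x \<Longrightarrow> x < l \<Longrightarrow> (f has_real_derivative f' x) (at x)"
proof -
  show "continuous_on {0..l} f"
    using assms by (intro DERIV_continuous_on) auto
  fix x assume "0 < x" "x < l"
  then show "(f has_real_derivative f' x) (at x)"
    using assms[of x] by (simp add: at_within_Icc_at)
qed

lemma constant_if_derivative_zero:
  fixes f :: "real \<Rightarrow> real"
  assumes "continuous_on {0..l} f" "\<And>x. 0 < x \<Longrightarrow> x < l \<Longrightarrow> (f has_real_derivative 0) (at x)" "x \<in> {0..l}"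
  shows "f x = f 0"
proof (cases "0 < l")
  case True
  then show ?thesis using DERIV_isconst2[of 0 l f x] assms by auto
next
  case False
  then have "x = 0" using assms(3) by auto
  then show ?thesis by simp
qed

text \<open>
  The difference to the claimed solution has conserved energy, which is 0 at the left end.
\<close>
lemma harmonic_oscillator:
  fixes f g :: "real \<Rightarrow> real"
  assumes \<kappa>: "0 < \<kappa>"
    and f: "\<And>x. x \<in> {0..l} \<Longrightarrow> (f has_real_derivative g x) (at x within {0..l})"
    and g: "\<And>x. x \<in> {0..l} \<Longrightarrow> (g has_real_derivative - (\<kappa>\<^sup>2 * f x)) (at x within {0..l})"
    and x: "x \<in> {0..l}"
  shows "f x = f 0 * cos (\<kappa> * x) + g 0 / \<kappa> * sin (\<kappa> * x)"
    and "g x = - \<kappa> * f 0 * sin (\<kappa> * x) + g 0 * cos (\<kappa> * x)"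
proof -
  define u where "u = (\<lambda>x. f x - (f 0 * cos (\<kappa> * x) + g 0 / \<kappa> * sin (\<kappa> * x)))"
  define v where "v = (\<lambda>x. g x - (- \<kappa> * f 0 * sin (\<kappa> * x) + g 0 * cos (\<kappa> * x)))"
  define En where "En = (\<lambda>x. (v x)\<^sup>2 + \<kappa>\<^sup>2 * (u x)\<^sup>2)"
  have u: "(u has_real_derivative v x) (at x within {0..l})" if "x \<in> {0..l}" for x
    unfolding u_def v_def using \<kappa> by (auto intro!: derivative_eq_intros f that)
  have v: "(v has_real_derivative - (\<kappa>\<^sup>2 * u x)) (at x within {0..l})" if "x \<in> {0..l}" for x
    unfolding u_def v_def using \<kappa>
    by (auto intro!: derivative_eq_intros g that simp: power2_eq_square algebra_simps)
  have dEn: "(En has_real_derivative 0) (at x within {0..l})" if "x \<in> {0..l}" for x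
    unfolding En_def by (auto intro!: derivative_eq_intros u v that simp: algebra_simps)
  have "En x = En 0"
    by (rule constant_if_derivative_zero[OF derivative_interior(1)[OF dEn] derivative_interior(2)[OF dEn] x])
  also have "En 0 = 0" using \<kappa> by (simp add: En_def u_def v_def)
  finally have "(v x)\<^sup>2 + \<kappa>\<^sup>2 * (u x)\<^sup>2 = 0" by (simp add: En_def)
  then have "v x = 0" "u x = 0" using \<kappa> by (auto simp: add_nonneg_eq_0_iff)
  then show "f x = f 0 * cos (\<kappa> * x) + g 0 / \<kappa> * sin (\<kappa> * x)"
    "g x = - \<kappa> * f 0 * sin (\<kappa> * x) + g 0 * cos (\<kappa> * x)" by (simp_all add: u_def v_def)
qed

lemma sum_over_arcs_by_vertex:
  fixes h :: "'e \<Rightarrow> real"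
  assumes "fin_digraph G"
  shows "(\<Sum>e\<in>arcs G. h e) = (\<Sum>v\<in>verts G. \<Sum>e\<in>out_arcs G v. h e)"
    and "(\<Sum>e\<in>arcs G. h e) = (\<Sum>v\<in>verts G. \<Sum>e\<in>in_arcs G v. h e)"
proof -
  interpret fin_digraph G by fact
  show "(\<Sum>e\<in>arcs G. h e) = (\<Sum>v\<in>verts G. \<Sum>e\<in>out_arcs G v. h e)"
    unfolding out_arcs_def using sum.group[of "arcs G" "verts G" "tail G" h] by (simp add: image_subset_iff)
  show "(\<Sum>e\<in>arcs G. h e) = (\<Sum>v\<in>verts G. \<Sum>e\<in>in_arcs G v. h e)"
    unfolding in_arcs_def using sum.group[of "arcs G" "verts G" "head G" h] by (simp add: image_subset_iff)
qed

text \<open>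
  Integration by parts without integrals: on every edge \<open>f f'\<close> has derivative \<open>f'\<^sup>2 - \<mu> f\<^sup>2 \<ge> 0\<close>, while the
  vertex conditions make its total increment over all edges vanish.  Hence the derivative vanishes.
\<close>
lemma nonpositive_eigenfunction:
  assumes G: "fin_digraph G" and l: "is_metric G l" and \<mu>: "\<mu> \<le> 0" and f: "f \<in> neumann_eigenspace G l \<mu>"
  shows "e \<in> arcs G \<Longrightarrow> x \<in> {0..l e} \<Longrightarrow> f e x = f e 0" and "\<mu> < 0 \<Longrightarrow> f = 0"
proof -
  interpret fin_digraph G by fact
  obtain \<phi> g where zero: "\<And>e x. \<not> (e \<in> arcs G \<and> x \<in> {0..l e}) \<Longrightarrow> f e x = 0"
    and \<phi>: "\<And>e. e \<in> arcs G \<Longrightarrow> f e 0 = \<phi> (tail G e) \<and> f e (l e) = \<phi> (head G e)"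
    and df: "\<And>e x. e \<in> arcs G \<Longrightarrow> x \<in> {0..l e} \<Longrightarrow> (f e has_real_derivative g e x) (at x within {0..l e})"
    and dg: "\<And>e x. e \<in> arcs G \<Longrightarrow> x \<in> {0..l e} \<Longrightarrow> (g e has_real_derivative - (\<mu> * f e x)) (at x within {0..l e})"
    and kirch: "\<And>v. v \<in> verts G \<Longrightarrow> (\<Sum>e \<in> out_arcs G v. g e 0) + (\<Sum>e \<in> in_arcs G v. - g e (l e)) = 0"
    using f unfolding neumann_eigenspace_def by blast
  \<comment> \<open>The increments of \<open>f f'\<close> along the arcs, regrouped by vertices.\<close>
  define D where "D = (\<lambda>e. f e (l e) * g e (l e) - f e 0 * g e 0)"
  have "(\<Sum>e\<in>arcs G. D e) = (\<Sum>e\<in>arcs G. f e (l e) * g e (l e)) - (\<Sum>e\<in>arcs G. f e 0 * g e 0)"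
    by (simp add: D_def sum_subtractf)
  also have "(\<Sum>e\<in>arcs G. f e (l e) * g e (l e)) = (\<Sum>v\<in>verts G. \<Sum>e\<in>in_arcs G v. \<phi> v * g e (l e))"
    unfolding sum_over_arcs_by_vertex(2)[OF G] using \<phi> by (intro sum.cong refl) auto
  also have "(\<Sum>e\<in>arcs G. f e 0 * g e 0) = (\<Sum>v\<in>verts G. \<Sum>e\<in>out_arcs G v. \<phi> v * g e 0)"
    unfolding sum_over_arcs_by_vertex(1)[OF G] using \<phi> by (intro sum.cong refl) auto
  also have "(\<Sum>v\<in>verts G. \<Sum>e\<in>in_arcs G v. \<phi> v * g e (l e)) - (\<Sum>v\<in>verts G. \<Sum>e\<in>out_arcs G v. \<phi> v * g e 0)
     = (\<Sum>v\<in>verts G. - \<phi> v * ((\<Sum>e \<in> out_arcs G v. g e 0) + (\<Sum>e \<in> in_arcs G v. - g e (l e))))"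
    unfolding sum_subtractf[symmetric]
    by (intro sum.cong refl) (simp add: sum_distrib_left[symmetric] sum_negf algebra_simps)
  also have "\<dots> = 0" using kirch by simp
  finally have sumD: "(\<Sum>e\<in>arcs G. D e) = 0" .
  define q where "q = (\<lambda>e x. f e x * g e x)"
  have dq: "(q e has_real_derivative (g e x)\<^sup>2 - \<mu> * (f e x)\<^sup>2) (at x within {0..l e})"
    if "e \<in> arcs G" "x \<in> {0..l e}" for e x
    unfolding q_def using that
    by (auto intro!: derivative_eq_intros df dg simp: power2_eq_square algebra_simps)
  have nonneg: "0 \<le> (g e x)\<^sup>2 - \<mu> * (f e x)\<^sup>2" for e x
  proof -
    have "\<mu> * (f e x)\<^sup>2 \<le> 0" using \<mu> by (simp add: mult_nonpos_nonneg)
    then show ?thesis using zero_le_power2[of "g e x"] by linarith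
  qed
  have mono: "q e x \<le> q e y" if e: "e \<in> arcs G" and xy: "0 \<le> x" "x \<le> y" "y \<le> l e" for e x y
  proof (rule DERIV_nonneg_imp_increasing_open[OF xy(2)])
    note di = derivative_interior[OF dq[OF e]]
    show "continuous_on {x..y} (q e)" using xy by (intro continuous_on_subset[OF di(1)]) auto
    fix z assume "x < z" "z < y"
    then show "\<exists>y. (q e has_real_derivative y) (at z) \<and> 0 \<le> y"
      using di(2)[of z] nonneg[of e z] xy by (intro exI[of _ "(g e z)\<^sup>2 - \<mu> * (f e z)\<^sup>2"]) auto
  qed
  have l0: "0 < l e" if "e \<in> arcs G" for e using l that by (simp add: is_metric_def)
  have "0 \<le> D e" if "e \<in> arcs G" for e
    using mono[OF that, of 0 "l e"] l0[OF that] by (simp add: D_def q_def)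
  then have D0: "D e = 0" if "e \<in> arcs G" for e
    using sumD sum_nonneg_eq_0_iff[of "arcs G" D] that by auto
  have inner: "g e x = 0 \<and> \<mu> * (f e x)\<^sup>2 = 0" if e: "e \<in> arcs G" and x: "0 < x" "x < l e" for e x
  proof -
    have const: "q e y = q e 0" if "0 \<le> y" "y \<le> l e" for y
      using mono[OF e, of 0 y] mono[OF e, of y "l e"] D0[OF e] that by (simp add: D_def q_def)
    have "(g e x)\<^sup>2 - \<mu> * (f e x)\<^sup>2 = 0"
    proof (rule DERIV_local_const)
      show "(q e has_real_derivative (g e x)\<^sup>2 - \<mu> * (f e x)\<^sup>2) (at x)"
        using derivative_interior(2)[OF dq[OF e] x] by simp
      show "0 < min x (l e - x)" using x by simp
      show "\<forall>y. \<bar>x - y\<bar> < min x (l e - x) \<longrightarrow> q e x = q e y"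
      proof (intro allI impI)
        fix y assume "\<bar>x - y\<bar> < min x (l e - x)"
        then have "0 \<le> y" "y \<le> l e" by linarith+
        then show "q e x = q e y" using const[of x] const[of y] x by simp
      qed
    qed
    moreover have "0 \<le> (g e x)\<^sup>2" "\<mu> * (f e x)\<^sup>2 \<le> 0" using \<mu> by (auto simp: mult_nonpos_nonneg)
    ultimately have "(g e x)\<^sup>2 = 0 \<and> \<mu> * (f e x)\<^sup>2 = 0" by linarith
    then show ?thesis by simp
  qed
  have const: "f e x = f e 0" if e: "e \<in> arcs G" and x: "x \<in> {0..l e}" for e x
  proof (rule constant_if_derivative_zero[OF _ _ x])
    show "continuous_on {0..l e} (f e)" by (rule derivative_interior(1)[OF df[OF e]])
    show "(f e has_real_derivative 0) (at y)" if "0 < y" "y < l e" for y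
      using derivative_interior(2)[OF df[OF e] that] inner[OF e that] by simp
  qed
  then show "e \<in> arcs G \<Longrightarrow> x \<in> {0..l e} \<Longrightarrow> f e x = f e 0" .
  assume neg: "\<mu> < 0"
  have "f e x = 0" for e x
  proof (cases "e \<in> arcs G \<and> x \<in> {0..l e}")
    case True
    then have "f e (l e / 2) = 0" using inner[of e "l e / 2"] l0[of e] neg by simp
    then show ?thesis using const[of e x] const[of e "l e / 2"] True l0[of e] by simp
  qed (rule zero)
  then show "f = 0" by (simp add: fun_eq_iff)
qed

lemma grown_constant:
  assumes "grown a b r R F" "\<And>e. e \<in> F \<Longrightarrow> \<phi> (a e) = \<phi> (b e)" "v \<in> R"
  shows "\<phi> v = \<phi> r"
  using assms by (induction arbitrary: v rule: grown.induct) (auto, metis+)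

lemma has_real_derivative_transform_on:
  assumes "x \<in> s" "\<And>y. y \<in> s \<Longrightarrow> f y = g y" "(g has_real_derivative d) (at x within s)"
  shows "(f has_real_derivative d) (at x within s)"
  using has_derivative_transform[OF assms(1,2) assms(3)[unfolded has_field_derivative_def]]
  by (simp only: has_field_derivative_def)

definition const_one :: "('v, 'e) pre_digraph \<Rightarrow> ('e \<Rightarrow> real) \<Rightarrow> 'e \<Rightarrow> real \<Rightarrow> real" where
  "const_one G l e x = (if e \<in> arcs G \<and> x \<in> {0..l e} then 1 else 0)"

lemma const_one_eigenfunction:
  "const_one G l \<in> neumann_eigenspace G l 0" if "is_metric G l"
  unfolding neumann_eigenspace_def
proof (intro CollectI conjI)
  show "\<forall>e x. \<not> (e \<in> arcs G \<and> x \<in> {0..l e}) \<longrightarrow> const_one G l e x = 0" by (simp add: const_one_def)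
  show "\<exists>\<phi>. \<forall>e\<in>arcs G. const_one G l e 0 = \<phi> (tail G e) \<and> const_one G l e (l e) = \<phi> (head G e)"
    using that by (intro exI[of _ "\<lambda>_. 1"]) (auto simp: const_one_def is_metric_def less_imp_le)
  have "(const_one G l e has_real_derivative 0) (at x within {0..l e})" if "e \<in> arcs G" "x \<in> {0..l e}" for e x
    by (rule has_real_derivative_transform_on[OF that(2) _ DERIV_const[of 1]])
      (use that(1) in \<open>simp add: const_one_def\<close>)
  then show "\<exists>g. (\<forall>e\<in>arcs G. \<forall>x\<in>{0..l e}. (const_one G l e has_real_derivative g e x) (at x within {0..l e}) \<and>
       (g e has_real_derivative - (0 * const_one G l e x)) (at x within {0..l e})) \<and>
     (\<forall>v\<in>verts G. (\<Sum>e\<in>out_arcs G v. g e 0) + (\<Sum>e\<in>in_arcs G v. - g e (l e)) = 0)"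
    by (intro exI[of _ "\<lambda>_ _. 0"]) auto
qed

text \<open>
  By \<open>nonpositive_eigenfunction\<close> an eigenfunction for 0 is constant on each edge, hence constant on the
  connected graph.
\<close>
lemma multiplicity_zero:
  assumes G: "fin_digraph G" "arcs G \<noteq> {}" and l: "is_metric G l"
    and gr: "grown (tail G) (head G) r (verts G) F" "F \<subseteq> arcs G"
  shows "eigenvalue_multiplicity G l 0 = 1" "neumann_eigenvalue G l 0"
proof -
  interpret fin_digraph G by fact
  have "neumann_eigenspace G l 0 \<subseteq> edge_fun.span {const_one G l}"
  proof
    fix f assume f: "f \<in> neumann_eigenspace G l 0"
    then obtain \<phi> where \<phi>: "\<And>e. e \<in> arcs G \<Longrightarrow> f e 0 = \<phi> (tail G e) \<and> f e (l e) = \<phi> (head G e)"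
      and zero: "\<And>e x. \<not> (e \<in> arcs G \<and> x \<in> {0..l e}) \<Longrightarrow> f e x = 0"
      unfolding neumann_eigenspace_def by blast
    note const = nonpositive_eigenfunction(1)[OF G(1) l _ f]
    have "\<phi> (tail G e) = \<phi> (head G e)" if "e \<in> arcs G" for e
      using const[of e "l e"] \<phi>[OF that] that l by (auto simp: is_metric_def less_imp_le)
    then have "\<phi> v = \<phi> r" if "v \<in> verts G" for v
      using grown_constant[OF gr(1) _ that, of \<phi>] gr(2) by blast
    then have "f e x = \<phi> r" if "e \<in> arcs G" "x \<in> {0..l e}" for e x
      using const[OF _ that] \<phi>[OF that(1)] that(1) by simp
    then have "f = edge_scale (\<phi> r) (const_one G l)"
      using zero by (auto simp: fun_eq_iff edge_scale_def const_one_def)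
    then show "f \<in> edge_fun.span {const_one G l}"
      by (simp add: edge_fun.span_base edge_fun.span_scale)
  qed
  moreover have "{const_one G l} \<subseteq> neumann_eigenspace G l 0" using const_one_eigenfunction[OF l] by simp
  ultimately have "edge_fun.span {const_one G l} = edge_fun.span (neumann_eigenspace G l 0)"
    by (metis edge_fun.span_eq edge_fun.span_superset subset_trans)
  moreover obtain e where e: "e \<in> arcs G" using G(2) by blast
  have "const_one G l e 0 = 1" using e l by (auto simp: const_one_def is_metric_def less_imp_le)
  then have ne: "const_one G l \<noteq> 0" by (auto simp: fun_eq_iff intro!: exI[of _ e] exI[of _ 0])
  then have "edge_fun.independent {const_one G l}" by (simp add: edge_fun.dependent_single)
  ultimately show "eigenvalue_multiplicity G l 0 = 1"
    using edge_fun.dim_eq_card[of "{const_one G l}"] by (simp add: eigenvalue_multiplicity_def)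
  show "neumann_eigenvalue G l 0"
    unfolding neumann_eigenvalue_def using ne const_one_eigenfunction[OF l] by blast
qed

text \<open>
  The dimension of an infinite-dimensional space would be 0, so finite dimension has to be shown:
  the eigenspace lies in the span of one cosine and one sine for each edge.
\<close>
lemma multiplicity_positive:
  assumes G: "fin_digraph G" and l: "is_metric G l" and \<kappa>: "0 < \<kappa>" and ev: "neumann_eigenvalue G l (\<kappa>\<^sup>2)"
  shows "1 \<le> eigenvalue_multiplicity G l (\<kappa>\<^sup>2)"
proof -
  interpret fin_digraph G by fact
  define cs where "cs = (\<lambda>e e' x. if e' = e \<and> x \<in> {0..l e} then cos (\<kappa> * x) else 0)"
  define sn where "sn = (\<lambda>e e' x. if e' = e \<and> x \<in> {0..l e} then sin (\<kappa> * x) else 0)"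
  define T where "T = cs ` arcs G \<union> sn ` arcs G"
  have "neumann_eigenspace G l (\<kappa>\<^sup>2) \<subseteq> edge_fun.span T"
  proof
    fix f assume "f \<in> neumann_eigenspace G l (\<kappa>\<^sup>2)"
    then obtain g where zero: "\<And>e x. \<not> (e \<in> arcs G \<and> x \<in> {0..l e}) \<Longrightarrow> f e x = 0"
    and df: "\<And>e x. e \<in> arcs G \<Longrightarrow> x \<in> {0..l e} \<Longrightarrow> (f e has_real_derivative g e x) (at x within {0..l e})"
    and dg: "\<And>e x. e \<in> arcs G \<Longrightarrow> x \<in> {0..l e} \<Longrightarrow> (g e has_real_derivative - (\<kappa>\<^sup>2 * f e x)) (at x within {0..l e})"
      unfolding neumann_eigenspace_def by blast
    have sol: "f e x = f e 0 * cos (\<kappa> * x) + g e 0 / \<kappa> * sin (\<kappa> * x)" if "e \<in> arcs G" "x \<in> {0..l e}" for e x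
      by (rule harmonic_oscillator(1)[OF \<kappa> df[OF that(1)] dg[OF that(1)] that(2)])
    define h where "h = (\<Sum>e\<in>arcs G. edge_scale (f e 0) (cs e) + edge_scale (g e 0 / \<kappa>) (sn e))"
    have sum_app: "(\<Sum>e\<in>A. F e) e' x = (\<Sum>e\<in>A. F e e' x)" for F :: "'b \<Rightarrow> 'b \<Rightarrow> real \<Rightarrow> real" and A e' x
      by (induction A rule: infinite_finite_induct) auto
    have "f = h"
    proof (intro ext)
      fix e x
      have "h e x = (\<Sum>e'\<in>arcs G. f e' 0 * cs e' e x + g e' 0 / \<kappa> * sn e' e x)"
        by (simp add: h_def sum_app edge_scale_def)
      also have "\<dots> = (\<Sum>e'\<in>arcs G. if e' = e then f e 0 * cs e e x + g e 0 / \<kappa> * sn e e x else 0)"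
        by (intro sum.cong refl) (auto simp: cs_def sn_def)
      also have "\<dots> = f e x"
        using sol[of e x] zero[of e x] by (auto simp: cs_def sn_def)
      finally show "f e x = h e x" by simp
    qed
    also have "h \<in> edge_fun.span T"
      unfolding h_def
      by (intro edge_fun.span_sum edge_fun.span_add edge_fun.span_scale edge_fun.span_base) (auto simp: T_def)
    finally show "f \<in> edge_fun.span T" .
  qed
  moreover obtain B where B: "B \<subseteq> neumann_eigenspace G l (\<kappa>\<^sup>2)" "edge_fun.independent B"
      "neumann_eigenspace G l (\<kappa>\<^sup>2) \<subseteq> edge_fun.span B" "card B = edge_fun.dim (neumann_eigenspace G l (\<kappa>\<^sup>2))"
    using edge_fun.basis_exists by blast
  ultimately have "finite B"
    using edge_fun.independent_span_bound[of T B] by (auto simp: T_def)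
  moreover have "B \<noteq> {}" using B(3) ev by (auto simp: neumann_eigenvalue_def)
  ultimately have "card B \<ge> 1" by (simp add: Suc_leI card_gt_0_iff)
  then show ?thesis using B(4) by (simp add: eigenvalue_multiplicity_def)
qed

section \<open>Growing trees in a graph\<close>

lemma connected_closed_vertex_set:
  assumes "wf_digraph H" "Digraph_Component.connected H" "r \<in> R" "r \<in> verts H"
    and closed: "\<And>e. e \<in> arcs H \<Longrightarrow> tail H e \<in> R \<longleftrightarrow> head H e \<in> R"
  shows "verts H \<subseteq> R"
proof
  interpret wf_digraph H by fact
  fix v assume "v \<in> verts H"
  then have "(r, v) \<in> rtrancl_on (verts H) ((arcs_ends H)\<^sup>s)"
    using assms(2)[unfolded connected_conv] assms(4) by simp
  then show "v \<in> R"
  proof (induction rule: rtrancl_on_induct)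
    case base then show ?case using assms(3) by blast
  next
    case (step y z)
    from step(2) have "(y, z) \<in> arcs_ends H \<or> (z, y) \<in> arcs_ends H" by (auto simp: symcl_def)
    then obtain e where "e \<in> arcs H" "tail H e = y \<and> head H e = z \<or> tail H e = z \<and> head H e = y"
      unfolding arcs_ends_def arc_to_ends_def by blast
    then show ?case using closed[of e] step(5) by auto
  qed
qed

text \<open>
  In a grown tree any two vertices are joined by a path, in the list format of \<open>undirected_cycle\<close>, so that
  one more edge between its ends closes a cycle.
\<close>
lemma grown_path:
  assumes "grown a b r R F" "x \<in> R" "y \<in> R"
  shows "\<exists>vs es. length vs = Suc (length es) \<and> vs ! 0 = x \<and> vs ! length es = y \<and> distinct vs \<and> distinct es \<and>
     set vs \<subseteq> R \<and> set es \<subseteq> F \<and> (\<forall>i<length es. {a (es ! i), b (es ! i)} = {vs ! i, vs ! Suc i})"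
  using assms
proof (induction arbitrary: x y rule: grown.induct)
  case root
  then show ?case by (intro exI[of _ "[r]"] exI[of _ "[]"]) auto
next
  case (grow R F u w e)
  note basic = grown_basic[OF grow.hyps(1)]
  have eF: "e \<notin> F" using basic grow.hyps(3,4) by auto
  consider "x \<in> R" "y \<in> R" | "x = w" "y \<in> R" | "x \<in> R" "y = w" | "x = w" "y = w"
    using grow.prems by blast
  then show ?case
  proof cases
    case 1
    from grow.IH[OF this] show ?thesis by blast
  next
    case 2
    from grow.IH[OF grow.hyps(2) 2(2)] obtain vs es where
      p: "length vs = Suc (length es)" "vs ! 0 = u" "vs ! length es = y" "distinct vs" "distinct es"
       "set vs \<subseteq> R" "set es \<subseteq> F" "\<forall>i<length es. {a (es ! i), b (es ! i)} = {vs ! i, vs ! Suc i}" by blast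
    show ?thesis
    proof (intro exI[of _ "w # vs"] exI[of _ "e # es"] conjI allI impI)
      fix i assume "i < length (e # es)"
      then show "{a ((e # es) ! i), b ((e # es) ! i)} = {(w # vs) ! i, (w # vs) ! Suc i}"
        using p(2,8) grow.hyps(4) by (cases i) auto
    qed (use p 2 eF grow.hyps(3) in auto)
  next
    case 3
    from grow.IH[OF 3(1) grow.hyps(2)] obtain vs es where
      p: "length vs = Suc (length es)" "vs ! 0 = x" "vs ! length es = u" "distinct vs" "distinct es"
       "set vs \<subseteq> R" "set es \<subseteq> F" "\<forall>i<length es. {a (es ! i), b (es ! i)} = {vs ! i, vs ! Suc i}" by blast
    show ?thesis
    proof (intro exI[of _ "vs @ [w]"] exI[of _ "es @ [e]"] conjI allI impI)
      fix i assume "i < length (es @ [e])"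
      then have "i < length es \<or> i = length es" by auto
      then show "{a ((es @ [e]) ! i), b ((es @ [e]) ! i)} = {(vs @ [w]) ! i, (vs @ [w]) ! Suc i}"
        using p(1,3,8) grow.hyps(4) by (auto simp: nth_append)
    qed (use p 3 eF grow.hyps(3) in \<open>auto simp: nth_append\<close>)
  next
    case 4
    then show ?thesis by (intro exI[of _ "[w]"] exI[of _ "[]"]) auto
  qed
qed

text \<open>
  A largest grown subtree contains all vertices by connectedness, and all arcs because any further arc would
  close a cycle.
\<close>
lemma undirected_tree_grown:
  assumes H: "fin_digraph H" and tree: "undirected_tree H" and r: "r \<in> verts H"
  shows "grown (tail H) (head H) r (verts H) (arcs H)"
proof -
  interpret fin_digraph H by fact
  let ?P = "\<lambda>R. \<exists>F. grown (tail H) (head H) r R F \<and> R \<subseteq> verts H \<and> F \<subseteq> arcs H"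
  have "?P {r}" using r by (auto intro: grown.root)
  moreover have "\<forall>R. ?P R \<longrightarrow> card R < Suc (card (verts H))" by (auto intro: card_mono simp: less_Suc_eq_le)
  ultimately have "\<exists>R. ?P R \<and> (\<forall>R'. ?P R' \<longrightarrow> card R' \<le> card R)"
    by (rule ex_has_greatest_nat)
  then obtain R where "?P R" and max: "\<And>R'. ?P R' \<Longrightarrow> card R' \<le> card R" by blast
  then obtain F where gr: "grown (tail H) (head H) r R F" and sub: "R \<subseteq> verts H" "F \<subseteq> arcs H" by blast
  note basic = grown_basic[OF gr]
  have closed: "tail H e \<in> R \<longleftrightarrow> head H e \<in> R" if e: "e \<in> arcs H" for e
  proof (rule ccontr)
    assume "\<not> ?thesis"
    then obtain u w where uw: "u \<in> R" "w \<notin> R" "(tail H e = u \<and> head H e = w) \<or> (tail H e = w \<and> head H e = u)"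
      by blast
    have "?P (insert w R)"
      using grown.grow[OF gr uw] sub e uw(3) by (intro exI[of _ "insert e F"]) auto
    from max[OF this] show False using basic uw(2) by simp
  qed
  have R: "R = verts H"
    using connected_closed_vertex_set[OF wf_digraph_axioms _ _ r closed] tree basic sub
    by (auto simp: undirected_tree_def)
  have "arcs H \<subseteq> F"
  proof
    fix e assume e: "e \<in> arcs H"
    show "e \<in> F"
    proof (rule ccontr)
      assume nF: "e \<notin> F"
      obtain vs es where p: "length vs = Suc (length es)" "vs ! 0 = tail H e" "vs ! length es = head H e"
        "distinct vs" "distinct es" "set vs \<subseteq> R" "set es \<subseteq> F"
        "\<forall>i<length es. {tail H (es ! i), head H (es ! i)} = {vs ! i, vs ! Suc i}"
        using grown_path[OF gr, of "tail H e" "head H e"] e R by auto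
      have "undirected_cycle H vs (es @ [e])"
        unfolding undirected_cycle_def
      proof (intro conjI allI impI)
        fix i assume "i < length (es @ [e])"
        then have "i < length es \<or> i = length es" by auto
        then show "{tail H ((es @ [e]) ! i), head H ((es @ [e]) ! i)} = {vs ! i, vs ! (Suc i mod length (es @ [e]))}"
          using p(2,3,8) by (auto simp: nth_append)
      qed (use p nF e R sub in auto)
      then show False using tree by (auto simp: undirected_tree_def)
    qed
  qed
  then show ?thesis using gr R sub by (simp add: subset_antisym)
qed

text \<open>
  A tree rooted at \<open>r\<close> can be grown from a new vertex \<open>c\<close> joined to \<open>r\<close>.
\<close>
lemma grown_from_neighbour:
  assumes "grown a b r R F" "c \<notin> R" "(a e = c \<and> b e = r) \<or> (a e = r \<and> b e = c)"
  shows "grown a b c (insert c R) (insert e F)"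
  using assms
proof (induction rule: grown.induct)
  case root
  then have "grown a b c (insert r {c}) (insert e {})" by (intro grown.grow[OF grown.root]) auto
  then show ?case by (simp add: insert_commute)
next
  case (grow R F u w e')
  then have g: "grown a b c (insert c R) (insert e F)" by simp
  have "grown a b c (insert w (insert c R)) (insert e' (insert e F))"
    by (rule grown.grow[OF g _ _ grow.hyps(4)]) (use grow.hyps grow.prems in auto)
  then show ?case by (simp add: insert_commute)
qed

lemma grown_incident:
  assumes "grown a b r R F" "v \<in> R" "v \<noteq> r"
  shows "\<exists>e\<in>F. a e = v \<or> b e = v"
  using assms by (induction rule: grown.induct) auto

lemma grown_card:
  assumes "grown a b r R F"
  shows "card R = Suc (card F)"
  using assms
proof (induction rule: grown.induct)
  case (grow R F u w e)
  note basic = grown_basic[OF grow.hyps(1)]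
  have "e \<notin> F" using basic grow.hyps(3,4) by auto
  then show ?case using grow basic by simp
qed simp

lemma grown_chain:
  assumes gr: "grown a b r X Y" and p0: "p 0 \<in> X"
    and new: "\<And>i. 1 \<le> i \<Longrightarrow> i \<le> n \<Longrightarrow> p i \<notin> X" and inj: "inj_on p {1..n}"
    and join: "\<And>i. i < n \<Longrightarrow> (a (q i) = p i \<and> b (q i) = p (Suc i)) \<or> (a (q i) = p (Suc i) \<and> b (q i) = p i)"
  shows "grown a b r (X \<union> p ` {1..n}) (Y \<union> q ` {..<n})"
proof -
  have "m \<le> n \<Longrightarrow> grown a b r (X \<union> p ` {1..m}) (Y \<union> q ` {..<m})" for m
  proof (induction m)
    case 0 then show ?case using gr by simp
  next
    case (Suc m)
    have g: "grown a b r (X \<union> p ` {1..m}) (Y \<union> q ` {..<m})" using Suc by simp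
    have pm: "p m \<in> X \<union> p ` {1..m}" using p0 by (cases m) auto
    have "p (Suc m) \<notin> p ` {1..m}"
    proof
      assume "p (Suc m) \<in> p ` {1..m}"
      then obtain i where i: "i \<in> {1..m}" "p (Suc m) = p i" by blast
      then have "Suc m = i" using inj_onD[OF inj i(2)] Suc.prems by simp
      then show False using i by simp
    qed
    then have nw: "p (Suc m) \<notin> X \<union> p ` {1..m}" using new[of "Suc m"] Suc.prems by simp
    have "grown a b r (insert (p (Suc m)) (X \<union> p ` {1..m})) (insert (q m) (Y \<union> q ` {..<m}))"
      by (rule grown.grow[OF g pm nw]) (use join[of m] Suc.prems in simp)
    moreover have "{1..Suc m} = insert (Suc m) {1..m}" "{..<Suc m} = insert m {..<m}" by auto
    ultimately show ?case by simp
  qed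
  then show ?thesis by simp
qed

section \<open>Subdivision of edges\<close>

text \<open>
  Each arc \<open>e\<close> is cut into \<open>N\<close> segments \<open>(e, 0), \<dots>, (e, N - 1)\<close>.  Segment \<open>(e, i)\<close> runs from node \<open>i\<close> to node
  \<open>i + 1\<close> of \<open>e\<close>, where nodes \<open>0\<close> and \<open>N\<close> are the original end vertices.
\<close>
definition sub_node :: "('v, 'e) pre_digraph \<Rightarrow> nat \<Rightarrow> 'e \<Rightarrow> nat \<Rightarrow> 'v + 'e \<times> nat" where
  "sub_node G N e i = (if i = 0 then Inl (tail G e) else if i = N then Inl (head G e) else Inr (e, i))"

abbreviation "sub_tail G N \<equiv> \<lambda>(e, i). sub_node G N e i"
abbreviation "sub_head G N \<equiv> \<lambda>(e, i). sub_node G N e (Suc i)"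

definition sub_verts :: "'v set \<Rightarrow> 'e set \<Rightarrow> nat \<Rightarrow> ('v + 'e \<times> nat) set" where
  "sub_verts R F N = Inl ` R \<union> Inr ` (F \<times> {1..<N})"

text \<open>
  The segments of \<open>e\<close> form a chain that starts at the end \<open>u\<close> already reached, whether this is the tail or the
  head of \<open>e\<close>.  If the other end \<open>w\<close> is new, the whole chain is attached.  If \<open>w\<close> is already in the
  tree, the chain stops before the segment at \<open>w\<close>, which remains outside the tree.
\<close>
lemma grown_along_arc:
  assumes N: "0 < N" and gr: "grown (sub_tail G N) (sub_head G N) r (sub_verts R F N) Y"
    and e: "e \<notin> F" and uw: "(tail G e = u \<and> head G e = w) \<or> (tail G e = w \<and> head G e = u)" "u \<in> R" "u \<noteq> w"
  shows "w \<notin> R \<Longrightarrow> grown (sub_tail G N) (sub_head G N) r (sub_verts (insert w R) (insert e F) N) (Y \<union> {e} \<times> {..<N})"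
    and "grown (sub_tail G N) (sub_head G N) r (sub_verts R (insert e F) N)
       (Y \<union> {e} \<times> ({..<N} - {if tail G e = w then 0 else N - 1}))"
proof -
  \<comment> \<open>\<open>rev\<close> and \<open>q\<close> number the nodes and the segments of \<open>e\<close> as seen from \<open>u\<close>.\<close>
  define rev where "rev = (\<lambda>i. if tail G e = u then i else N - i)"
  define p where "p = (\<lambda>i. sub_node G N e (rev i))"
  define q where "q = (\<lambda>i. (e, if tail G e = u then i else N - 1 - i))"
  have inner: "p i = Inr (e, rev i)" "rev i \<in> {1..<N}" if "1 \<le> i" "i < N" for i
    using that N by (auto simp: p_def rev_def sub_node_def)
  have ends: "p 0 = Inl u" "p N = Inl w" using uw N by (auto simp: p_def rev_def sub_node_def)
  have inj: "inj_on p {1..N - 1}"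
  proof (rule inj_onI)
    fix i j assume "i \<in> {1..N - 1}" "j \<in> {1..N - 1}" "p i = p j"
    then have "rev i = rev j" "i < N" "j < N" using inner(1)[of i] inner(1)[of j] by auto
    then show "i = j" by (auto simp: rev_def split: if_splits)
  qed
  have join: "(sub_tail G N (q i) = p i \<and> sub_head G N (q i) = p (Suc i)) \<or>
      (sub_tail G N (q i) = p (Suc i) \<and> sub_head G N (q i) = p i)" if "i < N" for i
    using that by (auto simp: p_def q_def rev_def Suc_diff_Suc)
  have new: "p i \<notin> sub_verts R F N" if "1 \<le> i" "i < N" for i
    using inner(1)[OF that] e by (auto simp: sub_verts_def)
  have start: "p 0 \<in> sub_verts R F N" using ends uw by (simp add: sub_verts_def)
  have pimg: "p ` {1..N - 1} = Inr ` ({e} \<times> {1..<N})"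
  proof -
    have "p ` {1..N - 1} = (\<lambda>i. Inr (e, i)) ` rev ` {1..N - 1}"
      unfolding image_image using inner by (intro image_cong) auto
    also have "rev ` {1..N - 1} = {1..<N}"
    proof
      show "rev ` {1..N - 1} \<subseteq> {1..<N}" using inner(2) by fastforce
      show "{1..<N} \<subseteq> rev ` {1..N - 1}"
      proof
        fix i assume i: "i \<in> {1..<N}"
        then have "i = rev (rev i)" "rev i \<in> {1..N - 1}" by (auto simp: rev_def)
        then show "i \<in> rev ` {1..N - 1}" by blast
      qed
    qed
    finally show ?thesis by auto
  qed
  have "grown (sub_tail G N) (sub_head G N) r (sub_verts R F N \<union> p ` {1..N - 1}) (Y \<union> q ` {..<N - 1})"
    using N by (intro grown_chain[OF gr start new inj join]) auto
  moreover have "sub_verts R F N \<union> p ` {1..N - 1} = sub_verts R (insert e F) N"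
    unfolding pimg by (auto simp: sub_verts_def)
  moreover have "q ` {..<N - 1} = {e} \<times> ({..<N} - {if tail G e = w then 0 else N - 1})"
  proof (cases "tail G e = u")
    case True
    then show ?thesis using uw N by (auto simp: q_def)
  next
    case False
    then have t: "tail G e = w" using uw by blast
    have "(\<lambda>i. N - 1 - i) ` {..<N - 1} = {..<N} - {0}"
    proof
      show "(\<lambda>i. N - 1 - i) ` {..<N - 1} \<subseteq> {..<N} - {0}" by auto
      show "{..<N} - {0} \<subseteq> (\<lambda>i. N - 1 - i) ` {..<N - 1}"
      proof
        fix i assume "i \<in> {..<N} - {0}"
        then have "i = N - 1 - (N - 1 - i)" "N - 1 - i \<in> {..<N - 1}" by auto
        then show "i \<in> (\<lambda>i. N - 1 - i) ` {..<N - 1}" by blast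
      qed
    qed
    moreover have "q ` {..<N - 1} = Pair e ` (\<lambda>i. N - 1 - i) ` {..<N - 1}"
      using False by (simp add: q_def image_image)
    ultimately show ?thesis using t by auto
  qed
  ultimately show gr1: "grown (sub_tail G N) (sub_head G N) r (sub_verts R (insert e F) N)
       (Y \<union> {e} \<times> ({..<N} - {if tail G e = w then 0 else N - 1}))" by simp
  assume w: "w \<notin> R"
  have last: "p (N - 1) \<in> sub_verts R (insert e F) N"
  proof (cases "N = 1")
    case True
    then show ?thesis using ends(1) uw(2) by (simp add: sub_verts_def)
  next
    case False
    then have "1 \<le> N - 1" "N - 1 < N" using N by auto
    then show ?thesis using inner[of "N - 1"] by (auto simp: sub_verts_def)
  qed
  have "grown (sub_tail G N) (sub_head G N) r (insert (p N) (sub_verts R (insert e F) N))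
      (insert (q (N - 1)) (Y \<union> {e} \<times> ({..<N} - {if tail G e = w then 0 else N - 1})))"
  proof (rule grown.grow[OF gr1 last])
    show "p N \<notin> sub_verts R (insert e F) N" using ends w by (auto simp: sub_verts_def)
    show "(sub_tail G N (q (N - 1)) = p (N - 1) \<and> sub_head G N (q (N - 1)) = p N) \<or>
      (sub_tail G N (q (N - 1)) = p N \<and> sub_head G N (q (N - 1)) = p (N - 1))"
      using join[of "N - 1"] N by simp
  qed
  moreover have "insert (p N) (sub_verts R (insert e F) N) = sub_verts (insert w R) (insert e F) N"
    using ends by (auto simp: sub_verts_def)
  moreover have "insert (q (N - 1)) (Y \<union> {e} \<times> ({..<N} - {if tail G e = w then 0 else N - 1})) = Y \<union> {e} \<times> {..<N}"
    using N uw by (auto simp: q_def)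
  ultimately show "grown (sub_tail G N) (sub_head G N) r (sub_verts (insert w R) (insert e F) N) (Y \<union> {e} \<times> {..<N})"
    by simp
qed

lemma grown_subdivision:
  assumes "grown (tail G) (head G) r R F" "0 < N"
  shows "grown (sub_tail G N) (sub_head G N) (Inl r) (sub_verts R F N) (F \<times> {..<N})"
  using assms(1)
proof (induction rule: grown.induct)
  case root
  show ?case using grown.root[of "sub_tail G N" "sub_head G N" "Inl r"] by (simp add: sub_verts_def)
next
  case (grow R F u w e)
  note basic = grown_basic[OF grow.hyps(1)]
  have eF: "e \<notin> F" "u \<noteq> w" using basic grow.hyps(2-4) by auto
  have "F \<times> {..<N} \<union> {e} \<times> {..<N} = insert e F \<times> {..<N}" by auto
  then show ?case
    using grown_along_arc(1)[OF assms(2) grow.IH eF(1) grow.hyps(4,2) eF(2) grow.hyps(3)] by simp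
qed

text \<open>
  The arcs \<open>A\<close> at the vertex \<open>c\<close> outside the original tree are followed from their other ends up to
  the last node before \<open>c\<close>, so each of them leaves out exactly its segment at \<open>c\<close>.
\<close>
lemma grown_subdivision_extra:
  assumes "grown (sub_tail G N) (sub_head G N) (Inl r) (sub_verts R F N) Y" "0 < N"
    and "finite A" "A \<inter> F = {}"
    and "\<And>e. e \<in> A \<Longrightarrow> (tail G e = c \<and> head G e \<in> R - {c}) \<or> (head G e = c \<and> tail G e \<in> R - {c})"
  shows "grown (sub_tail G N) (sub_head G N) (Inl r) (sub_verts R (F \<union> A) N)
     (Y \<union> (A \<times> {..<N} - (\<lambda>e. (e, if tail G e = c then 0 else N - 1)) ` A))"
  using assms(3-5)
proof (induction A rule: finite_induct)
  case empty
  then show ?case using assms(1) by simp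
next
  case (insert e A)
  let ?last = "\<lambda>e. (e, if tail G e = c then 0 else N - 1)"
  have IH: "grown (sub_tail G N) (sub_head G N) (Inl r) (sub_verts R (F \<union> A) N) (Y \<union> (A \<times> {..<N} - ?last ` A))"
    using insert by auto
  have eF: "e \<notin> F \<union> A" using insert by auto
  obtain u where u: "(tail G e = u \<and> head G e = c) \<or> (tail G e = c \<and> head G e = u)" "u \<in> R" "u \<noteq> c"
    using insert.prems(2)[of e] by auto
  have "Y \<union> (A \<times> {..<N} - ?last ` A) \<union> {e} \<times> ({..<N} - {if tail G e = c then 0 else N - 1})
      = Y \<union> (insert e A \<times> {..<N} - ?last ` insert e A)"
    using insert.hyps(2) by auto
  then show ?case
    using grown_along_arc(2)[OF assms(2) IH eF u] by simp
qed

section \<open>Eigenfunctions from singular vectors\<close>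

lemma seg_form_indicator:
  assumes "finite E"
  shows "seg_form a b s E x (\<lambda>u. if u = v then 1 else 0) =
    (\<Sum>e\<in>{e\<in>E. a e = v}. (x (a e) * cos (s e) - x (b e)) / sin (s e)) +
    (\<Sum>e\<in>{e\<in>E. b e = v}. (x (b e) * cos (s e) - x (a e)) / sin (s e))"
  unfolding seg_form_def sum.inter_filter[OF assms] sum.distrib[symmetric]
  by (intro sum.cong refl) (auto simp: add_divide_distrib[symmetric] algebra_simps)

text \<open>
  The vertex condition at an interior node of a subdivided arc is the addition theorem
  \<open>cos (t + h) + cos (t - h) = 2 cos h cos t\<close> (and likewise for the sine), so the node values of an arc are
  those of a single solution on the whole arc.
\<close>
lemma trigonometric_recurrence:
  fixes X :: "nat \<Rightarrow> real"
  assumes rec: "\<And>i. 1 \<le> i \<Longrightarrow> i < N \<Longrightarrow> X (Suc i) = 2 * cos h * X i - X (i - 1)" and h: "sin h \<noteq> 0" and N: "i \<le> N"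
  shows "X i = X 0 * cos (i * h) + (X 1 - X 0 * cos h) / sin h * sin (i * h)"
  using N
proof (induction i rule: less_induct)
  case (less i)
  consider "i = 0" | "i = 1" | j where "i = Suc (Suc j)" by (metis One_nat_def not0_implies_Suc)
  then show ?case
  proof cases
    case 1 then show ?thesis by simp
  next
    case 2 then show ?thesis using h by simp
  next
    case 3
    define B where "B = (X 1 - X 0 * cos h) / sin h"
    define t where "t = real (Suc j) * h"
    have t: "real i * h = t + h" "real j * h = t - h" by (simp_all add: 3 t_def algebra_simps)
    have "X i = 2 * cos h * X (Suc j) - X j" using rec[of "Suc j"] less.prems 3 by simp
    also have "X (Suc j) = X 0 * cos t + B * sin t"
      using less.IH[of "Suc j"] less.prems 3 unfolding B_def t_def by simp
    also have "X j = X 0 * cos (t - h) + B * sin (t - h)"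
      using less.IH[of j] less.prems 3 unfolding B_def t(2)[symmetric] by simp
    also have "2 * cos h * (X 0 * cos t + B * sin t) - (X 0 * cos (t - h) + B * sin (t - h))
       = X 0 * cos (t + h) + B * sin (t + h)"
      by (simp add: cos_add cos_diff sin_add sin_diff algebra_simps)
    finally show ?thesis unfolding B_def t(1) .
  qed
qed

text \<open>
  Testing the form against the indicator of a node gives the vertex condition at this node.  At the interior
  nodes of an arc it makes the node values fit one function \<open>A cos (\<kappa> t) + B sin (\<kappa> t)\<close>; at the
  vertices of the graph it is the Kirchhoff condition for these functions.
\<close>
lemma eigenvalue_of_singular_vector:
  fixes G :: "('v, 'e) pre_digraph"
  assumes G: "fin_digraph G" and l: "is_metric G l" and \<kappa>: "0 < \<kappa>" and N: "0 < N"
    and short: "\<And>e. e \<in> arcs G \<Longrightarrow> \<kappa> * (l e / N) < pi"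
    and inc: "\<And>v. v \<in> verts G \<Longrightarrow> \<exists>e\<in>arcs G. tail G e = v \<or> head G e = v"
    and x: "supported_in x (sub_verts (verts G) (arcs G) N)" "\<exists>v. x v \<noteq> 0"
    and sing: "\<And>y. supported_in y (sub_verts (verts G) (arcs G) N) \<Longrightarrow>
      seg_form (sub_tail G N) (sub_head G N) (\<lambda>p. \<kappa> * (l (fst p) / N)) (arcs G \<times> {..<N}) x y = 0"
  shows "neumann_eigenvalue G l (\<kappa>\<^sup>2)"
proof -
  interpret fin_digraph G by fact
  define X where "X = (\<lambda>e i. x (sub_node G N e i))"
  define h where "h = (\<lambda>e. \<kappa> * (l e / N))"
  have l0: "0 < l e" if "e \<in> arcs G" for e using l that by (simp add: is_metric_def)
  have hN: "real N * h e = \<kappa> * l e" for e using N by (simp add: h_def)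
  have sin0: "0 < sin (h e)" if "e \<in> arcs G" for e
    using short[OF that] l0[OF that] \<kappa> N by (intro sin_gt_zero) (auto simp: h_def)
  let ?E = "arcs G \<times> {..<N}"
  have kirch: "(\<Sum>p\<in>{p\<in>?E. sub_tail G N p = v}. (x (sub_tail G N p) * cos (h (fst p)) - x (sub_head G N p)) / sin (h (fst p))) +
     (\<Sum>p\<in>{p\<in>?E. sub_head G N p = v}. (x (sub_head G N p) * cos (h (fst p)) - x (sub_tail G N p)) / sin (h (fst p))) = 0"
    if "v \<in> sub_verts (verts G) (arcs G) N" for v
  proof -
    have "supported_in (\<lambda>u. if u = v then 1 else 0) (sub_verts (verts G) (arcs G) N)"
      using that by (auto simp: supported_in_def)
    from sing[OF this] show ?thesis by (simp add: seg_form_indicator h_def)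
  qed
  have rec: "X e (Suc i) = 2 * cos (h e) * X e i - X e (i - 1)" if e: "e \<in> arcs G" and i: "1 \<le> i" "i < N" for e i
  proof -
    have "{p\<in>?E. sub_tail G N p = Inr (e, i)} = {(e, i)}"
      using e i by (auto simp: sub_node_def split: if_splits)
    moreover have "{p\<in>?E. sub_head G N p = Inr (e, i)} = {(e, i - 1)}"
      using e i by (auto simp: sub_node_def split: if_splits)
    moreover have "Inr (e, i) \<in> sub_verts (verts G) (arcs G) N" using e i by (auto simp: sub_verts_def)
    ultimately have "(X e i * cos (h e) - X e (Suc i)) / sin (h e) + (X e i * cos (h e) - X e (i - 1)) / sin (h e) = 0"
      using kirch[of "Inr (e, i)"] i by (simp add: X_def)
    then show ?thesis using sin0[OF e] by (simp add: add_divide_distrib[symmetric])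
  qed
  define A where "A = (\<lambda>e. X e 0)"
  define B where "B = (\<lambda>e. (X e 1 - X e 0 * cos (h e)) / sin (h e))"
  have trig: "X e i = A e * cos (i * h e) + B e * sin (i * h e)" if "e \<in> arcs G" "i \<le> N" for e i
    unfolding A_def B_def
    by (rule trigonometric_recurrence[OF rec[OF that(1)] _ that(2)]) (use sin0[OF that(1)] in auto)
  define f where "f = (\<lambda>e t. if e \<in> arcs G \<and> t \<in> {0..l e} then A e * cos (\<kappa> * t) + B e * sin (\<kappa> * t) else 0)"
  define g where "g = (\<lambda>e t. \<kappa> * (B e * cos (\<kappa> * t) - A e * sin (\<kappa> * t)))"
  have fX: "f e (i * l e / N) = X e i" if "e \<in> arcs G" "i \<le> N" for e i
  proof -
    have "real i * l e / real N \<le> l e" using that l0[OF that(1)] N by (simp add: divide_le_eq mult.commute)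
    moreover have "\<kappa> * (real i * l e / real N) = real i * h e" by (simp add: h_def)
    ultimately show ?thesis using that l0[OF that(1)] trig[OF that] by (simp add: f_def)
  qed
  have Kv: "(\<Sum>e\<in>out_arcs G v. g e 0) + (\<Sum>e\<in>in_arcs G v. - g e (l e)) = 0" if v: "v \<in> verts G" for v
  proof -
    have "{p\<in>?E. sub_tail G N p = Inl v} = (\<lambda>e. (e, 0)) ` out_arcs G v"
      using N by (auto simp: sub_node_def split: if_splits)
    moreover have "{p\<in>?E. sub_head G N p = Inl v} = (\<lambda>e. (e, N - 1)) ` in_arcs G v"
      using N by (auto simp: sub_node_def split: if_splits)
    moreover have "Inl v \<in> sub_verts (verts G) (arcs G) N" using v by (auto simp: sub_verts_def)
    ultimately have "(\<Sum>e\<in>out_arcs G v. (X e 0 * cos (h e) - X e 1) / sin (h e)) +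
        (\<Sum>e\<in>in_arcs G v. (X e N * cos (h e) - X e (N - 1)) / sin (h e)) = 0"
      using kirch[of "Inl v"] N by (simp add: sum.reindex inj_on_def X_def)
    moreover have "(X e 0 * cos (h e) - X e 1) / sin (h e) = - g e 0 / \<kappa>" for e
      using \<kappa> by (simp add: g_def B_def A_def divide_simps)
    moreover have "(X e N * cos (h e) - X e (N - 1)) / sin (h e) = g e (l e) / \<kappa>" if "e \<in> in_arcs G v" for e
    proof -
      have e: "e \<in> arcs G" using that by simp
      have "real (N - 1) * h e = \<kappa> * l e - h e" using N hN[of e] by (simp add: of_nat_diff algebra_simps)
      then have "X e (N - 1) = A e * cos (\<kappa> * l e - h e) + B e * sin (\<kappa> * l e - h e)"
        using trig[OF e, of "N - 1"] by simp
      moreover have "X e N = A e * cos (\<kappa> * l e) + B e * sin (\<kappa> * l e)"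
        using trig[OF e, of N] hN[of e] by simp
      ultimately have "X e N * cos (h e) - X e (N - 1) = (B e * cos (\<kappa> * l e) - A e * sin (\<kappa> * l e)) * sin (h e)"
        by (simp add: cos_diff sin_diff algebra_simps)
      then show ?thesis using sin0[OF e] \<kappa> by (simp add: g_def)
    qed
    ultimately have "(\<Sum>e\<in>out_arcs G v. - g e 0 / \<kappa>) + (\<Sum>e\<in>in_arcs G v. g e (l e) / \<kappa>) = 0" by simp
    then have "(- (\<Sum>e\<in>out_arcs G v. g e 0) + (\<Sum>e\<in>in_arcs G v. g e (l e))) / \<kappa> = 0"
      by (auto simp add: sum_divide_distrib[symmetric] sum_negf add_divide_distrib)
    then show ?thesis using \<kappa> by (simp add: sum_negf)
  qed
  have "f \<in> neumann_eigenspace G l (\<kappa>\<^sup>2)"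
    unfolding neumann_eigenspace_def
  proof (intro CollectI conjI exI[of _ g] exI[of _ "\<lambda>v. x (Inl v)"] ballI allI impI Kv)
    fix e t assume "\<not> (e \<in> arcs G \<and> t \<in> {0..l e})"
    then show "f e t = 0" unfolding f_def by (rule if_not_P)
  next
    fix e assume e: "e \<in> arcs G"
    show "f e 0 = x (Inl (tail G e))" using fX[OF e, of 0] by (simp add: X_def sub_node_def)
    show "f e (l e) = x (Inl (head G e))" using fX[OF e, of N] N by (simp add: X_def sub_node_def)
    fix t assume t: "t \<in> {0..l e}"
    show "(f e has_real_derivative g e t) (at t within {0..l e})"
    proof (rule has_real_derivative_transform_on[OF t])
      show "f e y = A e * cos (\<kappa> * y) + B e * sin (\<kappa> * y)" if "y \<in> {0..l e}" for y
        using that e by (simp add: f_def)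
      show "((\<lambda>y. A e * cos (\<kappa> * y) + B e * sin (\<kappa> * y)) has_real_derivative g e t) (at t within {0..l e})"
        unfolding g_def by (auto intro!: derivative_eq_intros simp: algebra_simps)
    qed
    have "f e t = A e * cos (\<kappa> * t) + B e * sin (\<kappa> * t)" using t e by (simp add: f_def)
    then show "(g e has_real_derivative - (\<kappa>\<^sup>2 * f e t)) (at t within {0..l e})"
      unfolding g_def by (auto intro!: derivative_eq_intros simp: algebra_simps power2_eq_square)
  qed
  moreover have "f \<noteq> 0"
  proof
    assume "f = 0"
    then have X0: "X e i = 0" if "e \<in> arcs G" "i \<le> N" for e i using fX[OF that] by simp
    have "x v = 0" if v: "v \<in> sub_verts (verts G) (arcs G) N" for v
    proof (cases v)
      case (Inl u)
      then have "u \<in> verts G" using v by (auto simp: sub_verts_def)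
      then obtain e where "e \<in> arcs G" "tail G e = u \<or> head G e = u" using inc by blast
      then show ?thesis using X0[of e 0] X0[of e N] N Inl by (auto simp: X_def sub_node_def)
    next
      case (Inr p)
      then obtain e i where "p = (e, i)" "e \<in> arcs G" "i \<in> {1..<N}" using v by (auto simp: sub_verts_def)
      then show ?thesis using X0[of e i] Inr by (auto simp: X_def sub_node_def)
    qed
    then show False using x by (auto simp: supported_in_def)
  qed
  ultimately show ?thesis unfolding neumann_eigenvalue_def by blast
qed

section \<open>The upper bound\<close>

text \<open>
  The graphs of the theorem: an induced tree on \<open>S\<close> with arcs \<open>T\<close>, and one further vertex \<open>c\<close>.  The arc \<open>e0\<close>
  from \<open>c\<close> to \<open>r\<close> extends the tree to a spanning tree rooted at \<open>c\<close>.
\<close>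
locale apex_tree = fin_digraph G for G :: "('v, 'e) pre_digraph" +
  fixes c r :: 'v and e0 :: 'e and S :: "'v set" and T :: "'e set"
  assumes verts_eq: "verts G = insert c S" and c_notin: "c \<notin> S"
    and tree: "grown (tail G) (head G) r S T" and T_arcs: "T \<subseteq> arcs G"
    and apex_arc: "e \<in> arcs G - T \<Longrightarrow> (tail G e = c \<and> head G e \<in> S) \<or> (head G e = c \<and> tail G e \<in> S)"
    and e0: "e0 \<in> arcs G - T" and e0_ends: "(tail G e0 = c \<and> head G e0 = r) \<or> (tail G e0 = r \<and> head G e0 = c)"
    and degree: "v \<in> S \<Longrightarrow> 2 \<le> vertex_degree G v"
begin

lemma spanning: "grown (tail G) (head G) c (verts G) (insert e0 T)"
  unfolding verts_eq by (rule grown_from_neighbour[OF tree c_notin e0_ends])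

lemma loopless: "e \<in> arcs G \<Longrightarrow> tail G e \<noteq> head G e"
  using apex_arc[of e] grown_basic[OF tree] c_notin by (cases "e \<in> T") auto

lemma betti_eq: "betti G = int (card (arcs G - insert e0 T))"
proof -
  have "card (verts G) = Suc (card (insert e0 T))" by (rule grown_card[OF spanning])
  moreover have "card (arcs G - insert e0 T) = card (arcs G) - card (insert e0 T)"
    using e0 T_arcs grown_basic[OF spanning] by (intro card_Diff_subset) auto
  moreover have "card (insert e0 T) \<le> card (arcs G)" using e0 T_arcs by (intro card_mono) auto
  ultimately show ?thesis by (simp add: betti_def)
qed

lemma apex_degree: "int (card (arcs G - T)) = 1 + betti G"
proof -
  have "arcs G - T = insert e0 (arcs G - insert e0 T)" using e0 by auto
  then have "card (arcs G - T) = card (insert e0 (arcs G - insert e0 T))" by (rule arg_cong)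
  also have "\<dots> = Suc (card (arcs G - insert e0 T))" by (intro card_insert_disjoint) auto
  finally show ?thesis by (simp add: betti_eq)
qed

lemma incident_arc: "v \<in> verts G \<Longrightarrow> \<exists>e\<in>arcs G. tail G e = v \<or> head G e = v"
  using grown_incident[OF spanning, of v] e0 e0_ends T_arcs by (cases "v = c") auto

text \<open>
  An original vertex keeps its degree, since the segments at its end of its arcs are distinct; an interior
  node lies on two segments.
\<close>
lemma subdivided_degree:
  assumes N: "0 < N" and v: "v \<in> sub_verts (verts G) (arcs G) N - {Inl c}"
  shows "2 \<le> card {p\<in>arcs G \<times> {..<N}. sub_tail G N p = v \<or> sub_head G N p = v}" (is "2 \<le> card ?P")
proof (cases v)
  case (Inl u)
  have u: "u \<in> S" using v Inl by (auto simp: sub_verts_def verts_eq)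
  let ?f = "\<lambda>e. (e, if tail G e = u then 0 else N - 1)"
  have fin: "finite (out_arcs G u)" "finite (in_arcs G u)" by (simp_all add: out_arcs_def in_arcs_def)
  have disj: "out_arcs G u \<inter> in_arcs G u = {}" using loopless by auto
  have "vertex_degree G u = card (out_arcs G u \<union> in_arcs G u)"
    using card_Un_disjoint[OF fin disj] by (simp add: vertex_degree_def out_degree_def in_degree_def)
  also have "\<dots> = card (?f ` (out_arcs G u \<union> in_arcs G u))"
    by (rule card_image[symmetric]) (auto simp: inj_on_def)
  also have "\<dots> \<le> card ?P"
    using N Inl by (intro card_mono) (auto simp: sub_node_def)
  finally show ?thesis using degree[OF u] by simp
next
  case (Inr p)
  then obtain e i where p: "p = (e, i)" "e \<in> arcs G" "i \<in> {1..<N}" using v by (auto simp: sub_verts_def)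
  then have "{(e, i), (e, i - 1)} \<subseteq> ?P" using Inr by (auto simp: sub_node_def)
  then have "card {(e, i), (e, i - 1)} \<le> card ?P" by (intro card_mono) auto
  moreover have "card {(e, i), (e, i - 1)} = 2" using p by auto
  ultimately show ?thesis by simp
qed

text \<open>
  \<open>N\<close> is chosen so large that every segment has phase below \<open>\<pi>\<close> at frequency \<open>K\<close>.  The spanning tree of
  the subdivided graph leaves out one segment for each arc at \<open>c\<close> other than \<open>e0\<close>, and these are \<open>\<beta>\<close> in number.
\<close>
lemma ex_eigenvalue_below:
  assumes l: "is_metric G l" and K: "0 < K" and long: "pi * (1 + of_int (betti G)) < K * total_length G l"
  shows "\<exists>\<kappa>. 0 < \<kappa> \<and> \<kappa> \<le> K \<and> neumann_eigenvalue G l (\<kappa>\<^sup>2)"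
proof -
  have l0: "0 < l e" if "e \<in> arcs G" for e using l that by (simp add: is_metric_def)
  have lL: "l e \<le> total_length G l" if "e \<in> arcs G" for e
    unfolding total_length_def using that l0 by (intro member_le_sum) (auto simp: less_imp_le)
  obtain N :: nat where N: "K * total_length G l / pi < N" using reals_Archimedean2 by blast
  have short: "K * (l e / N) < pi" "0 < N" if "e \<in> arcs G" for e
  proof -
    have "K * l e \<le> K * total_length G l" using lL[OF that] K by simp
    moreover have "K * total_length G l < N * pi" using N by (simp add: divide_less_eq)
    ultimately have *: "K * l e < N * pi" by linarith
    have "0 < K * l e" using K l0[OF that] by simp
    then have "0 < real N * pi" using * by linarith
    then show "0 < N" by (simp add: zero_less_mult_iff)
    then show "K * (l e / N) < pi" using * by (simp add: divide_less_eq mult.commute)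
  qed
  have N0: "0 < N" using short(2) e0 by blast
  define F0 where "F0 = insert e0 T"
  define A where "A = arcs G - F0"
  have F0: "F0 \<subseteq> arcs G" using e0 T_arcs by (auto simp: F0_def)
  have A: "finite A" "A \<inter> F0 = {}" "F0 \<union> A = arcs G" using F0 by (auto simp: A_def)
  have Aends: "(tail G e = c \<and> head G e \<in> verts G - {c}) \<or> (head G e = c \<and> tail G e \<in> verts G - {c})" if "e \<in> A" for e
    using that apex_arc[of e] c_notin by (auto simp: A_def F0_def verts_eq)
  let ?last = "\<lambda>e. (e, if tail G e = c then 0 else N - 1)"
  let ?E = "arcs G \<times> {..<N}" and ?V = "sub_verts (verts G) (arcs G) N"
  let ?F = "F0 \<times> {..<N} \<union> (A \<times> {..<N} - ?last ` A)"
  have gr: "grown (sub_tail G N) (sub_head G N) (Inl c) ?V ?F"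
    using grown_subdivision_extra[OF grown_subdivision[OF spanning N0] N0 A(1) _ Aends] A
    unfolding F0_def[symmetric] by simp
  have FE: "?F \<subseteq> ?E" "finite ?E" using F0 by (auto simp: A_def)
  have EF: "?E - ?F = ?last ` A" using A N0 by (auto split: if_splits)
  have cardEF: "card (?E - ?F) = card A"
    unfolding EF by (rule card_image) (auto simp: inj_on_def)
  have bcard: "real (card A) = of_int (betti G)" by (simp add: betti_eq A_def F0_def)
  define w where "w = (\<lambda>p::'e \<times> nat. l (fst p) / N)"
  have sumw: "(\<Sum>p\<in>?E. w p) = total_length G l"
  proof -
    have "(\<Sum>p\<in>?E. w p) = (\<Sum>e\<in>arcs G. \<Sum>i<N. l e / N)"
      unfolding sum.cartesian_product by (simp add: w_def case_prod_unfold)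
    then show ?thesis using N0 by (simp add: total_length_def)
  qed
  have "\<exists>\<kappa>. 0 < \<kappa> \<and> \<kappa> \<le> K \<and> (\<exists>x. supported_in x ?V \<and> (\<exists>v. x v \<noteq> 0) \<and>
     (\<forall>y. supported_in y ?V \<longrightarrow> seg_form (sub_tail G N) (sub_head G N) (\<lambda>p. \<kappa> * w p) ?E x y = 0))"
  proof (rule ex_singular_frequency[OF gr FE _ K _ _ subdivided_degree[OF N0]])
    show "0 < w p" if "p \<in> ?E" for p using that l0 N0 by (auto simp: w_def)
    show "K * w p < pi" if "p \<in> ?E" for p using that short(1) by (auto simp: w_def)
    show "pi * (1 + card (?E - ?F)) < K * (\<Sum>p\<in>?E. w p)"
      unfolding cardEF sumw using long bcard by simp
    fix p assume "p \<in> ?E - ?F"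
    then obtain e where e: "e \<in> A" "p = ?last e" unfolding EF by blast
    have "e \<in> arcs G" using e by (simp add: A_def)
    show "(sub_tail G N p = Inl c \<and> sub_head G N p \<in> ?V - {Inl c}) \<or>
        (sub_head G N p = Inl c \<and> sub_tail G N p \<in> ?V - {Inl c})"
    proof (cases "tail G e = c")
      case True
      then have "sub_tail G N p = Inl c" using e by (simp add: sub_node_def)
      moreover have "sub_head G N p \<in> ?V - {Inl c}"
        using True e Aends[OF e(1)] N0 \<open>e \<in> arcs G\<close> by (auto simp: sub_node_def sub_verts_def)
      ultimately show ?thesis by blast
    next
      case False
      then have "sub_head G N p = Inl c" using e Aends[OF e(1)] N0 by (auto simp: sub_node_def)
      moreover have "sub_tail G N p \<in> ?V - {Inl c}"
        using False e Aends[OF e(1)] N0 \<open>e \<in> arcs G\<close> by (auto simp: sub_node_def sub_verts_def)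
      ultimately show ?thesis by blast
    qed
  qed
  then obtain \<kappa> x where \<kappa>: "0 < \<kappa>" "\<kappa> \<le> K" and x: "supported_in x ?V" "\<exists>v. x v \<noteq> 0"
    and sing: "\<And>y. supported_in y ?V \<Longrightarrow> seg_form (sub_tail G N) (sub_head G N) (\<lambda>p. \<kappa> * w p) ?E x y = 0"
    by blast
  have "neumann_eigenvalue G l (\<kappa>\<^sup>2)"
  proof (rule eigenvalue_of_singular_vector[OF fin_digraph_axioms l \<kappa>(1) N0 _ incident_arc x])
    show "\<kappa> * (l e / N) < pi" if "e \<in> arcs G" for e
    proof -
      have "\<kappa> * (l e / N) \<le> K * (l e / N)" using \<kappa> l0[OF that] by (intro mult_right_mono) auto
      then show ?thesis using short(1)[OF that] by linarith
    qed
  qed (use sing in \<open>simp_all add: w_def\<close>)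
  then show ?thesis using \<kappa> by blast
qed

lemma eigenvalue_nonneg:
  assumes "is_metric G l" "neumann_eigenvalue G l \<mu>"
  shows "0 \<le> \<mu>"
  using assms nonpositive_eigenfunction(2)[OF fin_digraph_axioms assms(1)]
  unfolding neumann_eigenvalue_def by (meson less_eq_real_def not_le)

definition two_eigenvalues_below :: "('e \<Rightarrow> real) \<Rightarrow> real set" where
  "two_eigenvalues_below l = {x. \<exists>S. finite S \<and> (\<forall>\<mu>\<in>S. neumann_eigenvalue G l \<mu> \<and> \<mu> \<le> x) \<and>
     1 < (\<Sum>\<mu>\<in>S. eigenvalue_multiplicity G l \<mu>)}"

lemma nth_eigenvalue_1: "nth_eigenvalue G l 1 = Inf (two_eigenvalues_below l)"
  unfolding nth_eigenvalue_def two_eigenvalues_below_def ..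

lemma zero_eigenvalue:
  assumes "is_metric G l"
  shows "eigenvalue_multiplicity G l 0 = 1" "neumann_eigenvalue G l 0"
proof -
  have "arcs G \<noteq> {}" "insert e0 T \<subseteq> arcs G" using e0 T_arcs by auto
  from multiplicity_zero[OF fin_digraph_axioms this(1) assms spanning this(2)]
  show "eigenvalue_multiplicity G l 0 = 1" "neumann_eigenvalue G l 0" by auto
qed

lemma positive_eigenvalue_in:
  assumes l: "is_metric G l" and \<kappa>: "0 < \<kappa>" "neumann_eigenvalue G l (\<kappa>\<^sup>2)"
  shows "\<kappa>\<^sup>2 \<in> two_eigenvalues_below l"
proof -
  have "1 < (\<Sum>\<mu>\<in>{0, \<kappa>\<^sup>2}. eigenvalue_multiplicity G l \<mu>)"
    using multiplicity_positive[OF fin_digraph_axioms l \<kappa>] zero_eigenvalue(1)[OF l] \<kappa>(1) by simp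
  then show ?thesis
    unfolding two_eigenvalues_below_def
    using zero_eigenvalue(2)[OF l] \<kappa> by (intro CollectI exI[of _ "{0, \<kappa>\<^sup>2}"]) auto
qed

lemma nth_eigenvalue_1_le:
  assumes l: "is_metric G l" and \<kappa>: "0 < \<kappa>" "neumann_eigenvalue G l (\<kappa>\<^sup>2)"
  shows "nth_eigenvalue G l 1 \<le> \<kappa>\<^sup>2"
  unfolding nth_eigenvalue_1
proof (rule cInf_lower[OF positive_eigenvalue_in[OF l \<kappa>]])
  show "bdd_below (two_eigenvalues_below l)"
    unfolding two_eigenvalues_below_def
  proof (rule bdd_belowI[of _ 0], clarify)
    fix x S assume S: "\<forall>\<mu>\<in>S. neumann_eigenvalue G l \<mu> \<and> \<mu> \<le> x" "1 < (\<Sum>\<mu>\<in>S. eigenvalue_multiplicity G l \<mu>)"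
    then obtain \<mu> where "\<mu> \<in> S" by fastforce
    then show "0 \<le> x" using S(1) eigenvalue_nonneg[OF l, of \<mu>] by force
  qed
qed

lemma nth_eigenvalue_1_ge:
  assumes l: "is_metric G l" and gap: "\<And>\<kappa>. 0 < \<kappa> \<Longrightarrow> neumann_eigenvalue G l (\<kappa>\<^sup>2) \<Longrightarrow> m \<le> \<kappa>\<^sup>2"
    and ex: "0 < \<kappa>" "neumann_eigenvalue G l (\<kappa>\<^sup>2)"
  shows "m \<le> nth_eigenvalue G l 1"
  unfolding nth_eigenvalue_1
proof (rule cInf_greatest)
  show "two_eigenvalues_below l \<noteq> {}" using positive_eigenvalue_in[OF l ex] by blast
  fix x assume "x \<in> two_eigenvalues_below l"
  then obtain S where S: "finite S" "\<forall>\<mu>\<in>S. neumann_eigenvalue G l \<mu> \<and> \<mu> \<le> x"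
    "1 < (\<Sum>\<mu>\<in>S. eigenvalue_multiplicity G l \<mu>)" unfolding two_eigenvalues_below_def by blast
  have "\<not> S \<subseteq> {0}"
  proof
    assume "S \<subseteq> {0}"
    then have "S = {} \<or> S = {0}" by blast
    then show False using S(3) zero_eigenvalue(1)[OF l] by auto
  qed
  then obtain \<mu> where \<mu>: "\<mu> \<in> S" "\<mu> \<noteq> 0" by blast
  then have "0 < \<mu>" using S(2) eigenvalue_nonneg[OF l, of \<mu>] by force
  then have "m \<le> (sqrt \<mu>)\<^sup>2" using gap[of "sqrt \<mu>"] S(2) \<mu>(1) by simp
  then show "m \<le> x" using \<open>0 < \<mu>\<close> S(2) \<mu>(1) by force
qed

text \<open>
  There is an eigenvalue in \<open>(0, K\<^sup>2]\<close> for every \<open>K > K0 = \<pi> (1 + \<beta>) / L\<close>; let \<open>K\<close> tend to \<open>K0\<close>.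
\<close>
lemma upper_bound:
  assumes l: "is_metric G l"
  shows "nth_eigenvalue G l 1 \<le> (1 + of_int (betti G))\<^sup>2 * pi\<^sup>2 / (total_length G l)\<^sup>2"
proof -
  define L where "L = total_length G l"
  have "0 < (\<Sum>e\<in>arcs G. l e)" using e0 l by (intro sum_pos) (auto simp: is_metric_def)
  then have L: "0 < L" by (simp add: L_def total_length_def)
  define K0 where "K0 = pi * (1 + of_int (betti G)) / L"
  have K0: "0 < K0" using L by (simp add: K0_def betti_eq add_pos_nonneg)
  have "nth_eigenvalue G l 1 \<le> K0\<^sup>2"
  proof (rule ccontr)
    assume "\<not> ?thesis"
    then have "K0 < sqrt (nth_eigenvalue G l 1)" using K0 by (simp add: real_less_rsqrt)
    then obtain K where K: "K0 < K" "K < sqrt (nth_eigenvalue G l 1)" using dense by blast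
    have "pi * (1 + of_int (betti G)) < K * total_length G l"
      using K(1) L by (simp add: K0_def L_def divide_less_eq)
    then obtain \<kappa> where \<kappa>: "0 < \<kappa>" "\<kappa> \<le> K" "neumann_eigenvalue G l (\<kappa>\<^sup>2)"
      using ex_eigenvalue_below[OF l, of K] K K0 by auto
    then have "nth_eigenvalue G l 1 \<le> \<kappa>\<^sup>2" using nth_eigenvalue_1_le[OF l] by blast
    also have "\<dots> \<le> K\<^sup>2" using \<kappa> by (intro power_mono) auto
    finally have "sqrt (nth_eigenvalue G l 1) \<le> K" using K K0 by (intro real_le_lsqrt) auto
    then show False using K by simp
  qed
  then show ?thesis by (simp add: K0_def L_def power_divide power_mult_distrib mult.commute)
qed

end

section \<open>The lower bound\<close>

lemma mult_cos_le_sin: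
  fixes x :: real
  assumes "0 \<le> x" "x \<le> pi"
  shows "x * cos x \<le> sin x"
proof -
  have "sin 0 - 0 * cos 0 \<le> sin x - x * cos x"
  proof (rule DERIV_nonneg_imp_nondecreasing[OF assms(1)])
    fix y assume y: "0 \<le> y" "y \<le> x"
    have "((\<lambda>x. sin x - x * cos x) has_real_derivative y * sin y) (at y)"
      by (auto intro!: derivative_eq_intros)
    moreover have "0 \<le> y * sin y" using y assms by (simp add: sin_ge_zero)
    ultimately show "\<exists>d. ((\<lambda>x. sin x - x * cos x) has_real_derivative d) (at y) \<and> 0 \<le> d" by blast
  qed
  then show ?thesis by simp
qed

text \<open>
  Apply \<open>t cos t \<le> sin t\<close> to \<open>t = \<kappa> / 2\<close> and double the angle.  This bounds \<open>sin \<kappa> / \<kappa>\<close> below,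
  uniformly for \<open>\<kappa>\<close> bounded away from \<open>\<pi>\<close>.
\<close>
lemma sin_ge_mult_cos_half:
  fixes \<kappa> :: real
  assumes "0 \<le> \<kappa>" "\<kappa> \<le> pi"
  shows "\<kappa> * (1 + cos \<kappa>) / 2 \<le> sin \<kappa>"
proof -
  have c: "0 \<le> cos (\<kappa> / 2)" using assms by (intro cos_ge_zero) auto
  have cos\<kappa>: "1 + cos \<kappa> = 2 * (cos (\<kappa> / 2))\<^sup>2" using cos_double_cos[of "\<kappa> / 2"] by simp
  have "\<kappa> * (1 + cos \<kappa>) / 2 = 2 * (\<kappa> / 2 * cos (\<kappa> / 2)) * cos (\<kappa> / 2)"
    unfolding cos\<kappa> by (simp add: power2_eq_square)
  also have "\<dots> \<le> 2 * sin (\<kappa> / 2) * cos (\<kappa> / 2)"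
    using mult_cos_le_sin[of "\<kappa> / 2"] assms c by (intro mult_right_mono) auto
  also have "\<dots> = sin \<kappa>" using sin_double[of "\<kappa> / 2"] by simp
  finally show ?thesis .
qed

text \<open>
  The converse of \<open>eigenvalue_of_singular_vector\<close> for short edges: the vertex values of an
  eigenfunction form a singular vector, because its outgoing derivatives are the linear expressions
  in the end values that occur in the form.  They do not all vanish, as no edge is long enough for
  a nonzero solution that vanishes at both ends.
\<close>
lemma singular_vector_of_eigenvalue:
  assumes G: "fin_digraph G" and l: "is_metric G l" and \<kappa>: "0 < \<kappa>"
    and short: "\<And>e. e \<in> arcs G \<Longrightarrow> \<kappa> * l e < pi" and ev: "neumann_eigenvalue G l (\<kappa>\<^sup>2)"
  shows "\<exists>x. (\<exists>v\<in>verts G. x v \<noteq> 0) \<and> (\<forall>y. seg_form (tail G) (head G) (\<lambda>e. \<kappa> * l e) (arcs G) x y = 0)"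
proof -
  interpret fin_digraph G by fact
  obtain f \<phi> g where zero: "\<And>e x. \<not> (e \<in> arcs G \<and> x \<in> {0..l e}) \<Longrightarrow> f e x = 0" and f0: "f \<noteq> 0"
    and \<phi>: "\<And>e. e \<in> arcs G \<Longrightarrow> f e 0 = \<phi> (tail G e) \<and> f e (l e) = \<phi> (head G e)"
    and df: "\<And>e x. e \<in> arcs G \<Longrightarrow> x \<in> {0..l e} \<Longrightarrow> (f e has_real_derivative g e x) (at x within {0..l e})"
    and dg: "\<And>e x. e \<in> arcs G \<Longrightarrow> x \<in> {0..l e} \<Longrightarrow> (g e has_real_derivative - (\<kappa>\<^sup>2 * f e x)) (at x within {0..l e})"
    and kirch: "\<And>v. v \<in> verts G \<Longrightarrow> (\<Sum>e \<in> out_arcs G v. g e 0) + (\<Sum>e \<in> in_arcs G v. - g e (l e)) = 0"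
    using ev unfolding neumann_eigenvalue_def neumann_eigenspace_def by blast
  have l0: "0 < l e" if "e \<in> arcs G" for e using l that by (simp add: is_metric_def)
  have sin0: "0 < sin (\<kappa> * l e)" if "e \<in> arcs G" for e
    using short[OF that] l0[OF that] \<kappa> by (intro sin_gt_zero) auto
  have sol: "f e x = f e 0 * cos (\<kappa> * x) + g e 0 / \<kappa> * sin (\<kappa> * x)"
      "g e x = - \<kappa> * f e 0 * sin (\<kappa> * x) + g e 0 * cos (\<kappa> * x)" if "e \<in> arcs G" "x \<in> {0..l e}" for e x
    using harmonic_oscillator[OF \<kappa> df[OF that(1)] dg[OF that(1)] that(2)] by blast+
  have ends: "\<phi> (head G e) = \<phi> (tail G e) * cos (\<kappa> * l e) + g e 0 / \<kappa> * sin (\<kappa> * l e)"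
    "g e (l e) = - \<kappa> * \<phi> (tail G e) * sin (\<kappa> * l e) + g e 0 * cos (\<kappa> * l e)" if "e \<in> arcs G" for e
    using sol[of e "l e"] \<phi>[OF that] l0[OF that] that by auto
  have t: "(\<phi> (tail G e) * cos (\<kappa> * l e) - \<phi> (head G e)) / sin (\<kappa> * l e) = - g e 0 / \<kappa>" if "e \<in> arcs G" for e
    using sin0[OF that] unfolding ends(1)[OF that] by simp
  have h: "(\<phi> (head G e) * cos (\<kappa> * l e) - \<phi> (tail G e)) / sin (\<kappa> * l e) = g e (l e) / \<kappa>" if "e \<in> arcs G" for e
  proof -
    define C Sn where "C = cos (\<kappa> * l e)" and "Sn = sin (\<kappa> * l e)"
    have "C * C = 1 - Sn * Sn" using sin_cos_squared_add[of "\<kappa> * l e"] by (simp add: C_def Sn_def power2_eq_square)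
    then have "\<phi> (tail G e) * (C * C) = \<phi> (tail G e) * (1 - Sn * Sn)" by (rule arg_cong)
    then have "\<phi> (tail G e) * (C * C) = \<phi> (tail G e) - \<phi> (tail G e) * Sn * Sn" by (simp only: right_diff_distrib mult.assoc mult_1_right)
    then have "\<phi> (head G e) * C - \<phi> (tail G e) = Sn * (g e 0 / \<kappa> * C - \<phi> (tail G e) * Sn)"
      unfolding ends(1)[OF that] C_def[symmetric] Sn_def[symmetric] by (simp add: algebra_simps)
    moreover have "g e (l e) / \<kappa> = g e 0 / \<kappa> * C - \<phi> (tail G e) * Sn"
      unfolding ends(2)[OF that] C_def Sn_def using \<kappa> by (simp add: field_simps)
    ultimately show ?thesis using sin0[OF that] by (simp add: C_def Sn_def)
  qed
  have "seg_form (tail G) (head G) (\<lambda>e. \<kappa> * l e) (arcs G) \<phi> y = 0" for y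
  proof -
    have "seg_form (tail G) (head G) (\<lambda>e. \<kappa> * l e) (arcs G) \<phi> y
      = (\<Sum>e\<in>arcs G. y (tail G e) * (- g e 0 / \<kappa>) + y (head G e) * (g e (l e) / \<kappa>))"
      unfolding seg_form_def
      by (intro sum.cong refl, subst t[symmetric], assumption, subst h[symmetric], assumption)
        (simp add: add_divide_distrib[symmetric] algebra_simps)
    also have "\<dots> = (\<Sum>e\<in>arcs G. y (tail G e) * (- g e 0 / \<kappa>)) + (\<Sum>e\<in>arcs G. y (head G e) * (g e (l e) / \<kappa>))"
      by (rule sum.distrib)
    also have "(\<Sum>e\<in>arcs G. y (tail G e) * (- g e 0 / \<kappa>)) = (\<Sum>v\<in>verts G. \<Sum>e\<in>out_arcs G v. y v * (- g e 0 / \<kappa>))"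
      unfolding sum_over_arcs_by_vertex(1)[OF G] by (intro sum.cong refl) auto
    also have "(\<Sum>e\<in>arcs G. y (head G e) * (g e (l e) / \<kappa>)) = (\<Sum>v\<in>verts G. \<Sum>e\<in>in_arcs G v. y v * (g e (l e) / \<kappa>))"
      unfolding sum_over_arcs_by_vertex(2)[OF G] by (intro sum.cong refl) auto
    also have "(\<Sum>v\<in>verts G. \<Sum>e\<in>out_arcs G v. y v * (- g e 0 / \<kappa>)) + (\<Sum>v\<in>verts G. \<Sum>e\<in>in_arcs G v. y v * (g e (l e) / \<kappa>))
      = (\<Sum>v\<in>verts G. - y v / \<kappa> * ((\<Sum>e \<in> out_arcs G v. g e 0) + (\<Sum>e \<in> in_arcs G v. - g e (l e))))"
      unfolding sum.distrib[symmetric] distrib_left sum_distrib_left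
      by (intro sum.cong refl arg_cong2[of _ _ _ _ "(+)"]) auto
    also have "\<dots> = 0" using kirch by simp
    finally show ?thesis .
  qed
  moreover have "\<exists>v\<in>verts G. \<phi> v \<noteq> 0"
  proof (rule ccontr)
    assume "\<not> ?thesis"
    then have \<phi>0: "\<phi> (tail G e) = 0" "\<phi> (head G e) = 0" if "e \<in> arcs G" for e using that by auto
    have "f e x = 0" for e x
    proof (cases "e \<in> arcs G \<and> x \<in> {0..l e}")
      case True
      then have "g e 0 = 0" using ends(1)[of e] \<phi>0[of e] sin0[of e] \<kappa> by simp
      then show ?thesis using sol(1)[of e x] True \<phi>[of e] \<phi>0[of e] by simp
    qed (rule zero)
    then show False using f0 by (auto simp: fun_eq_iff)
  qed
  ultimately show ?thesis by blast
qed

context apex_tree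
begin

definition contracted :: "real \<Rightarrow> 'e \<Rightarrow> real" where
  "contracted \<delta> e = (if e \<in> T then \<delta> else 1)"

lemma card_apex_arcs_pos: "0 < card (arcs G - T)"
  using e0 by (auto simp: card_gt_0_iff)

text \<open>
  On a single edge of length 1 between the values \<open>- M\<close> and \<open>M\<close> the form is
  \<open>2 M\<^sup>2 (1 + cos \<kappa>) / sin \<kappa>\<close>, positive for \<open>\<kappa> < \<pi>\<close>.  The values on the tree differ from \<open>M = x r\<close> by an
  oscillation controlled by \<open>D\<close>, the sum of the squared differences along the tree arcs.  The tree
  arcs contribute a multiple of \<open>D / \<delta>\<close>, which for small \<open>\<delta>\<close> outweighs all errors: of order \<open>D\<close> from
  the arcs at \<open>c\<close>, and of order \<open>\<delta> (M\<^sup>2 + D)\<close> from the tree arcs.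
\<close>
lemma contracted_form_positive:
  fixes q :: real
  assumes q: "0 < q" "q < pi"
  shows "\<exists>\<delta>>0. \<delta> \<le> 1 \<and> (\<forall>\<kappa> x. 0 < \<kappa> \<longrightarrow> \<kappa> \<le> q \<longrightarrow> x c = - x r \<longrightarrow> (\<exists>v\<in>verts G. x v \<noteq> 0) \<longrightarrow>
     0 < seg_form (tail G) (head G) (\<lambda>e. \<kappa> * contracted \<delta> e) (arcs G) x x)"
proof -
  define n d :: real where "n = card T" and "d = card (arcs G - T)"
  define \<eta> where "\<eta> = 1 + cos q"
  have n0: "0 \<le> n" and d1: "1 \<le> d" using card_apex_arcs_pos by (simp_all add: n_def d_def)
  have "cos pi < cos q" using q by (intro cos_monotone_0_pi) auto
  then have \<eta>: "0 < \<eta>" "\<eta> \<le> 2" by (simp_all add: \<eta>_def)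
  \<comment> \<open>The summands of \<open>Z\<close> provide, in this order, \<open>\<delta> \<le> 1/2\<close>, \<open>P < d \<eta>\<close>, and the two parts of \<open>Dcoef\<close>.\<close>
  define Z where "Z = 4 + 8 * (n * pi) + 2 * (d * n) + 8 * (n * pi * n)"
  have Z: "4 \<le> Z" using n0 d1 by (simp add: Z_def)
  define \<delta> where "\<delta> = \<eta> / Z"
  have \<delta>Z: "\<delta> * Z = \<eta>" using Z by (simp add: \<delta>_def)
  have \<delta>0: "0 < \<delta>" using \<eta> Z by (simp add: \<delta>_def)
  have \<delta>half: "\<delta> \<le> 1 / 2"
  proof -
    have "\<delta> * 4 \<le> \<delta> * Z" using \<delta>0 Z by (intro mult_left_mono) auto
    then show ?thesis using \<delta>Z \<eta> by linarith
  qed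
  define P where "P = 4 * (n * pi) * \<delta>"
  have P: "P < d * \<eta>"
  proof -
    have "0 \<le> n * pi" "0 \<le> d * n" "0 \<le> n * pi * n" using n0 d1 by simp_all
    then have "4 * (n * pi) < Z" unfolding Z_def by linarith
    then have "4 * (n * pi) * \<delta> < Z * \<delta>" using \<delta>0 by (rule mult_strict_right_mono)
    then have "P < \<eta>" using \<delta>Z by (simp add: P_def mult.commute)
    moreover have "1 * \<eta> \<le> d * \<eta>" using d1 \<eta> by (intro mult_right_mono) auto
    ultimately show ?thesis by simp
  qed
  have Dcoef: "d * n + P * n < \<eta> / (2 * \<delta>)"
  proof -
    have half: "\<eta> / (2 * \<delta>) = Z / 2" using \<delta>0 \<delta>Z[symmetric] by simp
    have "P * n \<le> 4 * (n * pi) * n"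
    proof -
      have "4 * (n * pi) * \<delta> \<le> 4 * (n * pi) * 1" using \<delta>half n0 by (intro mult_left_mono) auto
      then show ?thesis unfolding P_def using n0 by (intro mult_right_mono) auto
    qed
    moreover have "0 \<le> n * pi" using n0 by simp
    ultimately show ?thesis unfolding half Z_def mult.assoc by argo
  qed
  have "0 < seg_form (tail G) (head G) (\<lambda>e. \<kappa> * contracted \<delta> e) (arcs G) x x"
    if \<kappa>: "0 < \<kappa>" "\<kappa> \<le> q" and x: "x c = - x r" "\<exists>v\<in>verts G. x v \<noteq> 0" for \<kappa> :: real and x
  proof -
    define M where "M = x r"
    define D where "D = (\<Sum>e\<in>T. (x (tail G e) - x (head G e))\<^sup>2)"
    have D0: "0 \<le> D" by (auto simp: D_def intro: sum_nonneg)
    have osc: "(x v - M)\<^sup>2 \<le> n * D" if "v \<in> S" for v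
      using grown_oscillation[OF tree that, of x] by (simp add: M_def D_def n_def)
    have sq: "(x v)\<^sup>2 \<le> 2 * M\<^sup>2 + 2 * (n * D)" if "v \<in> S" for v
    proof -
      have "0 \<le> (x v - 2 * M)\<^sup>2" by simp
      then have "(x v)\<^sup>2 \<le> 2 * M\<^sup>2 + 2 * (x v - M)\<^sup>2" by (simp add: power2_eq_square algebra_simps)
      then show ?thesis using osc[OF that] by linarith
    qed
    have sin\<kappa>: "0 < sin \<kappa>" using \<kappa> q by (intro sin_gt_zero) auto
    have cos\<kappa>: "\<eta> \<le> 1 + cos \<kappa>" using \<kappa> q unfolding \<eta>_def by (simp add: cos_monotone_0_pi_le)
    have sin_low: "\<kappa> * \<eta> / 2 \<le> sin \<kappa>"
    proof -
      have "\<kappa> * \<eta> \<le> \<kappa> * (1 + cos \<kappa>)" using cos\<kappa> \<kappa> by (intro mult_left_mono) auto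
      then show ?thesis using sin_ge_mult_cos_half[of \<kappa>] \<kappa> q by linarith
    qed
    define energy where "energy = (\<lambda>e. ((x (tail G e) * x (tail G e) + x (head G e) * x (head G e)) * cos (\<kappa> * contracted \<delta> e)
       - x (tail G e) * x (head G e) - x (head G e) * x (tail G e)) / sin (\<kappa> * contracted \<delta> e))"
    have form: "seg_form (tail G) (head G) (\<lambda>e. \<kappa> * contracted \<delta> e) (arcs G) x x
       = (\<Sum>e\<in>arcs G - T. energy e) + (\<Sum>e\<in>T. energy e)"
      unfolding seg_form_def energy_def by (rule sum.subset_diff[OF T_arcs finite_arcs])
    have apex: "\<eta> * M\<^sup>2 - n * D \<le> sin \<kappa> * energy e" if e: "e \<in> arcs G - T" for e
    proof -
      obtain z where z: "z \<in> S" "(tail G e = c \<and> head G e = z) \<or> (head G e = c \<and> tail G e = z)"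
        using apex_arc[OF e] by blast
      have "energy e = ((M\<^sup>2 + (x z)\<^sup>2) * cos \<kappa> + 2 * M * x z) / sin \<kappa>"
        using z(2) x(1) e by (auto simp: energy_def contracted_def M_def power2_eq_square algebra_simps)
      then have "sin \<kappa> * energy e = (M\<^sup>2 + (x z)\<^sup>2) * cos \<kappa> + 2 * M * x z" using sin\<kappa> by simp
      also have "\<dots> = (1 + cos \<kappa>) * (M\<^sup>2 + (x z)\<^sup>2) - (x z - M)\<^sup>2"
        by (simp add: power2_eq_square algebra_simps)
      finally have "sin \<kappa> * energy e = (1 + cos \<kappa>) * (M\<^sup>2 + (x z)\<^sup>2) - (x z - M)\<^sup>2" .
      moreover have "\<eta> * M\<^sup>2 \<le> (1 + cos \<kappa>) * (M\<^sup>2 + (x z)\<^sup>2)"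
        using cos\<kappa> \<eta> by (intro mult_mono) auto
      ultimately show ?thesis using osc[OF z(1)] by linarith
    qed
    have inner: "\<eta> / (2 * \<delta>) * (x (tail G e) - x (head G e))\<^sup>2 - pi * \<delta> * (4 * M\<^sup>2 + 4 * (n * D)) \<le> sin \<kappa> * energy e"
      if e: "e \<in> T" for e
    proof -
      define s where "s = \<kappa> * \<delta>"
      have "s \<le> pi * (1/2)" unfolding s_def using \<kappa> q \<delta>half \<delta>0 by (intro mult_mono) auto
      then have s: "0 < s" "s \<le> pi / 2" using \<kappa> \<delta>0 by (auto simp: s_def)
      have sins: "0 < sin s" "sin s \<le> s" using s by (auto intro!: sin_gt_zero sin_x_le_x)
      define \<Delta> where "\<Delta> = (x (tail G e) - x (head G e))\<^sup>2"
      define R where "R = (x (tail G e))\<^sup>2 + (x (head G e))\<^sup>2"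
      have te: "energy e = \<Delta> / sin s - (1 - cos s) / sin s * R"
        unfolding times_divide_eq_left diff_divide_distrib[symmetric] using e
        by (simp add: energy_def contracted_def s_def \<Delta>_def R_def power2_eq_square algebra_simps)
      have ends: "tail G e \<in> S" "head G e \<in> S" using grown_basic[OF tree] e by auto
      have R: "0 \<le> R" "R \<le> 4 * M\<^sup>2 + 4 * (n * D)" using sq[OF ends(1)] sq[OF ends(2)] by (auto simp: R_def)
      have "\<eta> / (2 * \<delta>) \<le> sin \<kappa> / sin s"
      proof -
        have "\<eta> / (2 * \<delta>) = (\<kappa> * \<eta> / 2) / s" using \<kappa> \<delta>0 by (simp add: s_def)
        also have "\<dots> \<le> sin \<kappa> / s" using sin_low s by (intro divide_right_mono) auto
        also have "\<dots> \<le> sin \<kappa> / sin s" using sins sin\<kappa> by (intro divide_left_mono) auto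
        finally show ?thesis .
      qed
      then have 1: "\<eta> / (2 * \<delta>) * \<Delta> \<le> sin \<kappa> / sin s * \<Delta>" by (intro mult_right_mono) (auto simp: \<Delta>_def)
      have "sin \<kappa> * ((1 - cos s) / sin s) \<le> 1 * (pi * \<delta>)"
      proof (rule mult_mono)
        have "s \<le> pi * \<delta>" unfolding s_def using \<kappa> q \<delta>0 by (intro mult_right_mono) auto
        then show "(1 - cos s) / sin s \<le> pi * \<delta>" using tan_half_le[OF s] by linarith
      qed (use sins in auto)
      then have "sin \<kappa> * ((1 - cos s) / sin s) * R \<le> (1 * (pi * \<delta>)) * R"
        using R(1) by (rule mult_right_mono)
      also have "\<dots> \<le> pi * \<delta> * (4 * M\<^sup>2 + 4 * (n * D))"
        unfolding mult_1_left using R(2) \<delta>0 by (intro mult_left_mono) auto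
      finally have "sin \<kappa> * ((1 - cos s) / sin s) * R \<le> pi * \<delta> * (4 * M\<^sup>2 + 4 * (n * D))" .
      with 1 show ?thesis unfolding te \<Delta>_def[symmetric] by (simp add: algebra_simps)
    qed
    have "(d * \<eta> - P) * M\<^sup>2 + (\<eta> / (2 * \<delta>) - (d * n + P * n)) * D
      = (\<Sum>e\<in>arcs G - T. \<eta> * M\<^sup>2 - n * D) +
        (\<Sum>e\<in>T. \<eta> / (2 * \<delta>) * (x (tail G e) - x (head G e))\<^sup>2 - pi * \<delta> * (4 * M\<^sup>2 + 4 * (n * D)))"
      unfolding sum_subtractf sum_distrib_left[symmetric] D_def[symmetric]
      by (simp add: d_def n_def P_def algebra_simps)
    also have "\<dots> \<le> (\<Sum>e\<in>arcs G - T. sin \<kappa> * energy e) + (\<Sum>e\<in>T. sin \<kappa> * energy e)"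
      by (intro add_mono sum_mono apex inner)
    also have "\<dots> = sin \<kappa> * seg_form (tail G) (head G) (\<lambda>e. \<kappa> * contracted \<delta> e) (arcs G) x x"
      unfolding form by (simp add: sum_distrib_left distrib_left)
    finally have low: "(d * \<eta> - P) * M\<^sup>2 + (\<eta> / (2 * \<delta>) - (d * n + P * n)) * D
      \<le> sin \<kappa> * seg_form (tail G) (head G) (\<lambda>e. \<kappa> * contracted \<delta> e) (arcs G) x x" .
    have "M \<noteq> 0 \<or> D \<noteq> 0"
    proof (rule ccontr)
      assume MD: "\<not> ?thesis"
      then have "x v = 0" if "v \<in> S" for v using osc[OF that] by simp
      moreover have "x c = 0" using x(1) MD by (simp add: M_def)
      ultimately show False using x(2) by (auto simp: verts_eq)
    qed
    then have "0 < (d * \<eta> - P) * M\<^sup>2 + (\<eta> / (2 * \<delta>) - (d * n + P * n)) * D"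
    proof
      assume "M \<noteq> 0"
      then show ?thesis using P Dcoef D0 by (intro add_pos_nonneg mult_pos_pos mult_nonneg_nonneg) auto
    next
      assume "D \<noteq> 0"
      then show ?thesis using P Dcoef D0 by (intro add_nonneg_pos mult_pos_pos mult_nonneg_nonneg) auto
    qed
    then have "0 < sin \<kappa> * seg_form (tail G) (head G) (\<lambda>e. \<kappa> * contracted \<delta> e) (arcs G) x x"
      using low by linarith
    then show ?thesis using sin\<kappa> by (simp add: zero_less_mult_iff)
  qed
  then show ?thesis using \<delta>0 \<delta>half by (intro exI[of _ \<delta>]) auto
qed

text \<open>
  Let \<open>x\<close> be a singular vector and \<open>y = x + t\<close> with \<open>t\<close> chosen such that \<open>y c = - y r\<close>.  Singularity gives
  \<open>Q y = t\<^sup>2 Q 1 \<le> 0\<close>, so \<open>y = 0\<close> by positivity.  Then \<open>x\<close> is constant, and \<open>Q 1 < 0\<close> forces it to be 0.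
\<close>
lemma contracted_spectral_gap:
  assumes q: "0 < q" "q < pi"
  shows "\<exists>\<delta>>0. \<forall>\<kappa>. 0 < \<kappa> \<longrightarrow> \<kappa> \<le> q \<longrightarrow> \<not> neumann_eigenvalue G (contracted \<delta>) (\<kappa>\<^sup>2)"
proof -
  obtain \<delta> where \<delta>: "0 < \<delta>" "\<delta> \<le> 1"
    and pos: "\<And>\<kappa> x. 0 < \<kappa> \<Longrightarrow> \<kappa> \<le> q \<Longrightarrow> x c = - x r \<Longrightarrow> \<exists>v\<in>verts G. x v \<noteq> 0 \<Longrightarrow>
     0 < seg_form (tail G) (head G) (\<lambda>e. \<kappa> * contracted \<delta> e) (arcs G) x x"
    using contracted_form_positive[OF q] by blast
  have "\<not> neumann_eigenvalue G (contracted \<delta>) (\<kappa>\<^sup>2)" if \<kappa>: "0 < \<kappa>" "\<kappa> \<le> q" for \<kappa>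
  proof
    assume ev: "neumann_eigenvalue G (contracted \<delta>) (\<kappa>\<^sup>2)"
    have s: "0 < \<kappa> * contracted \<delta> e" "\<kappa> * contracted \<delta> e < pi" for e
    proof -
      show "0 < \<kappa> * contracted \<delta> e" using \<kappa> \<delta> by (simp add: contracted_def)
      have "\<kappa> * contracted \<delta> e \<le> \<kappa> * 1" using \<kappa> \<delta> by (intro mult_left_mono) (auto simp: contracted_def)
      then show "\<kappa> * contracted \<delta> e < pi" using \<kappa> q by linarith
    qed
    have m: "is_metric G (contracted \<delta>)" using \<delta> by (simp add: is_metric_def contracted_def)
    let ?B = "seg_form (tail G) (head G) (\<lambda>e. \<kappa> * contracted \<delta> e) (arcs G)"
    obtain x where x: "\<exists>v\<in>verts G. x v \<noteq> 0" "\<And>y. ?B x y = 0"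
      using singular_vector_of_eigenvalue[OF fin_digraph_axioms m \<kappa>(1) s(2) ev] by blast
    define one :: "'v \<Rightarrow> real" where "one = (\<lambda>_. 1)"
    have "?B one one = (\<Sum>e\<in>arcs G. - ((1 - cos (\<kappa> * contracted \<delta> e)) / sin (\<kappa> * contracted \<delta> e) * 2))"
      unfolding seg_form_diagonal by (simp add: one_def del: times_divide_eq_left)
    also have "\<dots> < (\<Sum>e\<in>arcs G. 0)"
    proof (rule sum_strict_mono)
      fix e assume "e \<in> arcs G"
      have "cos (\<kappa> * contracted \<delta> e) < cos 0" using s[of e] by (intro cos_monotone_0_pi) auto
      moreover have "0 < sin (\<kappa> * contracted \<delta> e)" using s[of e] by (intro sin_gt_zero)
      ultimately show "- ((1 - cos (\<kappa> * contracted \<delta> e)) / sin (\<kappa> * contracted \<delta> e) * 2) < 0" by simp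
    qed (use e0 in auto)
    finally have one: "?B one one < 0" by simp
    define t where "t = - (x c + x r) / 2"
    define y where "y = (\<lambda>v. 1 * x v + t * one v)"
    have "?B y y = t\<^sup>2 * ?B one one"
      unfolding y_def symmetric_bilinear_combination[OF seg_form_symmetric_bilinear] using x(2) by simp
    then have "?B y y \<le> 0" using one by (simp add: mult_nonneg_nonpos)
    moreover have "y c = - y r" by (simp add: y_def t_def one_def field_simps)
    ultimately have y0: "y v = 0" if "v \<in> verts G" for v using pos[OF \<kappa>, of y] that by force
    have "?B y one = 0"
      unfolding seg_form_def using y0 by (intro sum.neutral) simp
    moreover have "?B y one = ?B x one + t * ?B one one"
    proof -
      have sym: "?B u v = ?B v u" for u v
        using seg_form_symmetric_bilinear unfolding symmetric_bilinear_def by blast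
      have lin: "linear_functional (?B one)"
        using seg_form_symmetric_bilinear unfolding symmetric_bilinear_def by blast
      have "?B one (\<lambda>v. x v + t * one v) = ?B one x + t * ?B one one" by (rule linear_functional_simps(1)[OF lin])
      then show ?thesis using sym[of y one] sym[of x one] by (simp add: y_def)
    qed
    ultimately have "t = 0" using x(2)[of one] one by simp
    then have "x v = 0" if "v \<in> verts G" for v using y0[OF that] by (simp add: y_def)
    then show False using x(1) by blast
  qed
  then show ?thesis using \<delta>(1) by blast
qed

text \<open>
  The contracted metrics have length at least \<open>d\<close> and first eigenvalue at least \<open>q\<^sup>2\<close>, for every \<open>q < \<pi>\<close>.
\<close>
lemma lower_bound:
  assumes C: "\<And>l. is_metric G l \<Longrightarrow> nth_eigenvalue G l 1 \<le> C / (total_length G l)\<^sup>2"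
  shows "(1 + of_int (betti G))\<^sup>2 * pi\<^sup>2 \<le> C"
proof -
  define d :: real where "d = card (arcs G - T)"
  have d: "1 \<le> d" "d = 1 + of_int (betti G)"
    using card_apex_arcs_pos apex_degree by (simp_all add: d_def)
  have bound: "d\<^sup>2 * q\<^sup>2 \<le> C" if q: "0 < q" "q < pi" for q
  proof -
    obtain \<delta> where \<delta>: "0 < \<delta>" "\<And>\<kappa>. 0 < \<kappa> \<Longrightarrow> \<kappa> \<le> q \<Longrightarrow> \<not> neumann_eigenvalue G (contracted \<delta>) (\<kappa>\<^sup>2)"
      using contracted_spectral_gap[OF q] by blast
    define L where "L = total_length G (contracted \<delta>)"
    have m: "is_metric G (contracted \<delta>)" using \<delta> by (simp add: is_metric_def contracted_def)
    have "L = (\<Sum>e\<in>arcs G - T. contracted \<delta> e) + (\<Sum>e\<in>T. contracted \<delta> e)"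
      unfolding L_def total_length_def by (rule sum.subset_diff[OF T_arcs finite_arcs])
    also have "(\<Sum>e\<in>arcs G - T. contracted \<delta> e) = d" by (simp add: contracted_def d_def)
    finally have L: "d \<le> L" using \<delta>(1) by (simp add: contracted_def)
    obtain \<kappa> where \<kappa>: "0 < \<kappa>" "neumann_eigenvalue G (contracted \<delta>) (\<kappa>\<^sup>2)"
    proof -
      \<comment> \<open>Any frequency above \<open>\<pi> d / L\<close> will do.\<close>
      define K where "K = (pi * d + 1) / L"
      have "0 < K" using L d by (simp add: K_def add_pos_pos)
      moreover have "pi * (1 + of_int (betti G)) < K * total_length G (contracted \<delta>)"
        using L d unfolding L_def[symmetric] d(2)[symmetric] by (simp add: K_def)
      ultimately show ?thesis using ex_eigenvalue_below[OF m] that by blast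
    qed
    have "q\<^sup>2 \<le> nth_eigenvalue G (contracted \<delta>) 1"
    proof (rule nth_eigenvalue_1_ge[OF m _ \<kappa>])
      fix \<kappa>' assume "0 < \<kappa>'" "neumann_eigenvalue G (contracted \<delta>) (\<kappa>'\<^sup>2)"
      then have "q \<le> \<kappa>'" using \<delta>(2)[of \<kappa>'] by force
      then show "q\<^sup>2 \<le> \<kappa>'\<^sup>2" using q by (intro power_mono) auto
    qed
    also have "\<dots> \<le> C / L\<^sup>2" unfolding L_def by (rule C[OF m])
    finally have "q\<^sup>2 * L\<^sup>2 \<le> C" using L d by (simp add: pos_le_divide_eq)
    moreover have "q\<^sup>2 * d\<^sup>2 \<le> q\<^sup>2 * L\<^sup>2" using L d by (intro mult_left_mono power_mono) auto
    ultimately show ?thesis by (simp add: mult.commute)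
  qed
  have "d\<^sup>2 * pi\<^sup>2 \<le> C"
  proof (rule tendsto_upperbound)
    show "((\<lambda>q. d\<^sup>2 * q\<^sup>2) \<longlongrightarrow> d\<^sup>2 * pi\<^sup>2) (at_left pi)" by (intro tendsto_intros)
    show "eventually (\<lambda>q. d\<^sup>2 * q\<^sup>2 \<le> C) (at_left pi)"
      using eventually_at_left_real[OF pi_gt_zero] by eventually_elim (use bound in auto)
  qed simp
  then show ?thesis by (simp add: d(2))
qed

lemma Lambda1_eq: "Lambda1 G = (1 + of_int (betti G))\<^sup>2 * pi\<^sup>2"
  unfolding Lambda1_def
  by (rule Least_equality) (use upper_bound lower_bound in auto)

end

section \<open>The value of the optimal constant\<close>

text \<open>
  Connectedness of the whole graph provides the arc from \<open>c\<close> to the tree and shows that no vertex has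
  degree 0; pendant vertices are excluded, so all degrees are at least 2.
\<close>
lemma ex_apex_tree:
  fixes G :: "('v, 'e) pre_digraph"
  assumes G: "fin_digraph G" and conn: "Digraph_Component.connected G" and loop: "loopfree_digraph G"
    and pend: "\<forall>v \<in> verts G. \<not> pendant G v"
    and S: "S \<subseteq> verts G" "card S = card (verts G) - 1" "undirected_tree (G \<restriction> S)"
  shows "\<exists>c r e0 T. apex_tree G c r e0 S T"
proof -
  interpret fin_digraph G by fact
  interpret loopfree_digraph G by fact
  have "S \<noteq> {}" using S(3) by (auto simp: undirected_tree_def connected_conv)
  then have "card (verts G) > 0" using S(1) by (auto simp: card_gt_0_iff)
  then have "card (verts G - S) = 1"
    using S card_Diff_subset[of S "verts G"] finite_subset[OF S(1)] by simp
  then obtain c where "verts G - S = {c}" by (auto simp: card_1_singleton_iff)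
  then have c: "verts G = insert c S" "c \<notin> S" using S(1) by auto
  define T where "T = arcs (G \<restriction> S)"
  have T: "T = {e \<in> arcs G. tail G e \<in> S \<and> head G e \<in> S}" by (simp add: T_def)
  have apex: "(tail G e = c \<and> head G e \<in> S) \<or> (head G e = c \<and> tail G e \<in> S)" if "e \<in> arcs G - T" for e
    using that no_loops[of e] wellformed[of e] c by (auto simp: T)
  have "\<not> verts G \<subseteq> {c}" using \<open>S \<noteq> {}\<close> c by auto
  then obtain e0 where e0: "e0 \<in> arcs G" "\<not> (tail G e0 \<in> {c} \<longleftrightarrow> head G e0 \<in> {c})"
    using connected_closed_vertex_set[OF wf_digraph_axioms conn, of c "{c}"] c by blast
  then have e0T: "e0 \<in> arcs G - T" using c by (auto simp: T)
  obtain r where r: "r \<in> S" "(tail G e0 = c \<and> head G e0 = r) \<or> (tail G e0 = r \<and> head G e0 = c)"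
    using apex[OF e0T] by blast
  have fin: "fin_digraph (G \<restriction> S)"
    using finite_subset[OF S(1)] by unfold_locales auto
  have tree: "grown (tail G) (head G) r S T"
    using undirected_tree_grown[OF fin S(3), of r] r by (simp add: T_def)
  have deg: "2 \<le> vertex_degree G v" if v: "v \<in> S" for v
  proof -
    have "grown (tail G) (head G) c (verts G) (insert e0 T)"
      unfolding c(1) by (rule grown_from_neighbour[OF tree c(2) r(2)])
    then obtain e where e: "e \<in> insert e0 T" "tail G e = v \<or> head G e = v"
      using grown_incident[of _ _ c "verts G" _ v] v c by blast
    then have "e \<in> out_arcs G v \<union> in_arcs G v" using e0 by (auto simp: T)
    moreover have "finite (out_arcs G v)" "finite (in_arcs G v)" by (simp_all add: out_arcs_def in_arcs_def)
    ultimately have "0 < card (out_arcs G v) \<or> 0 < card (in_arcs G v)" by (auto simp: card_gt_0_iff)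
    then have "vertex_degree G v \<noteq> 0" by (auto simp: vertex_degree_def out_degree_def in_degree_def)
    moreover have "vertex_degree G v \<noteq> 1" using pend v c by (auto simp: pendant_def)
    ultimately show ?thesis by simp
  qed
  have "apex_tree G c r e0 S T"
    by unfold_locales (use c tree T apex e0T r deg in auto)
  then show ?thesis by blast
qed

theorem theorem1p3:
  fixes G :: "('v, 'e) pre_digraph"
  assumes "fin_digraph G"
    and "Digraph_Component.connected G"
    and "arcs G \<noteq> {}"
    and "loopfree_digraph G"
    and "\<forall>v \<in> verts G. \<not> pendant G v"
    and "\<exists>S. S \<subseteq> verts G \<and> card S = card (verts G) - 1 \<and> undirected_tree (G \<restriction> S)"
  shows "Lambda1 G = (1 + of_int (betti G))\<^sup>2 * pi\<^sup>2"
proof -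
  obtain c r e0 S T where "apex_tree G c r e0 S T"
    using assms ex_apex_tree[OF assms(1,2,4,5)] by blast
  then show ?thesis by (rule apex_tree.Lambda1_eq)
qed

end
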